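(* Let $\alpha>0$, let $T=\mathbb R$ or $T=\mathbb Z$, and let $\{X_t\}_{t\in T}$ be a stationary $\alpha$-Fréchet process. Suppose that $X$ has a jointly measurable spectral representation $\{f_t\}_{t\in T}\subset L_+^\alpha(S_{I,N},\lambda_{I,N})$ which is minimal, with standardized support. Then there exists a unique, modulo $\lambda_{I,N}$, non-singular and measurable flow $\{\phi_t\}_{t\in T}$ on $(S_{I,N},\lambda_{I,N})$ such that for each $t\in T$, $$f_t(s)=\Big(\frac{d(\lambda_{I,N}\circ\phi_t)}{d\lambda_{I,N}}\Big)^{1/\alpha}(s)\,(f_0\circ\phi_t)(s)\quad\text{for }\lambda_{I,N}\text{-a.e. }s.$$
   Context: A random variable is $\alpha$-Fréchet with scale $\sigma>0$ if its distribution function is $\exp(-\sigma^\alpha x^{-\alpha})$, $x>0$; a process is $\alpha$-Fréchet if all $\max_{j\le n}a_jX_{t_j}$, $a_j>0$, are $\alpha$-Fréchet. $L_+^\alpha(S,\mu)$ is the set of measurable $f:S\to[0,\infty)$ with $\int_Sf^\alpha d\mu<\infty$, with metric $\rho_{\mu,\alpha}(f,g)=\int_S|f^\alpha-g^\alpha|d\mu$. $\{f_t\}\subset L_+^\alpha(S,\mu)$ is a spectral representation of $X$ if $P(X_{t_i}\le x_i,\,1\le i\le n)=\exp\{-\int_S(\bigvee_ix_i^{-1}f_{t_i})^\alpha d\mu\}$ for all $n$, $t_i\in T$, $x_i>0$; it is (jointly) measurable if $(t,s)\mapsto f_t(s)$ is product measurable. $\mathrm{supp}\{f_t:t\in T\}$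 is $\{g_0\neq0\}$ (mod $\mu$) for any $g_0$ in the $\rho_{\mu,\alpha}$-closure of the max-linear combinations $\bigvee_{i\le n}a_if_{t_i}$ ($a_i>0$) with $\mu(\{g\neq0\}\setminus\{g_0\neq0\})=0$ for all $g$ in that closure. $\rho(\{f_t\})$ is the $\sigma$-field generated by the ratios $f_t/f_{t'}$ with values in $[0,\infty]$ ($0/0:=0$). A representation is minimal if $\mathrm{supp}\{f_t:t\in T\}=S$ $\mu$-a.e. and for every measurable $B\subset S$ there is $A\in\rho(\{f_t\})$ with $\mu(A\Delta B)=0$. It has standardized support if, up to null sets, $(S,\mu)=(S_{I,N},\lambda_{I,N})$ for some $I\in\{0,1\}$, $N\in\{0,1,\dots\}\cup\{\infty\}$: $S_{I,N}\subset(0,1)\cup\mathbb N$, with $S_{I,N}\cap(0,1)=\emptyset$ if $I=0$, $(0,1)$ if $I=1$; $S_{I,N}\cap\mathbb N=\emptyset$, $\{1,\dots,N\}$, or $\mathbb N$ according as $N=0$, $N\in\mathbb N$, $N=\infty$; $\lambda_{I,N}$ is Lebesgue measure on the part in $(0,1)$ and counting measure on the part in $\mathbb N$. A flow on $(S,\mathcal B,\mu)$ is a family $\{\phi_t\}_{t\in T}$ of maps $S\to S$ with $\phi_{t_1+t_2}(s)=\phi_{t_2}(\phi_{t_1}(s))$ and $\phi_0(s)=s$ for all $t_1,t_2\in T$, $s\in S$. It is measurable if $(t,s)\mapsto\phi_t(s)$ is measurable from $T\times S$ to $S$, and non-singular if $\mu(\phi_t^{-1}(A))=0\Leftrightarrow\mu(A)=0$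 for all $A\in\mathcal B$, $t\in T$. For invertible $\phi$, $(\mu\circ\phi)(A)=\mu(\phi(A))$. Uniqueness modulo $\lambda_{I,N}$: two such flows agree $\lambda_{I,N}$-a.e. for each $t$. *)

theory Defs
  imports "HOL-Probability.Probability"
begin

text \<open>Both time sets are treated at once: \<open>T\<close> is a set of reals, namely \<open>UNIV\<close> or \<open>\<int>\<close>, with
  the \<open>\<sigma>\<close>-algebra \<open>restrict_space borel T\<close> (which on \<open>\<int>\<close> contains all subsets). Objects
  indexed by time are functions on \<open>real\<close> whose values outside \<open>T\<close> are irrelevant.\<close>

section \<open>Frechet processes\<close>

definition frechet_rv :: "'a measure \<Rightarrow> real \<Rightarrow> ('a \<Rightarrow> real) \<Rightarrow> bool" where
  "frechet_rv P \<alpha> Y \<longleftrightarrow> Y \<in> borel_measurable P \<and>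
     (\<exists>\<sigma>>0. \<forall>x>0. measure P {\<omega> \<in> space P. Y \<omega> \<le> x} = exp (- (\<sigma> powr \<alpha>) * x powr (- \<alpha>)))"

definition frechet_process :: "'a measure \<Rightarrow> real \<Rightarrow> real set \<Rightarrow> (real \<Rightarrow> 'a \<Rightarrow> real) \<Rightarrow> bool" where
  "frechet_process P \<alpha> T X \<longleftrightarrow> (\<forall>t\<in>T. X t \<in> borel_measurable P) \<and>
     (\<forall>(n::nat) (t::nat \<Rightarrow> real) (a::nat \<Rightarrow> real).
        n \<ge> 1 \<longrightarrow> (\<forall>j<n. t j \<in> T \<and> a j > 0) \<longrightarrow>
        frechet_rv P \<alpha> (\<lambda>\<omega>. Max ((\<lambda>j. a j * X (t j) \<omega>) ` {..<n})))"

definition stationary_process :: "'a measure \<Rightarrow> real set \<Rightarrow> (real \<Rightarrow> 'a \<Rightarrow> real) \<Rightarrow> bool" where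
  "stationary_process P T X \<longleftrightarrow> (\<forall>t\<in>T. X t \<in> borel_measurable P) \<and>
     (\<forall>(n::nat) (t::nat \<Rightarrow> real). \<forall>h\<in>T. (\<forall>i<n. t i \<in> T) \<longrightarrow>
        distr P (\<Pi>\<^sub>M i\<in>{..<n}. borel) (\<lambda>\<omega>. \<lambda>i\<in>{..<n}. X (t i + h) \<omega>) =
        distr P (\<Pi>\<^sub>M i\<in>{..<n}. borel) (\<lambda>\<omega>. \<lambda>i\<in>{..<n}. X (t i) \<omega>))"

section \<open>Spectral representations\<close>

definition L_plus :: "'s measure \<Rightarrow> real \<Rightarrow> ('s \<Rightarrow> real) set" where
  "L_plus M \<alpha> = {f \<in> borel_measurable M.
     (\<forall>s\<in>space M. 0 \<le> f s) \<and> (\<integral>\<^sup>+ s. ennreal (f s powr \<alpha>) \<partial>M) < \<infinity>}"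

definition rho_dist :: "'s measure \<Rightarrow> real \<Rightarrow> ('s \<Rightarrow> real) \<Rightarrow> ('s \<Rightarrow> real) \<Rightarrow> real" where
  "rho_dist M \<alpha> f g = (\<integral>s. \<bar>f s powr \<alpha> - g s powr \<alpha>\<bar> \<partial>M)"

definition spectral_representation ::
  "'a measure \<Rightarrow> 's measure \<Rightarrow> real \<Rightarrow> real set \<Rightarrow> (real \<Rightarrow> 'a \<Rightarrow> real) \<Rightarrow> (real \<Rightarrow> 's \<Rightarrow> real) \<Rightarrow> bool" where
  "spectral_representation P M \<alpha> T X f \<longleftrightarrow> (\<forall>t\<in>T. f t \<in> L_plus M \<alpha>) \<and>
     (\<forall>(n::nat) (t::nat \<Rightarrow> real) (x::nat \<Rightarrow> real).
        n \<ge> 1 \<longrightarrow> (\<forall>i<n. t i \<in> T \<and> x i > 0) \<longrightarrow>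
        measure P {\<omega> \<in> space P. \<forall>i<n. X (t i) \<omega> \<le> x i} =
        exp (- (\<integral>s. (Max ((\<lambda>i. inverse (x i) * f (t i) s) ` {..<n})) powr \<alpha> \<partial>M)))"

definition jointly_measurable :: "'s measure \<Rightarrow> real set \<Rightarrow> (real \<Rightarrow> 's \<Rightarrow> real) \<Rightarrow> bool" where
  "jointly_measurable M T f \<longleftrightarrow>
     (\<lambda>(t, s). f t s) \<in> borel_measurable (restrict_space borel T \<Otimes>\<^sub>M M)"

definition max_linear_combinations ::
  "real set \<Rightarrow> (real \<Rightarrow> 's \<Rightarrow> real) \<Rightarrow> ('s \<Rightarrow> real) set" where
  "max_linear_combinations T f =
     {\<lambda>s. Max ((\<lambda>i. a i * f (t i) s) ` {..<n}) |(n::nat) (a::nat \<Rightarrow> real) (t::nat \<Rightarrow> real).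
        n \<ge> 1 \<and> (\<forall>i<n. a i > 0 \<and> t i \<in> T)}"

definition max_linear_closure ::
  "'s measure \<Rightarrow> real \<Rightarrow> real set \<Rightarrow> (real \<Rightarrow> 's \<Rightarrow> real) \<Rightarrow> ('s \<Rightarrow> real) set" where
  "max_linear_closure M \<alpha> T f =
     {g \<in> L_plus M \<alpha>. \<forall>\<epsilon>>0. \<exists>h\<in>max_linear_combinations T f. rho_dist M \<alpha> g h < \<epsilon>}"

text \<open>The support is only determined up to null sets, so it is a predicate on measurable sets.\<close>

definition is_supp ::
  "'s measure \<Rightarrow> real \<Rightarrow> real set \<Rightarrow> (real \<Rightarrow> 's \<Rightarrow> real) \<Rightarrow> 's set \<Rightarrow> bool" where
  "is_supp M \<alpha> T f A \<longleftrightarrow> A \<in> sets M \<and>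
     (\<exists>g0\<in>max_linear_closure M \<alpha> T f.
        (\<forall>g\<in>max_linear_closure M \<alpha> T f.
           emeasure M ({s \<in> space M. g s \<noteq> 0} - {s \<in> space M. g0 s \<noteq> 0}) = 0) \<and>
        emeasure M (sym_diff A {s \<in> space M. g0 s \<noteq> 0}) = 0)"

text \<open>Division on \<^typ>\<open>ennreal\<close> satisfies \<open>0 / 0 = 0\<close> and \<open>a / 0 = \<infinity>\<close> for \<open>a > 0\<close>, which is the
  convention wanted for the ratios (see the lemma below).\<close>

definition ratio_sigma_field ::
  "'s measure \<Rightarrow> real set \<Rightarrow> (real \<Rightarrow> 's \<Rightarrow> real) \<Rightarrow> 's set set" where
  "ratio_sigma_field M T f = sigma_sets (space M)
     {(\<lambda>s. ennreal (f t s) / ennreal (f t' s)) -` B \<inter> space M | t t' B.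
        t \<in> T \<and> t' \<in> T \<and> B \<in> sets borel}"

lemma ratio_convention:
  fixes a b :: real
  assumes "a \<ge> 0" "b \<ge> 0"
  shows "ennreal a / ennreal b = (if b > 0 then ennreal (a / b) else if a = 0 then 0 else \<infinity>)"
proof (cases "b > 0")
  case True
  then show ?thesis using assms by (simp add: divide_ennreal)
next
  case False
  then show ?thesis using assms by (simp add: divide_ennreal_def ennreal_mult_top)
qed

definition minimal_representation ::
  "'s measure \<Rightarrow> real \<Rightarrow> real set \<Rightarrow> (real \<Rightarrow> 's \<Rightarrow> real) \<Rightarrow> bool" where
  "minimal_representation M \<alpha> T f \<longleftrightarrow> is_supp M \<alpha> T f (space M) \<and>
     (\<forall>B\<in>sets M. \<exists>A\<in>ratio_sigma_field M T f. emeasure M (sym_diff A B) = 0)"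

section \<open>The standard spaces\<close>

definition std_space :: "nat \<Rightarrow> enat \<Rightarrow> real set" where
  "std_space I N = (if I = 1 then {0<..<1} else {}) \<union> {real n | n. 1 \<le> n \<and> enat n \<le> N}"

definition std_measure :: "nat \<Rightarrow> enat \<Rightarrow> real measure" where
  "std_measure I N = measure_of (std_space I N) (sets (restrict_space borel (std_space I N)))
     (\<lambda>A. emeasure lborel (A \<inter> {0<..<1}) + emeasure (count_space UNIV) (A \<inter> \<nat>))"

text \<open>The next lemmas confirm that the set function in \<^const>\<open>std_measure\<close> is countably additive,
  so that \<^const>\<open>measure_of\<close> does not fall back to the zero measure.\<close>

lemma std_space_borel [measurable]: "std_space I N \<in> sets borel"
proof -
  have "countable {real n | n. 1 \<le> n \<and> enat n \<le> N}"
    by (rule countable_subset[of _ "range real"]) auto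
  then have "{real n | n. 1 \<le> n \<and> enat n \<le> N} \<in> sets borel"
    by (rule sets.countable[rotated]) auto
  then show ?thesis
    unfolding std_space_def by auto
qed

lemma space_std_measure [simp]: "space (std_measure I N) = std_space I N"
  unfolding std_measure_def
  by (rule space_measure_of) (auto simp: sets_restrict_space)

lemma sets_std_measure [simp]:
  "sets (std_measure I N) = sets (restrict_space borel (std_space I N))"
proof -
  have "sigma_sets (std_space I N) (sets (restrict_space borel (std_space I N))) =
      sets (restrict_space borel (std_space I N))"
    using sets.sigma_sets_eq[of "restrict_space borel (std_space I N)"]
    by (simp add: space_restrict_space)
  moreover have "sets (restrict_space borel (std_space I N)) \<subseteq> Pow (std_space I N)"
    by (auto simp: sets_restrict_space)
  ultimately show ?thesis
    unfolding std_measure_def by (simp only: sets_measure_of)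
qed

lemma emeasure_std_measure:
  assumes "A \<in> sets borel" "A \<subseteq> std_space I N"
  shows "emeasure (std_measure I N) A =
    emeasure lborel (A \<inter> {0<..<1}) + emeasure (count_space UNIV) (A \<inter> \<nat>)"
proof (rule emeasure_measure_of[OF std_measure_def])
  show "sets (restrict_space borel (std_space I N)) \<subseteq> Pow (std_space I N)"
    by (auto simp: sets_restrict_space)
  show "A \<in> sets (std_measure I N)"
    using assms by (simp add: sets_restrict_space_iff)
  let ?m = "\<lambda>A::real set. emeasure lborel (A \<inter> {0<..<1}) + emeasure (count_space UNIV) (A \<inter> \<nat>)"
  show "positive (sets (std_measure I N)) ?m"
    by (simp add: positive_def)
  show "countably_additive (sets (std_measure I N)) ?m"
  proof (rule countably_additiveI)
    fix F :: "nat \<Rightarrow> real set"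
    assume F: "range F \<subseteq> sets (std_measure I N)" "disjoint_family F"
    have b: "F i \<in> sets borel" for i
    proof -
      have "F i \<in> sets (restrict_space borel (std_space I N))"
        using F(1) by auto
      then show ?thesis
        by (simp add: sets_restrict_space_iff)
    qed
    have "(\<Sum>i. emeasure lborel (F i \<inter> {0<..<1})) = emeasure lborel (\<Union>i. F i \<inter> {0<..<1})"
      by (rule suminf_emeasure)
         (use b F(2) in \<open>auto simp: disjoint_family_on_def\<close>)
    moreover have "(\<Sum>i. emeasure (count_space UNIV) (F i \<inter> \<nat>)) =
        emeasure (count_space UNIV) (\<Union>i. F i \<inter> \<nat>)"
      by (rule suminf_emeasure) (use F(2) in \<open>auto simp: disjoint_family_on_def\<close>)
    ultimately show "(\<Sum>i. ?m (F i)) = ?m (\<Union>i. F i)"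
      by (simp add: suminf_add[symmetric])
  qed
qed

section \<open>Flows\<close>

definition is_flow :: "'s measure \<Rightarrow> real set \<Rightarrow> (real \<Rightarrow> 's \<Rightarrow> 's) \<Rightarrow> bool" where
  "is_flow M T \<phi> \<longleftrightarrow> (\<forall>t\<in>T. \<phi> t \<in> space M \<rightarrow> space M) \<and>
     (\<forall>t1\<in>T. \<forall>t2\<in>T. \<forall>s\<in>space M. \<phi> (t1 + t2) s = \<phi> t2 (\<phi> t1 s)) \<and>
     (\<forall>s\<in>space M. \<phi> 0 s = s)"

definition measurable_flow :: "'s measure \<Rightarrow> real set \<Rightarrow> (real \<Rightarrow> 's \<Rightarrow> 's) \<Rightarrow> bool" where
  "measurable_flow M T \<phi> \<longleftrightarrow> is_flow M T \<phi> \<and>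
     (\<lambda>(t, s). \<phi> t s) \<in> restrict_space borel T \<Otimes>\<^sub>M M \<rightarrow>\<^sub>M M"

definition nonsingular_flow :: "'s measure \<Rightarrow> real set \<Rightarrow> (real \<Rightarrow> 's \<Rightarrow> 's) \<Rightarrow> bool" where
  "nonsingular_flow M T \<phi> \<longleftrightarrow> is_flow M T \<phi> \<and>
     (\<forall>t\<in>T. \<forall>A\<in>sets M. emeasure M (\<phi> t -` A \<inter> space M) = 0 \<longleftrightarrow> emeasure M A = 0)"

definition image_measure :: "'s measure \<Rightarrow> ('s \<Rightarrow> 's) \<Rightarrow> 's measure" where
  "image_measure M \<phi> = measure_of (space M) (sets M) (\<lambda>A. emeasure M (\<phi> ` A))"

text \<open>For an invertible bimeasurable map (such as a member of a measurable flow) this is indeed the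
  measure sending \<open>A\<close> to the measure of the image of \<open>A\<close>.\<close>

lemma emeasure_image_measure:
  assumes "\<phi> \<in> space M \<rightarrow> space M" "\<psi> \<in> M \<rightarrow>\<^sub>M M"
    and inv: "\<And>s. s \<in> space M \<Longrightarrow> \<psi> (\<phi> s) = s" "\<And>s. s \<in> space M \<Longrightarrow> \<phi> (\<psi> s) = s"
    and A: "A \<in> sets M"
  shows "emeasure (image_measure M \<phi>) A = emeasure M (\<phi> ` A)"
proof -
  have im: "\<phi> ` B = \<psi> -` B \<inter> space M" if "B \<in> sets M" for B
  proof -
    have "B \<subseteq> space M" using that by (rule sets.sets_into_space)
    then show ?thesis
      using assms(1) measurable_space[OF assms(2)] inv by (force simp: image_iff)
  qed
  have "image_measure M \<phi> = measure_of (space M) (sets M) (emeasure (distr M M \<psi>))"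
    unfolding image_measure_def
    by (rule measure_of_eq)
       (auto simp: sets.space_closed sets.sigma_sets_eq emeasure_distr[OF assms(2)] im)
  also have "\<dots> = distr M M \<psi>"
    using measure_of_of_measure[of "distr M M \<psi>"] by simp
  finally show ?thesis
    using A by (simp add: emeasure_distr[OF assms(2)] im)
qed

definition flow_represents ::
  "'s measure \<Rightarrow> real \<Rightarrow> real set \<Rightarrow> (real \<Rightarrow> 's \<Rightarrow> real) \<Rightarrow> (real \<Rightarrow> 's \<Rightarrow> 's) \<Rightarrow> bool" where
  "flow_represents M \<alpha> T f \<phi> \<longleftrightarrow>
     (\<forall>t\<in>T. AE s in M. f t s =
        enn2real (RN_deriv M (image_measure M (\<phi> t)) s) powr (1 / \<alpha>) * f 0 (\<phi> t s))"

end

theory Submission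
  imports Defs
begin

text \<open>
The times shift every representation: stationarity says that for every shift \<open>h\<close> the family
\<open>f (t + h)\<close> has the same integrals of powers of maxima \<open>max (a i * f (t i + h))\<close> as the family
\<open>f t\<close>. The idea is that these integrals determine the family up to a change of the points of the
space, so that the shift by \<open>h\<close> must be induced by a point map, and that minimality makes this
point map unique, hence a flow.

The integrals determine the family as follows. Differentiating the integral of
\<open>max (m, c * g) powr \<alpha>\<close> in \<open>c\<close> at \<open>c = 1\<close> gives the integral of \<open>g powr \<alpha>\<close> over \<open>{m < g}\<close>
(\<open>max_difference_quotient\<close>). So for each member \<open>g b\<close> the integrals yield the joint distribution
of all ratios \<open>g i / g b\<close> under the measure with density \<open>g b powr \<alpha>\<close> (\<open>distr_ratios_eq\<close>). The
choice of \<open>b\<close> is removed by dividing each sequence \<open>g i s\<close> by its first nonzero entry, which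
gives the normalized sequence of the point \<open>s\<close> (\<open>distr_normalized_eq\<close>).

Minimality provides a countable set of times whose normalized sequence determines the point almost
everywhere: there is a measurable \<open>G\<close> with \<open>G (normalized sequence of s) = s\<close>
(\<open>minimal_representation_coordinates\<close>). The point map for the shift \<open>h\<close> sends \<open>s\<close> to \<open>G\<close> of the
normalized sequence of the shifted family at \<open>s\<close>. Written in this way it is jointly measurable in
\<open>h\<close> and \<open>s\<close>. The equality of distributions shows that it is nonsingular and that it turns \<open>f t\<close>
into \<open>f (t + h)\<close> up to a positive factor independent of \<open>t\<close> (\<open>near_map_represents\<close>). As \<open>G\<close> of a
normalized sequence does not see such a factor, the point maps satisfy the flow equation, for each
pair of times almost everywhere (\<open>near_map_add\<close>).

Exceptional null sets that depend on the times have to be removed. For countable time, and for a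
space without nonempty null sets, this is immediate. For real time, the idea of Mackey is used: a
point \<open>s\<close> is replaced by its whole orbit, up to changes of the orbit at a null set of times, and on
orbits the shift is a flow without any exception. The orbit is recorded by the times it spends in
rays \<open>{v. v < q}\<close>, as functions of the upper time limit. These functions are Lipschitz, so they form
a well-behaved space on which the shift is jointly measurable, and they determine \<open>s\<close> almost
everywhere (\<open>path_left_inverse\<close>). The orbits that spend almost all of their time in the image of the
original space form an invariant set. Those among them that are not themselves in the image are
moved into a null Borel set of Cantor type inside the unit interval, which makes the invariant set
isomorphic to a subset of the original space with null complement (\<open>strict_flow\<close>).

The factor in \<open>f (t + h) = factor * f t\<close> at the moved point is the required root of the
Radon--Nikodym derivative, since the equality of distributions contains a change of variables
formula (\<open>nn_integral_point_map\<close>). Conversely, for every flow that represents \<open>f\<close> the chain rule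
for Radon--Nikodym derivatives (\<open>flow_deriv_cocycle\<close>) turns the representation of \<open>f (t + h)\<close>
by \<open>f 0\<close> into one by \<open>f t\<close> with a factor independent of \<open>t\<close>. The normalized sequences then identify
the flow with the point maps, which is uniqueness (\<open>flow_determined\<close>).
\<close>

section \<open>Integrals of maxima determine distributions of ratios\<close>

definition same_max_integrals ::
  "real \<Rightarrow> 's measure \<Rightarrow> (nat \<Rightarrow> 's \<Rightarrow> real) \<Rightarrow> 'r measure \<Rightarrow> (nat \<Rightarrow> 'r \<Rightarrow> real) \<Rightarrow> bool" where
  "same_max_integrals \<alpha> M g M' g' \<longleftrightarrow>
     (\<forall>n\<ge>1. \<forall>a. (\<forall>i<n. a i > 0) \<longrightarrow>
        (\<integral>s. Max ((\<lambda>i. a i * g i s) ` {..<n}) powr \<alpha> \<partial>M) =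
        (\<integral>s. Max ((\<lambda>i. a i * g' i s) ` {..<n}) powr \<alpha> \<partial>M'))"

lemma L_plusD:
  assumes "f \<in> L_plus M \<alpha>"
  shows "f \<in> borel_measurable M" "s \<in> space M \<Longrightarrow> 0 \<le> f s" "integrable M (\<lambda>s. f s powr \<alpha>)"
proof -
  show f: "f \<in> borel_measurable M" and "s \<in> space M \<Longrightarrow> 0 \<le> f s"
    using assms by (auto simp: L_plus_def)
  show "integrable M (\<lambda>s. f s powr \<alpha>)"
    using assms f by (intro integrableI_nonneg) (auto simp: L_plus_def)
qed

lemma Max_powr_le_sum:
  fixes x :: "nat \<Rightarrow> real"
  assumes "n \<ge> 1" "\<And>i. i < n \<Longrightarrow> 0 \<le> x i"
  shows "Max (x ` {..<n}) powr \<alpha> \<le> (\<Sum>i<n. x i powr \<alpha>)"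
proof -
  have "Max (x ` {..<n}) \<in> x ` {..<n}"
    using assms(1) by (intro Max_in) (auto simp: lessThan_empty_iff)
  then obtain j where "j < n" "Max (x ` {..<n}) = x j" by auto
  then show ?thesis
    using member_le_sum[of j "{..<n}" "\<lambda>i. x i powr \<alpha>"] by auto
qed

lemma L_plus_Max:
  fixes n :: nat
  assumes "n \<ge> 1" "\<And>i. i < n \<Longrightarrow> f i \<in> L_plus M \<alpha>" "\<And>i. i < n \<Longrightarrow> 0 \<le> a i"
  shows "(\<lambda>s. Max ((\<lambda>i. a i * f i s) ` {..<n})) \<in> L_plus M \<alpha>"
proof -
  have [measurable]: "(\<lambda>s. Max ((\<lambda>i. a i * f i s) ` {..<n})) \<in> borel_measurable M"
    using assms L_plusD(1)[OF assms(2)] by (intro borel_measurable_Max) auto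
  have nn: "0 \<le> a i * f i s" if "i < n" "s \<in> space M" for i s
    using assms that L_plusD(2)[OF assms(2)] by auto
  have int: "integrable M (\<lambda>s. Max ((\<lambda>i. a i * f i s) ` {..<n}) powr \<alpha>)"
  proof (rule Bochner_Integration.integrable_bound)
    show "integrable M (\<lambda>s. \<Sum>i<n. a i powr \<alpha> * f i s powr \<alpha>)"
      using L_plusD(3)[OF assms(2)] by auto
    show "AE s in M. norm (Max ((\<lambda>i. a i * f i s) ` {..<n}) powr \<alpha>)
        \<le> norm (\<Sum>i<n. a i powr \<alpha> * f i s powr \<alpha>)"
    proof (rule AE_I2)
      fix s assume s: "s \<in> space M"
      have "Max ((\<lambda>i. a i * f i s) ` {..<n}) powr \<alpha> \<le> (\<Sum>i<n. (a i * f i s) powr \<alpha>)"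
        using assms(1) nn s by (intro Max_powr_le_sum) auto
      also have "\<dots> = (\<Sum>i<n. a i powr \<alpha> * f i s powr \<alpha>)"
        using assms(3) L_plusD(2)[OF assms(2)] s by (intro sum.cong) (auto simp: powr_mult)
      finally show "norm (Max ((\<lambda>i. a i * f i s) ` {..<n}) powr \<alpha>)
        \<le> norm (\<Sum>i<n. a i powr \<alpha> * f i s powr \<alpha>)"
        by simp
    qed
  qed simp
  have "0 \<le> Max ((\<lambda>i. a i * f i s) ` {..<n})" if "s \<in> space M" for s
  proof -
    have "a 0 * f 0 s \<le> Max ((\<lambda>i. a i * f i s) ` {..<n})"
      using assms(1) by (intro Max_ge) auto
    moreover have "0 \<le> a 0 * f 0 s" using nn[of 0 s] assms(1) that by simp
    ultimately show ?thesis by (rule order_trans[rotated])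
  qed
  then show ?thesis
    using int by (auto simp: L_plus_def nn_integral_eq_integral)
qed

text \<open>Approaching \<open>1\<close> from below produces the strict inequality \<open>m < g\<close>: where \<open>g \<le> m\<close> the quotient
vanishes, where \<open>m < g\<close> it is eventually constant, and \<open>g powr \<alpha>\<close> dominates it everywhere.\<close>

lemma max_difference_quotient:
  fixes m g :: "'s \<Rightarrow> real" and c :: "nat \<Rightarrow> real"
  assumes mg: "m \<in> L_plus M \<alpha>" "g \<in> L_plus M \<alpha>" and \<alpha>: "\<alpha> > 0"
    and c: "\<And>k. 0 < c k" "\<And>k. c k < 1" "c \<longlonglongrightarrow> 1"
  shows "(\<lambda>k. ((\<integral>s. max (m s) (g s) powr \<alpha> \<partial>M) - (\<integral>s. max (m s) (c k * g s) powr \<alpha> \<partial>M))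
           / (1 - c k powr \<alpha>))
         \<longlonglongrightarrow> (\<integral>s. g s powr \<alpha> * indicator {s. m s < g s} s \<partial>M)"
proof -
  note [measurable] = L_plusD(1)[OF mg(1)] L_plusD(1)[OF mg(2)]
  have nn: "0 \<le> m s" "0 \<le> g s" if "s \<in> space M" for s
    using L_plusD(2)[OF mg(1)] L_plusD(2)[OF mg(2)] that by auto
  have int: "integrable M (\<lambda>s. max (m s) (d * g s) powr \<alpha>)" if "0 \<le> d" for d
  proof -
    have "(\<lambda>s. Max ((\<lambda>i. (if i = 0 then 1 else d) * (if i = 0 then m s else g s)) ` {..<2::nat})) \<in> L_plus M \<alpha>"
      using L_plus_Max[of 2 "\<lambda>i. if i = 0 then m else g" M \<alpha> "\<lambda>i. if i = 0 then 1 else d"] mg that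
      by (auto simp: if_distribR)
    then show ?thesis
      by (auto dest!: L_plusD(3) simp: lessThan_Suc numeral_2_eq_2 max.commute)
  qed
  let ?F = "\<lambda>k s. (max (m s) (g s) powr \<alpha> - max (m s) (c k * g s) powr \<alpha>) / (1 - c k powr \<alpha>)"
  have cp: "c k powr \<alpha> < 1" for k
    using c \<alpha> powr_less_mono2[of \<alpha> "c k" 1] by (auto simp: less_imp_le)
  have bnd: "0 \<le> ?F k s \<and> ?F k s \<le> g s powr \<alpha>" if s: "s \<in> space M" for k s
  proof -
    have 1: "c k * g s \<le> g s" using c(2)[of k] nn[OF s] by (simp add: mult_left_le_one_le less_imp_le c(1))
    have 2: "(c k * g s) powr \<alpha> = c k powr \<alpha> * g s powr \<alpha>"
      using c(1)[of k] nn[OF s] by (simp add: powr_mult)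
    consider "g s \<le> m s" | "m s < g s" "c k * g s \<le> m s" | "m s < c k * g s" by linarith
    then have "0 \<le> max (m s) (g s) powr \<alpha> - max (m s) (c k * g s) powr \<alpha> \<and>
      max (m s) (g s) powr \<alpha> - max (m s) (c k * g s) powr \<alpha> \<le> g s powr \<alpha> * (1 - c k powr \<alpha>)"
    proof cases
      case 1
      then show ?thesis using \<open>c k * g s \<le> g s\<close> cp[of k] by (simp add: max_absorb1)
    next
      case 2
      have "(c k * g s) powr \<alpha> \<le> m s powr \<alpha>"
        using 2 \<alpha> c(1)[of k] nn[OF s] by (intro powr_mono2) auto
      moreover have "m s powr \<alpha> \<le> g s powr \<alpha>"
        using 2 \<alpha> nn[OF s] by (intro powr_mono2) auto
      ultimately show ?thesis
        using 2 \<open>(c k * g s) powr \<alpha> = _\<close> by (simp add: max_absorb1 max_absorb2 algebra_simps)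
    next
      case 3
      then have "m s < g s" using 1 by linarith
      then show ?thesis
        using 3 2 cp[of k] nn[OF s] by (simp add: max_absorb2 algebra_simps mult_left_le)
    qed
    then show ?thesis
      using cp[of k] by (simp add: divide_le_eq)
  qed
  have "(\<lambda>k. \<integral>s. ?F k s \<partial>M) \<longlonglongrightarrow> (\<integral>s. g s powr \<alpha> * indicator {s. m s < g s} s \<partial>M)"
  proof (rule integral_dominated_convergence)
    show "integrable M (\<lambda>s. g s powr \<alpha>)" using L_plusD(3)[OF mg(2)] .
    show "AE s in M. norm (?F k s) \<le> g s powr \<alpha>" for k
      using bnd by (intro AE_I2) (metis abs_of_nonneg real_norm_def)
    show "AE s in M. (\<lambda>k. ?F k s) \<longlonglongrightarrow> g s powr \<alpha> * indicator {s. m s < g s} s"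
    proof (rule AE_I2)
      fix s assume s: "s \<in> space M"
      show "(\<lambda>k. ?F k s) \<longlonglongrightarrow> g s powr \<alpha> * indicator {s. m s < g s} s"
      proof (cases "m s < g s")
        case True
        have "(\<lambda>k. c k * g s) \<longlonglongrightarrow> 1 * g s" by (intro tendsto_intros c)
        then have "eventually (\<lambda>k. c k * g s > m s) sequentially"
          using True by (intro order_tendstoD) auto
        then have "eventually (\<lambda>k. ?F k s = g s powr \<alpha>) sequentially"
        proof eventually_elim
          case (elim k)
          then show ?case
            using True cp[of k] c(1)[of k] nn[OF s] by (simp add: powr_mult field_simps)
        qed
        then show ?thesis
          using True by (auto simp: tendsto_eventually)
      next
        case False
        have "c k * g s \<le> m s" for k
          using False mult_right_mono[of "c k" 1 "g s"] c(2)[of k] nn[OF s] by simp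
        then show ?thesis using False by (simp add: max_absorb1)
      qed
    qed
  qed simp_all
  moreover have "(\<integral>s. ?F k s \<partial>M) = ((\<integral>s. max (m s) (g s) powr \<alpha> \<partial>M) - (\<integral>s. max (m s) (c k * g s) powr \<alpha> \<partial>M))
           / (1 - c k powr \<alpha>)" for k
    using int[of 1] int[of "c k"] c(1)[of k] by (simp add: less_imp_le)
  ultimately show ?thesis by (simp only:)
qed

lemma Max_fun_upd_max:
  fixes x :: "nat \<Rightarrow> real"
  assumes "b < n"
  shows "Max ((x(b := max (x b) z)) ` {..<n}) = max (Max (x ` {..<n})) z"
proof (rule Max_eqI)
  have ge: "x i \<le> Max (x ` {..<n})" if "i < n" for i
    using that by (intro Max_ge) auto
  show "y \<le> max (Max (x ` {..<n})) z" if y: "y \<in> (x(b := max (x b) z)) ` {..<n}" for y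
  proof -
    obtain i where i: "i < n" "y = (x(b := max (x b) z)) i"
      using y unfolding image_iff lessThan_iff Bex_def by blast
    show ?thesis using ge[OF i(1)] ge[OF assms] i(2) by (cases "i = b") (auto simp: le_max_iff_disj)
  qed
  have "Max (x ` {..<n}) \<in> x ` {..<n}"
    using assms by (intro Max_in) (auto simp: lessThan_empty_iff)
  then obtain j where j: "j < n" "Max (x ` {..<n}) = x j" by auto
  show "max (Max (x ` {..<n})) z \<in> (x(b := max (x b) z)) ` {..<n}"
  proof (cases "z \<le> x j \<and> j \<noteq> b")
    case True
    then show ?thesis using j by (auto simp: max_absorb1 intro!: image_eqI[of _ _ j])
  next
    case False
    then have "max (Max (x ` {..<n})) z = max (x b) z"
      using j ge[OF assms] by (auto simp: max_def)
    then show ?thesis using assms by (auto intro!: image_eqI[of _ _ b])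
  qed
qed simp

text \<open>This is the difference quotient for \<open>m = max (g i / y i)\<close>. The perturbed maximum
\<open>max (m, d * g b)\<close> is again a maximum of positive multiples of the \<open>g i\<close>, because \<open>b\<close> is one of the
indices.\<close>

lemma same_max_integrals_cdf:
  assumes same: "same_max_integrals \<alpha> M g M' g'" and \<alpha>: "\<alpha> > 0"
    and g: "\<And>i. g i \<in> L_plus M \<alpha>" and g': "\<And>i. g' i \<in> L_plus M' \<alpha>"
    and b: "b < n" and y: "\<And>i. i < n \<Longrightarrow> y i > 0"
  shows "(\<integral>s. g b s powr \<alpha> * indicator {s. \<forall>i<n. g i s < y i * g b s} s \<partial>M) =
         (\<integral>s. g' b s powr \<alpha> * indicator {s. \<forall>i<n. g' i s < y i * g' b s} s \<partial>M')"
proof -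
  \<comment> \<open>any sequence in the open unit interval that tends to 1\<close>
  define c where "c k = 1 - 1 / real (k + 2)" for k :: nat
  have c: "0 < c k" "c k < 1" for k by (auto simp: c_def)
  have "(\<lambda>k. 1 - 1 / real (k + 2)) \<longlonglongrightarrow> 1 - 0"
    by (intro tendsto_diff tendsto_const LIMSEQ_ignore_initial_segment[of "\<lambda>k. 1 / real k"] lim_1_over_n)
  then have clim: "c \<longlonglongrightarrow> 1" by (simp add: c_def[abs_def])
  define a where "a i = 1 / y i" for i
  have a: "0 < a i" if "i < n" for i using y[OF that] by (simp add: a_def)
  define m where "m s = Max ((\<lambda>i. a i * g i s) ` {..<n})" for s
  define m' where "m' s = Max ((\<lambda>i. a i * g' i s) ` {..<n})" for s
  have n: "n \<ge> 1" using b by simp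
  have m: "m \<in> L_plus M \<alpha>" "m' \<in> L_plus M' \<alpha>"
    unfolding m_def[abs_def] m'_def[abs_def] using n g g' a
    by (intro L_plus_Max; auto intro: less_imp_le)+
  \<comment> \<open>raising the coefficient of g b to at least d adds d * g b to the maximum\<close>
  have upd: "Max ((\<lambda>i. (a(b := max (a b) d)) i * h i) ` {..<n}) = max (Max ((\<lambda>i. a i * h i) ` {..<n})) (d * h b)"
    if "0 \<le> h b" for d and h :: "nat \<Rightarrow> real"
  proof -
    have "(\<lambda>i. (a(b := max (a b) d)) i * h i) = (\<lambda>i. a i * h i)(b := max (a b * h b) (d * h b))"
      using that by (auto simp: fun_eq_iff max_mult_distrib_right)
    then show ?thesis by (simp only: Max_fun_upd_max[OF b, of "\<lambda>i. a i * h i" "d * h b"])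
  qed
  have eq: "(\<integral>s. max (m s) (d * g b s) powr \<alpha> \<partial>M) = (\<integral>s. max (m' s) (d * g' b s) powr \<alpha> \<partial>M')"
    if "d > 0" for d
  proof -
    have "(\<integral>s. max (m s) (d * g b s) powr \<alpha> \<partial>M)
        = (\<integral>s. Max ((\<lambda>i. (a(b := max (a b) d)) i * g i s) ` {..<n}) powr \<alpha> \<partial>M)"
      using upd[of "\<lambda>i. g i _" d] L_plusD(2)[OF g] by (intro Bochner_Integration.integral_cong) (auto simp: m_def)
    also have "\<dots> = (\<integral>s. Max ((\<lambda>i. (a(b := max (a b) d)) i * g' i s) ` {..<n}) powr \<alpha> \<partial>M')"
    proof -
      have "\<forall>i<n. (a(b := max (a b) d)) i > 0" using a that by auto
      with same n show ?thesis unfolding same_max_integrals_def by blast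
    qed
    also have "\<dots> = (\<integral>s. max (m' s) (d * g' b s) powr \<alpha> \<partial>M')"
      using upd[of "\<lambda>i. g' i _" d] L_plusD(2)[OF g'] by (intro Bochner_Integration.integral_cong) (auto simp: m'_def)
    finally show ?thesis .
  qed
  have "(\<integral>s. g b s powr \<alpha> * indicator {s. m s < g b s} s \<partial>M) =
        (\<integral>s. g' b s powr \<alpha> * indicator {s. m' s < g' b s} s \<partial>M')"
    using max_difference_quotient[OF m(1) g \<alpha> c clim, of b]
      max_difference_quotient[OF m(2) g' \<alpha> c clim, of b] eq[of 1] eq[OF c(1)]
    by (simp add: LIMSEQ_unique)
  moreover have "m s < g b s \<longleftrightarrow> (\<forall>i<n. g i s < y i * g b s)" for s
    unfolding m_def using b y
    by (subst Max_less_iff) (auto simp: a_def lessThan_empty_iff field_simps)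
  moreover have "m' s < g' b s \<longleftrightarrow> (\<forall>i<n. g' i s < y i * g' b s)" for s
    unfolding m'_def using b y
    by (subst Max_less_iff) (auto simp: a_def lessThan_empty_iff field_simps)
  ultimately show ?thesis by simp
qed

abbreviation seq_space :: "(nat \<Rightarrow> real) measure" where
  "seq_space \<equiv> PiM UNIV (\<lambda>_. borel)"

text \<open>The restriction to \<open>b < n\<close> makes each of these sets bound the coordinate \<open>b\<close>, as the
distribution functions computed above require; it does not change the generated \<open>\<sigma>\<close>-algebra.\<close>

definition corner_sets :: "nat \<Rightarrow> (nat \<Rightarrow> real) set set" where
  "corner_sets b = {{y. \<forall>i<n. y i < c i} | n c. b < n}"

lemma corner_setsI: "b < n \<Longrightarrow> {y. \<forall>i<n. y i < c i} \<in> corner_sets b"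
  unfolding corner_sets_def by (intro CollectI exI[of _ n] exI[of _ c] conjI refl)

lemma space_seq_space [simp]: "space seq_space = UNIV"
  by (simp add: space_PiM)

lemma sets_seq_space_eq_corner: "sets seq_space = sigma_sets UNIV (corner_sets b)"
proof
  have "{y. \<forall>i<n. y i < c i} \<in> sets seq_space" for n and c :: "nat \<Rightarrow> real"
  proof -
    have "{y\<in>space seq_space. \<forall>i\<in>{..<n}. y i < c i} \<in> sets seq_space"
      by measurable
    then show ?thesis by (simp add: Ball_def)
  qed
  then have "corner_sets b \<subseteq> sets seq_space" by (auto simp: corner_sets_def)
  then show "sigma_sets UNIV (corner_sets b) \<subseteq> sets seq_space"
    using sets.sigma_sets_subset[of "corner_sets b" seq_space] by simp
  let ?S = "sigma UNIV (corner_sets b)"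
  have S: "sets ?S = sigma_sets UNIV (corner_sets b)" by simp
  have "(\<lambda>y. y i) \<in> borel_measurable ?S" for i
  proof (rule borel_measurableI_less)
    fix x :: real
    define n where "n = Suc (max b i)"
    have "{y. y i < x} = (\<Union>k::nat. {y. \<forall>j<n. y j < (if j = i then x else real k)})"
    proof (intro set_eqI iffI)
      fix y assume "y \<in> {y::nat\<Rightarrow>real. y i < x}"
      obtain k :: nat where k: "Max (y ` {..<n}) < real k" using reals_Archimedean2 by blast
      have "y j < real k" if "j < n" for j
        using le_less_trans[OF Max_ge[of "y ` {..<n}" "y j"] k] that by auto
      then show "y \<in> (\<Union>k::nat. {y. \<forall>j<n. y j < (if j = i then x else real k)})"
        using \<open>y \<in> _\<close> by auto
    next
      fix y assume "y \<in> (\<Union>k::nat. {y. \<forall>j<n. y j < (if j = i then x else real k)})"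
      then show "y \<in> {y::nat\<Rightarrow>real. y i < x}" by (auto simp: n_def dest!: spec[of _ i])
    qed
    also have "\<dots> \<in> sets ?S"
      unfolding S
    proof (rule sigma_sets.Union, rule sigma_sets.Basic)
      fix k
      have "b < n" by (simp add: n_def)
      then show "{y. \<forall>j<n. y j < (if j = i then x else real k)} \<in> corner_sets b"
        by (rule corner_setsI)
    qed
    finally show "{y \<in> space ?S. y i < x} \<in> sets ?S" by simp
  qed
  then have "(\<lambda>y. y) \<in> measurable ?S seq_space"
    by (intro measurable_PiM_single') auto
  then show "sets seq_space \<subseteq> sigma_sets UNIV (corner_sets b)"
    by (auto dest!: measurable_sets simp: space_PiM)
qed

lemma Int_stable_corner_sets: "Int_stable (corner_sets b)"
proof (rule Int_stableI)
  fix A B assume "A \<in> corner_sets b" "B \<in> corner_sets b"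
  then obtain n c n' c' where A: "A = {y. \<forall>i<n. y i < c i}" "b < n"
    and B: "B = {y. \<forall>i<n'. y i < c' i}" "b < n'"
    by (auto simp: corner_sets_def)
  have "A \<inter> B = {y. \<forall>i<max n n'. y i < (if i < n \<and> i < n' then min (c i) (c' i) else if i < n then c i else c' i)}"
  proof (intro set_eqI)
    fix y
    have "y \<in> A \<inter> B \<longleftrightarrow> (\<forall>i. (i < n \<longrightarrow> y i < c i) \<and> (i < n' \<longrightarrow> y i < c' i))"
      by (auto simp: A B)
    also have "\<dots> \<longleftrightarrow> (\<forall>i<max n n'. y i < (if i < n \<and> i < n' then min (c i) (c' i) else if i < n then c i else c' i))"
      by (intro all_cong1) auto
    finally show "y \<in> A \<inter> B \<longleftrightarrow> y \<in> {y. \<forall>i<max n n'. y i < (if i < n \<and> i < n' then min (c i) (c' i) else if i < n then c i else c' i)}"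
      by simp
  qed
  moreover have "b < max n n'" using A(2) by simp
  ultimately show "A \<inter> B \<in> corner_sets b" by (simp only: corner_setsI)
qed

text \<open>The sets on which \<open>g b\<close> vanishes do not contribute, since the density vanishes there; on the others
\<open>g i / g b < c\<close> is the inequality \<open>g i < c * g b\<close> of the distribution functions. Bounds \<open>c \<le> 0\<close>
give the empty set because the ratios are nonnegative.\<close>

lemma distr_ratios_eq:
  assumes same: "same_max_integrals \<alpha> M g M' g'" and \<alpha>: "\<alpha> > 0"
    and g: "\<And>i. g i \<in> L_plus M \<alpha>" and g': "\<And>i. g' i \<in> L_plus M' \<alpha>"
  shows "distr (density M (\<lambda>s. ennreal (g b s powr \<alpha>))) seq_space (\<lambda>s i. g i s / g b s) =
         distr (density M' (\<lambda>s. ennreal (g' b s powr \<alpha>))) seq_space (\<lambda>s i. g' i s / g' b s)"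
    (is "?D = ?D'")
proof (rule measure_eqI_generator_eq[where \<Omega> = UNIV and E = "corner_sets b"
      and A = "\<lambda>k. {y. \<forall>i<Suc b. y i < real k}"])
  have rat: "(\<lambda>s i. h i s / h b s) \<in> measurable N seq_space"
    if "\<And>i. h i \<in> borel_measurable N" for h :: "nat \<Rightarrow> 'c \<Rightarrow> real" and N
    using that by (intro measurable_PiM_single') (auto simp: space_PiM)
  have fin: "emeasure (distr (density N (\<lambda>s. ennreal (h b s powr \<alpha>))) seq_space (\<lambda>s i. h i s / h b s)) A =
      ennreal (\<integral>s. h b s powr \<alpha> * indicator {s. (\<lambda>i. h i s / h b s) \<in> A} s \<partial>N)"
    if h: "\<And>i. h i \<in> L_plus N \<alpha>" and A: "A \<in> sets seq_space" for h :: "nat \<Rightarrow> 'c \<Rightarrow> real" and N A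
  proof -
    have hm [measurable]: "h i \<in> borel_measurable N" for i using L_plusD(1)[OF h] .
    note r [measurable] = rat[of h N, OF hm]
    note A [measurable]
    have i: "integrable N (\<lambda>s. h b s powr \<alpha> * indicator {s. (\<lambda>i. h i s / h b s) \<in> A} s)"
    proof (rule Bochner_Integration.integrable_bound[OF L_plusD(3)[OF h[of b]]])
      have "(\<lambda>s. h b s powr \<alpha> * indicator A (\<lambda>i. h i s / h b s)) \<in> borel_measurable N"
        by measurable
      then show "(\<lambda>s. h b s powr \<alpha> * indicator {s. (\<lambda>i. h i s / h b s) \<in> A} s) \<in> borel_measurable N"
        by (simp add: indicator_def)
    qed (auto simp: indicator_def)
    have "emeasure (distr (density N (\<lambda>s. ennreal (h b s powr \<alpha>))) seq_space (\<lambda>s i. h i s / h b s)) A =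
      (\<integral>\<^sup>+s. ennreal (h b s powr \<alpha>) * indicator ((\<lambda>s i. h i s / h b s) -` A \<inter> space N) s \<partial>N)"
      using measurable_sets[OF r A] by (simp add: emeasure_distr emeasure_density)
    also have "\<dots> = (\<integral>\<^sup>+s. ennreal (h b s powr \<alpha> * indicator {s. (\<lambda>i. h i s / h b s) \<in> A} s) \<partial>N)"
      by (intro nn_integral_cong) (auto simp: indicator_def)
    also have "\<dots> = ennreal (\<integral>s. h b s powr \<alpha> * indicator {s. (\<lambda>i. h i s / h b s) \<in> A} s \<partial>N)"
      by (intro nn_integral_eq_integral i) auto
    finally show ?thesis .
  qed
  have corner: "(\<integral>s. h b s powr \<alpha> * indicator {s. (\<lambda>i. h i s / h b s) \<in> {y. \<forall>i<n. y i < c i}} s \<partial>N) =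
      (if \<forall>i<n. c i > 0 then \<integral>s. h b s powr \<alpha> * indicator {s. \<forall>i<n. h i s < c i * h b s} s \<partial>N else 0)"
    if h: "\<And>i. h i \<in> L_plus N \<alpha>" for h :: "nat \<Rightarrow> 'c \<Rightarrow> real" and N n c
  proof (cases "\<forall>i<n. c i > 0")
    case True
    have "(\<integral>s. h b s powr \<alpha> * indicator {s. (\<lambda>i. h i s / h b s) \<in> {y. \<forall>i<n. y i < c i}} s \<partial>N) =
      (\<integral>s. h b s powr \<alpha> * indicator {s. \<forall>i<n. h i s < c i * h b s} s \<partial>N)"
    proof (rule Bochner_Integration.integral_cong[OF refl])
      fix s assume "s \<in> space N"
      then have "h b s \<ge> 0" using L_plusD(2)[OF h] by auto
      then consider "h b s = 0" | "h b s > 0" by linarith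
      then show "h b s powr \<alpha> * indicator {s. (\<lambda>i. h i s / h b s) \<in> {y. \<forall>i<n. y i < c i}} s =
        h b s powr \<alpha> * indicator {s. \<forall>i<n. h i s < c i * h b s} s"
        by cases (auto simp: indicator_def field_simps)
    qed
    then show ?thesis using True by simp
  next
    case False
    then obtain i where i: "i < n" "c i \<le> 0" by force
    have "(\<integral>s. h b s powr \<alpha> * indicator {s. (\<lambda>i. h i s / h b s) \<in> {y. \<forall>i<n. y i < c i}} s \<partial>N) =
      (\<integral>s. 0 \<partial>N)"
    proof (rule Bochner_Integration.integral_cong[OF refl])
      fix s assume "s \<in> space N"
      then have "0 \<le> h i s / h b s" using L_plusD(2)[OF h] by auto
      then have "\<not> (h i s / h b s < c i)" using i by linarith
      then show "h b s powr \<alpha> * indicator {s. (\<lambda>i. h i s / h b s) \<in> {y. \<forall>i<n. y i < c i}} s = 0"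
        using i by (auto simp: indicator_def)
    qed
    then show ?thesis by (simp only: False if_False Bochner_Integration.integral_zero)
  qed
  have cs: "corner_sets b \<subseteq> sets seq_space"
    by (auto simp: sets_seq_space_eq_corner[of b])
  show "emeasure ?D X = emeasure ?D' X" if X: "X \<in> corner_sets b" for X
  proof -
    obtain n c where Xe: "X = {y. \<forall>i<n. y i < c i}" "b < n" using X by (auto simp: corner_sets_def)
    have X': "X \<in> sets seq_space" using X cs by auto
    have eq: "(\<integral>s. g b s powr \<alpha> * indicator {s. \<forall>i<n. g i s < c i * g b s} s \<partial>M) =
      (\<integral>s. g' b s powr \<alpha> * indicator {s. \<forall>i<n. g' i s < c i * g' b s} s \<partial>M')" if "\<forall>i<n. c i > 0"
      by (rule same_max_integrals_cdf[OF same \<alpha> g g' Xe(2)]) (use that in auto)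
    show ?thesis
      unfolding fin[of g, OF g X'] fin[of g', OF g' X'] unfolding Xe(1) corner[of g, OF g] corner[of g', OF g']
      by (cases "\<forall>i<n. c i > 0") (simp_all only: eq if_True if_False)
  qed
  show "emeasure ?D {y. \<forall>i<Suc b. y i < real k} \<noteq> \<infinity>" for k
  proof -
    have "{y. \<forall>i<Suc b. y i < real k} \<in> corner_sets b" by (rule corner_setsI) simp
    then have "{y. \<forall>i<Suc b. y i < real k} \<in> sets seq_space" using cs by auto
    from fin[of g, OF g this] show ?thesis
      by (simp only: infinity_ennreal_def ennreal_neq_top not_False_eq_True)
  qed
  show "range (\<lambda>k. {y. \<forall>i<Suc b. y i < real k}) \<subseteq> corner_sets b"
    by (rule image_subsetI, rule corner_setsI) simp
  show "(\<Union>k. {y. \<forall>i<Suc b. y i < real k}) = UNIV"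
  proof (intro set_eqI iffI UNIV_I)
    fix y :: "nat \<Rightarrow> real"
    obtain k :: nat where k: "Max (y ` {..<Suc b}) < real k" using reals_Archimedean2 by blast
    have "y j < real k" if "j < Suc b" for j
      using le_less_trans[OF Max_ge[of "y ` {..<Suc b}" "y j"] k] that by auto
    then show "y \<in> (\<Union>k. {y. \<forall>i<Suc b. y i < real k})" by auto
  qed
qed (simp_all add: Int_stable_corner_sets sets_seq_space_eq_corner[of b])


text \<open>The first nonzero entry serves to select one representative of each sequence up to positive
multiples. The zero sequence has lead \<open>0\<close> and is its own normalization.\<close>

definition lead_index :: "(nat \<Rightarrow> real) \<Rightarrow> nat" where
  "lead_index y = (LEAST i. y i \<noteq> 0)"

definition lead :: "(nat \<Rightarrow> real) \<Rightarrow> real" where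
  "lead y = y (lead_index y)"

definition normalize_seq :: "(nat \<Rightarrow> real) \<Rightarrow> nat \<Rightarrow> real" where
  "normalize_seq y = (\<lambda>i. y i / lead y)"

lemma lead_eq_0_iff: "lead y = 0 \<longleftrightarrow> (\<forall>i. y i = 0)"
  unfolding lead_def lead_index_def by (metis (mono_tags, lifting) LeastI)

lemma lead_nonneg: "(\<And>i. 0 \<le> y i) \<Longrightarrow> 0 \<le> lead y"
  by (simp add: lead_def)

lemma lead_scale: "c \<noteq> 0 \<Longrightarrow> lead (\<lambda>i. c * y i) = c * lead y"
  by (simp add: lead_def lead_index_def)

lemma normalize_seq_scale: "c \<noteq> 0 \<Longrightarrow> normalize_seq (\<lambda>i. c * y i) = normalize_seq y"
  by (simp add: normalize_seq_def lead_scale)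

lemma lead_times_normalize_seq: "lead y * normalize_seq y i = y i"
  using lead_eq_0_iff[of y] by (cases "lead y = 0") (auto simp: normalize_seq_def)

lemma measurable_lead_index [measurable]: "lead_index \<in> measurable seq_space (count_space UNIV)"
  unfolding lead_index_def by measurable

lemma measurable_lead [measurable]: "lead \<in> borel_measurable seq_space"
  unfolding lead_def by (rule measurable_compose_countable[OF _ measurable_lead_index]) measurable

lemma measurable_normalize_seq [measurable]: "normalize_seq \<in> measurable seq_space seq_space"
  unfolding normalize_seq_def by (intro measurable_PiM_single') (auto simp: space_PiM)

lemma measurable_seq [measurable (raw)]:
  "(\<And>i. g i \<in> borel_measurable M) \<Longrightarrow> (\<lambda>s i. g i s) \<in> measurable M seq_space"
  by (intro measurable_PiM_single') (auto simp: space_PiM)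

text \<open>The space is split according to the position \<open>k\<close> of the first nonzero entry. On the part with
position \<open>k\<close> the normalized sequence consists of the ratios to \<open>g k\<close>, and the part is itself
described by these ratios, so that \<open>distr_ratios_eq\<close> applies to each summand.\<close>

lemma distr_normalized_eq:
  assumes same: "same_max_integrals \<alpha> M g M' g'" and \<alpha>: "\<alpha> > 0"
    and g: "\<And>i. g i \<in> L_plus M \<alpha>" and g': "\<And>i. g' i \<in> L_plus M' \<alpha>"
  shows "distr (density M (\<lambda>s. ennreal (lead (\<lambda>i. g i s) powr \<alpha>))) seq_space (\<lambda>s. normalize_seq (\<lambda>i. g i s)) =
         distr (density M' (\<lambda>s. ennreal (lead (\<lambda>i. g' i s) powr \<alpha>))) seq_space (\<lambda>s. normalize_seq (\<lambda>i. g' i s))"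
proof (rule measure_eqI)
  fix A assume "A \<in> sets (distr (density M (\<lambda>s. ennreal (lead (\<lambda>i. g i s) powr \<alpha>))) seq_space (\<lambda>s. normalize_seq (\<lambda>i. g i s)))"
  then have A [measurable]: "A \<in> sets seq_space" by simp
  define B where "B k = A \<inter> {y. (\<forall>j<k. y j = 0) \<and> y k \<noteq> 0}" for k
  have B [measurable]: "B k \<in> sets seq_space" for k
  proof -
    have "{y \<in> space seq_space. (\<forall>j\<in>{..<k}. y j = 0) \<and> y k \<noteq> 0} \<in> sets seq_space" by measurable
    then show ?thesis unfolding B_def by (intro sets.Int A) (simp add: Ball_def)
  qed
  have point: "(\<Sum>k. ennreal (y k powr \<alpha>) * indicator (B k) (\<lambda>i. y i / y k)) =
      ennreal (lead y powr \<alpha>) * indicator A (normalize_seq y)" for y :: "nat \<Rightarrow> real"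
  proof (cases "\<forall>i. y i = 0")
    case True
    then have "lead y = 0" by (simp add: lead_eq_0_iff)
    then show ?thesis using True by simp
  next
    case False
    define K where "K = lead_index y"
    have K: "y K \<noteq> 0"
      using False LeastI_ex[of "\<lambda>i. y i \<noteq> 0"] by (simp add: K_def lead_index_def)
    have K0: "y j = 0" if "j < K" for j
      using not_less_Least[of j "\<lambda>i. y i \<noteq> 0"] that by (simp add: K_def lead_index_def)
    have zero: "ennreal (y k powr \<alpha>) * indicator (B k) (\<lambda>i. y i / y k) = 0" if "k \<noteq> K" for k
    proof (cases "k < K")
      case True then show ?thesis using K0 by simp
    next
      case False
      then have "K < k" using that by simp
      then have "(\<lambda>i. y i / y k) \<notin> B k" if "y k \<noteq> 0" using K that by (auto simp: B_def)
      then show ?thesis by (cases "y k = 0") simp_all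
    qed
    define F where "F k = ennreal (y k powr \<alpha>) * indicator (B k) (\<lambda>i. y i / y k)" for k
    have "F k = 0" if "k \<noteq> K" for k unfolding F_def by (rule zero[OF that])
    then have "suminf F = F K"
      using suminf_finite[of "{K}" F] by simp
    then have "(\<Sum>k. ennreal (y k powr \<alpha>) * indicator (B k) (\<lambda>i. y i / y k)) =
        ennreal (y K powr \<alpha>) * indicator (B K) (\<lambda>i. y i / y K)"
      by (simp only: F_def[abs_def])
    also have "(\<lambda>i. y i / y K) = normalize_seq y"
      by (simp add: normalize_seq_def lead_def K_def)
    also have "indicator (B K) (normalize_seq y) = (indicator A (normalize_seq y) :: ennreal)"
      using K K0 by (auto simp: B_def indicator_def normalize_seq_def lead_def K_def[symmetric])
    also have "y K = lead y" by (simp add: lead_def K_def)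
    finally show ?thesis .
  qed
  have decomp: "emeasure (distr (density N (\<lambda>s. ennreal (lead (\<lambda>i. h i s) powr \<alpha>))) seq_space (\<lambda>s. normalize_seq (\<lambda>i. h i s))) A =
      (\<Sum>k. emeasure (distr (density N (\<lambda>s. ennreal (h k s powr \<alpha>))) seq_space (\<lambda>s i. h i s / h k s)) (B k))"
    if h: "\<And>i. h i \<in> L_plus N \<alpha>" for h :: "nat \<Rightarrow> 'c \<Rightarrow> real" and N
  proof -
    have hm [measurable]: "h i \<in> borel_measurable N" for i using L_plusD(1)[OF h] .
    have 1: "emeasure (distr (density N w) seq_space R) C = (\<integral>\<^sup>+s. w s * indicator C (R s) \<partial>N)"
      if [measurable]: "w \<in> borel_measurable N" "R \<in> measurable N seq_space" "C \<in> sets seq_space" for w R C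
    proof -
      have "emeasure (distr (density N w) seq_space R) C = (\<integral>\<^sup>+s. w s * indicator (R -` C \<inter> space N) s \<partial>N)"
        by (subst emeasure_distr, simp_all, subst emeasure_density) auto
      also have "\<dots> = (\<integral>\<^sup>+s. w s * indicator C (R s) \<partial>N)"
        by (intro nn_integral_cong) (auto simp: indicator_def)
      finally show ?thesis .
    qed
    have "emeasure (distr (density N (\<lambda>s. ennreal (lead (\<lambda>i. h i s) powr \<alpha>))) seq_space (\<lambda>s. normalize_seq (\<lambda>i. h i s))) A =
       (\<integral>\<^sup>+s. (\<Sum>k. ennreal (h k s powr \<alpha>) * indicator (B k) (\<lambda>i. h i s / h k s)) \<partial>N)"
      by (subst 1) (auto simp: point intro!: nn_integral_cong)
    also have "\<dots> = (\<Sum>k. \<integral>\<^sup>+s. ennreal (h k s powr \<alpha>) * indicator (B k) (\<lambda>i. h i s / h k s) \<partial>N)"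
      by (intro nn_integral_suminf) measurable
    also have "\<dots> = (\<Sum>k. emeasure (distr (density N (\<lambda>s. ennreal (h k s powr \<alpha>))) seq_space (\<lambda>s i. h i s / h k s)) (B k))"
      by (intro suminf_cong 1[symmetric]) measurable
    finally show ?thesis .
  qed
  show "emeasure (distr (density M (\<lambda>s. ennreal (lead (\<lambda>i. g i s) powr \<alpha>))) seq_space (\<lambda>s. normalize_seq (\<lambda>i. g i s))) A =
      emeasure (distr (density M' (\<lambda>s. ennreal (lead (\<lambda>i. g' i s) powr \<alpha>))) seq_space (\<lambda>s. normalize_seq (\<lambda>i. g' i s))) A"
    unfolding decomp[of g, OF g] decomp[of g', OF g']
    by (simp only: distr_ratios_eq[of \<alpha> M g M' g', OF same \<alpha> g g'])
qed simp

text \<open>Two families with the same integrals of maxima, the first of which separates the points of its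
space by means of \<open>G\<close>. The point map goes from the space of the second family to that of the
first.\<close>

locale matched_families =
  fixes \<alpha> :: real and M :: "'s measure" and g :: "nat \<Rightarrow> 's \<Rightarrow> real"
    and M' :: "'r measure" and g' :: "nat \<Rightarrow> 'r \<Rightarrow> real" and G :: "(nat \<Rightarrow> real) \<Rightarrow> 's"
  assumes alpha_pos: "\<alpha> > 0"
    and g: "\<And>i. g i \<in> L_plus M \<alpha>" and g': "\<And>i. g' i \<in> L_plus M' \<alpha>"
    and same: "same_max_integrals \<alpha> M g M' g'"
    and full: "AE s in M. \<exists>i. g i s \<noteq> 0" and full': "AE s in M'. \<exists>i. g' i s \<noteq> 0"
    and G [measurable]: "G \<in> measurable seq_space M"
    and recover: "AE s in M. G (normalize_seq (\<lambda>i. g i s)) = s"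
begin

definition point_map :: "'r \<Rightarrow> 's" where
  "point_map s = G (normalize_seq (\<lambda>i. g' i s))"

text \<open>At almost every point this is the factor by which \<open>g'\<close> differs from \<open>g\<close> at the image point.\<close>

definition jac :: "'r \<Rightarrow> real" where
  "jac s = lead (\<lambda>i. g' i s) / lead (\<lambda>i. g i (point_map s))"

lemma measurable_g [measurable]: "g i \<in> borel_measurable M" "g' i \<in> borel_measurable M'"
  using L_plusD(1)[OF g] L_plusD(1)[OF g'] .

lemma measurable_point_map [measurable]: "point_map \<in> measurable M' M"
  unfolding point_map_def[abs_def] by measurable

lemma measurable_jac [measurable]: "jac \<in> borel_measurable M'"
  unfolding jac_def[abs_def] by measurable

lemma lead_nn: "s \<in> space M \<Longrightarrow> 0 \<le> lead (\<lambda>i. g i s)" "s' \<in> space M' \<Longrightarrow> 0 \<le> lead (\<lambda>i. g' i s')"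
  using L_plusD(2)[OF g] L_plusD(2)[OF g'] by (auto intro!: lead_nonneg)

lemma AE_lead_pos: "AE s in M. lead (\<lambda>i. g i s) > 0" "AE s in M'. lead (\<lambda>i. g' i s) > 0"
proof -
  show "AE s in M. lead (\<lambda>i. g i s) > 0"
    using full AE_space by eventually_elim (use lead_nn lead_eq_0_iff in \<open>force simp: less_le\<close>)
  show "AE s in M'. lead (\<lambda>i. g' i s) > 0"
    using full' AE_space by eventually_elim (use lead_nn lead_eq_0_iff in \<open>force simp: less_le\<close>)
qed

abbreviation "D \<equiv> density M (\<lambda>s. ennreal (lead (\<lambda>i. g i s) powr \<alpha>))"
abbreviation "D' \<equiv> density M' (\<lambda>s. ennreal (lead (\<lambda>i. g' i s) powr \<alpha>))"

lemma AE_D_iff: "(AE s in D. P s) \<longleftrightarrow> (AE s in M. P s)" "(AE s in D'. Q s) \<longleftrightarrow> (AE s in M'. Q s)"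
proof -
  show "(AE s in D. P s) \<longleftrightarrow> (AE s in M. P s)"
    using AE_lead_pos(1) by (subst AE_density) (auto elim: eventually_rev_mp eventually_mp)
  show "(AE s in D'. Q s) \<longleftrightarrow> (AE s in M'. Q s)"
    using AE_lead_pos(2) by (subst AE_density) (auto elim: eventually_rev_mp eventually_mp)
qed

lemma distr_norm_eq:
  "distr D seq_space (\<lambda>s. normalize_seq (\<lambda>i. g i s)) = distr D' seq_space (\<lambda>s. normalize_seq (\<lambda>i. g' i s))"
  using distr_normalized_eq[OF same alpha_pos g g'] .

text \<open>Both sides are images under \<open>G\<close> of the common distribution of the normalized sequences.\<close>

lemma distr_point_map: "distr D' M point_map = D"
proof -
  have "distr D' M point_map = distr (distr D' seq_space (\<lambda>s. normalize_seq (\<lambda>i. g' i s))) M G"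
    by (subst distr_distr) (auto simp: comp_def point_map_def[abs_def])
  also have "\<dots> = distr D M (\<lambda>s. G (normalize_seq (\<lambda>i. g i s)))"
    unfolding distr_norm_eq[symmetric] by (subst distr_distr) (auto simp: comp_def)
  also have "\<dots> = distr D D (\<lambda>s. s)"
    by (rule distr_cong_AE) (use recover in \<open>auto simp: AE_D_iff\<close>)
  also have "\<dots> = D" by (rule distr_id)
  finally show ?thesis .
qed

lemma AE_point_map: assumes "AE s in M. P s" shows "AE s in M'. P (point_map s)"
proof -
  have "AE s in distr D' M point_map. P s"
    unfolding distr_point_map AE_D_iff by (rule assms)
  then have "AE s in D'. P (point_map s)"
    by (rule AE_distrD[rotated]) simp
  then show ?thesis by (simp add: AE_D_iff)
qed

text \<open>The normalized sequence of \<open>g\<close> is fixed by \<open>y \<mapsto> normalized sequence of g at G y\<close> almost surely.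
This is a property of its distribution, hence shared by the normalized sequence of \<open>g'\<close>.\<close>

lemma AE_normalize_point_map:
  "AE s in M'. normalize_seq (\<lambda>i. g i (point_map s)) = normalize_seq (\<lambda>i. g' i s)"
proof -
  have "(\<lambda>y. normalize_seq (\<lambda>i. g i (G y))) \<in> measurable seq_space seq_space"
    by measurable
  from measurable_compose[OF this measurable_component_singleton[OF UNIV_I]]
  have [measurable]: "(\<lambda>y. normalize_seq (\<lambda>i. g i (G y)) j) \<in> borel_measurable seq_space" for j .
  have "{y \<in> space seq_space. normalize_seq (\<lambda>i. g i (G y)) j = y j} \<in> sets seq_space" for j
    by (rule borel_measurable_eq) measurable
  then have "Measurable.pred seq_space (\<lambda>y. \<forall>j. normalize_seq (\<lambda>i. g i (G y)) j = y j)"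
    by (intro pred_intros_countable) (simp add: pred_def)
  then have E: "{y. \<forall>j. normalize_seq (\<lambda>i. g i (G y)) j = y j} \<in> sets seq_space"
    by (simp add: pred_def)
  have "AE s in D. \<forall>j. normalize_seq (\<lambda>i. g i (G (normalize_seq (\<lambda>i. g i s)))) j = normalize_seq (\<lambda>i. g i s) j"
    unfolding AE_D_iff using recover by eventually_elim simp
  then have "AE y in distr D seq_space (\<lambda>s. normalize_seq (\<lambda>i. g i s)). \<forall>j. normalize_seq (\<lambda>i. g i (G y)) j = y j"
    by (subst AE_distr_iff) (auto simp: E)
  then have "AE s in D'. \<forall>j. normalize_seq (\<lambda>i. g i (point_map s)) j = normalize_seq (\<lambda>i. g' i s) j"
    unfolding distr_norm_eq by (subst (asm) AE_distr_iff) (auto simp: point_map_def E)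
  then show ?thesis by (simp add: AE_D_iff fun_eq_iff)
qed

lemma AE_jac: "AE s in M'. 0 < jac s \<and> (\<forall>i. g' i s = jac s * g i (point_map s))"
  using AE_normalize_point_map AE_lead_pos(2) AE_point_map[OF AE_lead_pos(1)]
proof eventually_elim
  case (elim s)
  have "g' i s = jac s * g i (point_map s)" for i
  proof -
    have "g' i s = lead (\<lambda>i. g' i s) * normalize_seq (\<lambda>i. g' i s) i"
      by (simp add: lead_times_normalize_seq)
    also have "\<dots> = jac s * (lead (\<lambda>i. g i (point_map s)) * normalize_seq (\<lambda>i. g i (point_map s)) i)"
      using elim by (simp add: jac_def)
    also have "\<dots> = jac s * g i (point_map s)"
      by (simp only: lead_times_normalize_seq)
    finally show ?thesis .
  qed
  moreover have "0 < jac s" using elim(2,3) by (simp add: jac_def)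
  ultimately show ?case by blast
qed

text \<open>This is \<open>distr_point_map\<close> with the densities moved to one side.\<close>

lemma nn_integral_point_map:
  assumes [measurable]: "h \<in> borel_measurable M"
  shows "(\<integral>\<^sup>+s. h (point_map s) * ennreal (jac s powr \<alpha>) \<partial>M') = (\<integral>\<^sup>+s. h s \<partial>M)"
proof -
  let ?w = "\<lambda>s. ennreal (lead (\<lambda>i. g i s) powr \<alpha>)"
  have "(\<integral>\<^sup>+s. h s \<partial>M) = (\<integral>\<^sup>+s. ?w s * (h s * ennreal (lead (\<lambda>i. g i s) powr (- \<alpha>))) \<partial>M)"
    using AE_lead_pos(1)
  proof (intro nn_integral_cong_AE, eventually_elim)
    case (elim s)
    have "?w s * (h s * ennreal (lead (\<lambda>i. g i s) powr (- \<alpha>))) = h s * (?w s * ennreal (lead (\<lambda>i. g i s) powr (- \<alpha>)))"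
      by (simp add: ac_simps)
    also have "?w s * ennreal (lead (\<lambda>i. g i s) powr (- \<alpha>)) = 1"
      using elim by (simp add: ennreal_mult[symmetric] powr_minus)
    finally show ?case by simp
  qed
  also have "\<dots> = (\<integral>\<^sup>+s. h s * ennreal (lead (\<lambda>i. g i s) powr (- \<alpha>)) \<partial>D)"
    by (subst nn_integral_density) auto
  also have "\<dots> = (\<integral>\<^sup>+s. h (point_map s) * ennreal (lead (\<lambda>i. g i (point_map s)) powr (- \<alpha>)) \<partial>D')"
    unfolding distr_point_map[symmetric] by (subst nn_integral_distr) auto
  also have "\<dots> = (\<integral>\<^sup>+s. ennreal (lead (\<lambda>i. g' i s) powr \<alpha>) * (h (point_map s) * ennreal (lead (\<lambda>i. g i (point_map s)) powr (- \<alpha>))) \<partial>M')"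
    by (subst nn_integral_density) auto
  also have "\<dots> = (\<integral>\<^sup>+s. h (point_map s) * ennreal (jac s powr \<alpha>) \<partial>M')"
    using AE_lead_pos(2) AE_point_map[OF AE_lead_pos(1)]
  proof (intro nn_integral_cong_AE, eventually_elim)
    case (elim s)
    have "jac s powr \<alpha> = lead (\<lambda>i. g' i s) powr \<alpha> * lead (\<lambda>i. g i (point_map s)) powr (- \<alpha>)"
      unfolding jac_def powr_minus using elim by (subst powr_divide) (simp_all add: divide_inverse)
    then show ?case
      by (simp add: ennreal_mult ac_simps)
  qed
  finally show ?thesis ..
qed

end

section \<open>Coordinates of a minimal representation\<close>

text \<open>If every ray agrees almost everywhere with a set described by \<open>r\<close>, then the point can be read off
from its image as the infimum of the rationals \<open>q\<close> whose ray contains it.\<close>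

lemma measurable_left_inverse_AE:
  fixes M :: "real measure"
  assumes sets_M: "sets M = sets (restrict_space borel (space M))" and space_M: "space M \<in> sets borel"
    and s0: "s0 \<in> space M"
    and r [measurable]: "r \<in> measurable M Q"
    and rays: "\<And>q::rat. \<exists>E\<in>sets Q. AE s in M. s < of_rat q \<longleftrightarrow> r s \<in> E"
  shows "\<exists>G. G \<in> measurable Q M \<and> (AE s in M. G (r s) = s)"
proof -
  obtain E where E [measurable]: "\<And>q. E q \<in> sets Q"
    and AE_E: "\<And>q. AE s in M. s < of_rat q \<longleftrightarrow> r s \<in> E q"
    using rays by metis
  define G0 where "G0 y = real_of_ereal (INF q. if y \<in> E q then ereal (of_rat q) else \<infinity>)" for y
  define G where "G y = (if G0 y \<in> space M then G0 y else s0)" for y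
  have [measurable]: "G0 \<in> borel_measurable Q"
    unfolding G0_def[abs_def] by measurable
  note space_M [measurable]
  have "G \<in> borel_measurable Q"
    unfolding G_def[abs_def] by measurable
  then have "G \<in> measurable Q (restrict_space borel (space M))"
    using s0 by (intro measurable_restrict_space2) (auto simp: G_def)
  then have "G \<in> measurable Q M"
    by (simp cong: measurable_cong_sets add: sets_M)
  moreover have "AE s in M. \<forall>q. s < of_rat q \<longleftrightarrow> r s \<in> E q"
    using AE_E by (simp add: AE_all_countable)
  then have "AE s in M. G (r s) = s"
    using AE_space
  proof eventually_elim
    case (elim s)
    have "(INF q. if r s \<in> E q then ereal (of_rat q) else \<infinity>) = ereal s"
    proof (rule antisym)
      show "ereal s \<le> (INF q. if r s \<in> E q then ereal (of_rat q) else \<infinity>)"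
        using elim by (intro INF_greatest) (auto intro: less_imp_le)
      show "(INF q. if r s \<in> E q then ereal (of_rat q) else \<infinity>) \<le> ereal s"
      proof (rule ereal_le_epsilon2)
        fix e :: real assume "0 < e"
        then obtain q where q: "s < of_rat q" "of_rat q < s + e"
          using of_rat_dense[of s "s + e"] by auto
        have "(INF q. if r s \<in> E q then ereal (of_rat q) else \<infinity>) \<le> ereal (of_rat q)"
          using q elim by (intro INF_lower2[of q]) auto
        also have "\<dots> \<le> ereal s + ereal e" using q by simp
        finally show "(INF q. if r s \<in> E q then ereal (of_rat q) else \<infinity>) \<le> ereal s + ereal e" .
      qed
    qed
    then show ?case using elim by (simp add: G_def G0_def)
  qed
  ultimately show ?thesis by blast
qed

lemma ratio_sigma_field_mono: "K \<subseteq> K' \<Longrightarrow> ratio_sigma_field M K f \<subseteq> ratio_sigma_field M K' f"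
  unfolding ratio_sigma_field_def by (intro sigma_sets_mono') blast

lemma ratio_sigma_field_countable:
  assumes "A \<in> ratio_sigma_field M T f"
  shows "\<exists>K. countable K \<and> K \<subseteq> T \<and> A \<in> ratio_sigma_field M K f"
  using assms unfolding ratio_sigma_field_def[of M T f]
proof (induction rule: sigma_sets.induct)
  case (Basic a)
  then obtain t t' B where "a = (\<lambda>s. ennreal (f t s) / ennreal (f t' s)) -` B \<inter> space M"
    "t \<in> T" "t' \<in> T" "B \<in> sets borel" by blast
  then show ?case
    unfolding ratio_sigma_field_def by (intro exI[of _ "{t, t'}"]) (auto intro!: sigma_sets.Basic)
next
  case Empty
  then show ?case by (intro exI[of _ "{}"]) (auto simp: ratio_sigma_field_def intro: sigma_sets.Empty)
next
  case (Compl a)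
  then show ?case unfolding ratio_sigma_field_def by (blast intro: sigma_sets.Compl)
next
  case (Union a)
  then obtain K where K: "\<And>i. countable (K i)" "\<And>i. K i \<subseteq> T" "\<And>i. a i \<in> ratio_sigma_field M (K i) f"
    by metis
  have "a i \<in> ratio_sigma_field M (\<Union>i. K i) f" for i
    using K(3) ratio_sigma_field_mono[of "K i" "\<Union>i. K i" M f] by blast
  then have "(\<Union>i. a i) \<in> ratio_sigma_field M (\<Union>i. K i) f"
    unfolding ratio_sigma_field_def by (rule sigma_sets.Union)
  then show ?case using K by (intro exI[of _ "\<Union>i. K i"]) auto
qed

lemma ratio_normalize_seq:
  fixes y :: "nat \<Rightarrow> real"
  assumes "\<And>i. 0 \<le> y i"
  shows "ennreal (normalize_seq y i) / ennreal (normalize_seq y j) = ennreal (y i) / ennreal (y j)"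
proof (cases "lead y = 0")
  case True
  then have "y i = 0" by (simp add: lead_eq_0_iff)
  then show ?thesis using True by (simp add: normalize_seq_def)
next
  case False
  then have "lead y > 0" using lead_nonneg[of y] assms by (simp add: less_le)
  then show ?thesis
    using assms by (simp add: ratio_convention normalize_seq_def zero_less_divide_iff)
qed

text \<open>The ratios of a sequence do not change under normalization, so they are functions of the normalized
sequence.\<close>

lemma ratio_sigma_field_range:
  assumes f: "\<And>i. f (u i) \<in> borel_measurable M" "\<And>i s. s \<in> space M \<Longrightarrow> 0 \<le> f (u i) s"
    and A: "A \<in> ratio_sigma_field M (range u) f"
  shows "\<exists>E\<in>sets seq_space. A = {s \<in> space M. normalize_seq (\<lambda>i. f (u i) s) \<in> E}"
proof -
  let ?r = "\<lambda>s. normalize_seq (\<lambda>i. f (u i) s)"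
  let ?V = "vimage_algebra (space M) ?r seq_space"
  have r [measurable]: "?r \<in> measurable ?V seq_space"
    by (rule measurable_vimage_algebra1) simp
  have "{(\<lambda>s. ennreal (f t s) / ennreal (f t' s)) -` B \<inter> space M | t t' B.
        t \<in> range u \<and> t' \<in> range u \<and> B \<in> sets borel} \<subseteq> sets ?V"
  proof clarify
    fix i j and B :: "ennreal set" assume B: "B \<in> sets borel"
    have "(\<lambda>s. ennreal (?r s i) / ennreal (?r s j)) \<in> borel_measurable ?V"
      by measurable
    note measurable_sets[OF this B]
    moreover have "(\<lambda>s. ennreal (?r s i) / ennreal (?r s j)) -` B \<inter> space ?V =
        (\<lambda>s. ennreal (f (u i) s) / ennreal (f (u j) s)) -` B \<inter> space M"
      using f(2) by (auto simp: ratio_normalize_seq)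
    ultimately show "(\<lambda>s. ennreal (f (u i) s) / ennreal (f (u j) s)) -` B \<inter> space M \<in> sets ?V"
      by simp
  qed
  then have "ratio_sigma_field M (range u) f \<subseteq> sets ?V"
    unfolding ratio_sigma_field_def using sets.sigma_sets_subset[of _ ?V] by simp
  then have "A \<in> sets ?V" using A by auto
  then show ?thesis
    by (auto simp: sets_vimage_algebra2 vimage_def)
qed

text \<open>A function \<open>g\<close> of full support in the closure is a limit of max-linear combinations, which involve
only countably many times altogether. Where all the corresponding members vanish the combinations
vanish, and therefore so does \<open>g\<close>.\<close>

lemma countable_support:
  assumes f: "\<And>t. t \<in> T \<Longrightarrow> f t \<in> L_plus M \<alpha>" and supp: "is_supp M \<alpha> T f (space M)"
  shows "\<exists>K. countable K \<and> K \<subseteq> T \<and> (AE s in M. \<exists>t\<in>K. f t s \<noteq> 0)"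
proof -
  obtain g where g: "g \<in> max_linear_closure M \<alpha> T f"
    and g0: "emeasure M (sym_diff (space M) {s \<in> space M. g s \<noteq> 0}) = 0"
    using supp unfolding is_supp_def by auto
  have gL: "g \<in> L_plus M \<alpha>" using g by (simp add: max_linear_closure_def)
  note [measurable] = L_plusD(1)[OF gL]
  have "sym_diff (space M) {s \<in> space M. g s \<noteq> 0} = {s \<in> space M. \<not> g s \<noteq> 0}" by auto
  then have AE_g: "AE s in M. g s \<noteq> 0"
    using g0 by (intro AE_I[of _ _ "{s \<in> space M. \<not> g s \<noteq> 0}"]) auto
  \<comment> \<open>n, a and t describe a max-linear combination close to g\<close>
  define good where "good k n a t \<longleftrightarrow> n \<ge> 1 \<and> (\<forall>i<n. a i > 0 \<and> t i \<in> T) \<and>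
      rho_dist M \<alpha> g (\<lambda>s. Max ((\<lambda>i. a i * f (t i) s) ` {..<n})) < 1 / real (Suc k)"
    for k n :: nat and a t :: "nat \<Rightarrow> real"
  have "\<exists>w. good k (fst w) (fst (snd w)) (snd (snd w))" for k
  proof -
    have "\<exists>h\<in>max_linear_combinations T f. rho_dist M \<alpha> g h < 1 / real (Suc k)"
      using g unfolding max_linear_closure_def by auto
    then obtain n a t where "good k n a t" unfolding max_linear_combinations_def good_def by blast
    then show ?thesis by (intro exI[of _ "(n, a, t)"]) simp
  qed
  then obtain w where w: "\<And>k. good k (fst (w k)) (fst (snd (w k))) (snd (snd (w k)))"
    by metis
  define n where "n k = fst (w k)" for k
  define a where "a k = fst (snd (w k))" for k
  define t where "t k = snd (snd (w k))" for k
  have good: "good k (n k) (a k) (t k)" for k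
    using w by (simp add: n_def a_def t_def)
  have n: "n k \<ge> 1" and a: "i < n k \<Longrightarrow> a k i > 0" and t: "i < n k \<Longrightarrow> t k i \<in> T"
    and rho: "rho_dist M \<alpha> g (\<lambda>s. Max ((\<lambda>i. a k i * f (t k i) s) ` {..<n k})) < 1 / real (Suc k)" for k i
    using good[of k] by (auto simp: good_def)
  define K where "K = (\<Union>k. t k ` {..<n k})"
  have K: "countable K" "K \<subseteq> T" using t by (auto simp: K_def)
  define h where "h k s = Max ((\<lambda>i. a k i * f (t k i) s) ` {..<n k})" for k s
  have hL: "h k \<in> L_plus M \<alpha>" for k
    unfolding h_def[abs_def] using n[of k] a[of _ k] t[of _ k] f by (intro L_plus_Max) (auto intro: less_imp_le)
  note [measurable] = L_plusD(1)[OF hL]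
  define Z where "Z = {s \<in> space M. \<forall>t\<in>K. f t s = 0}"
  have Z [measurable]: "Z \<in> sets M"
  proof -
    have [measurable]: "f t \<in> borel_measurable M" if "t \<in> K" for t
      using K(2) that L_plusD(1)[OF f] by auto
    have "Z = space M - (\<Union>t\<in>K. {s \<in> space M. f t s \<noteq> 0})" by (auto simp: Z_def)
    also have "\<dots> \<in> sets M"
      by (intro sets.Diff sets.top sets.countable_UN'[OF K(1)]) (auto simp: image_subset_iff)
    finally show ?thesis .
  qed
  have h0: "h k s = 0" if "s \<in> Z" for k s
  proof -
    have "(\<lambda>i. a k i * f (t k i) s) ` {..<n k} = (\<lambda>i. 0) ` {..<n k}"
      using that by (intro image_cong) (auto simp: Z_def K_def)
    also have "\<dots> = {0}" using n[of k] by (simp add: image_constant_conv lessThan_empty_iff)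
    finally have "(\<lambda>i. a k i * f (t k i) s) ` {..<n k} = {0}" .
    then show ?thesis by (simp add: h_def)
  qed
  have le: "(\<integral>s. g s powr \<alpha> * indicator Z s \<partial>M) \<le> 1 / real (Suc k)" for k
  proof -
    have "(\<integral>s. g s powr \<alpha> * indicator Z s \<partial>M) \<le> (\<integral>s. \<bar>g s powr \<alpha> - h k s powr \<alpha>\<bar> \<partial>M)"
    proof (rule integral_mono)
      show "integrable M (\<lambda>s. g s powr \<alpha> * indicator Z s)"
        by (intro integrable_real_mult_indicator Z L_plusD(3)[OF gL])
      show "integrable M (\<lambda>s. \<bar>g s powr \<alpha> - h k s powr \<alpha>\<bar>)"
        by (intro integrable_abs Bochner_Integration.integrable_diff L_plusD(3) gL hL)
    qed (auto simp: indicator_def h0)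
    also have "\<dots> < 1 / real (Suc k)"
      using rho[of k] by (simp add: rho_dist_def h_def)
    finally show ?thesis by simp
  qed
  have "(\<integral>s. g s powr \<alpha> * indicator Z s \<partial>M) \<le> 0"
    using LIMSEQ_le_const[OF LIMSEQ_inverse_real_of_nat] le by (auto simp: inverse_eq_divide)
  moreover have "0 \<le> (\<integral>s. g s powr \<alpha> * indicator Z s \<partial>M)"
    by (intro integral_nonneg_AE) auto
  ultimately have "(\<integral>s. g s powr \<alpha> * indicator Z s \<partial>M) = 0" by simp
  then have "AE s in M. g s powr \<alpha> * indicator Z s = 0"
    by (subst (asm) integral_nonneg_eq_0_iff_AE)
      (auto intro!: integrable_real_mult_indicator Z L_plusD(3)[OF gL])
  with AE_g AE_space have "AE s in M. \<exists>t\<in>K. f t s \<noteq> 0"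
  proof eventually_elim
    case (elim s)
    then have "s \<notin> Z" by (auto simp: indicator_def)
    then show ?case using elim by (auto simp: Z_def)
  qed
  with K show ?thesis by blast
qed

text \<open>The times needed for the support and those needed to approximate each rational ray by a set of the
ratio field are countable in number.\<close>

lemma minimal_representation_coordinates:
  fixes M :: "real measure"
  assumes sets_M: "sets M = sets (restrict_space borel (space M))" and space_M: "space M \<in> sets borel"
    and ne: "space M \<noteq> {}" and T: "T \<noteq> {}"
    and f: "\<And>t. t \<in> T \<Longrightarrow> f t \<in> L_plus M \<alpha>"
    and min: "minimal_representation M \<alpha> T f"
  shows "\<exists>u G. range u \<subseteq> T \<and> (AE s in M. \<exists>i::nat. f (u i) s \<noteq> 0) \<and> G \<in> measurable seq_space M \<and>
     (AE s in M. G (normalize_seq (\<lambda>i. f (u i) s)) = s)"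
proof -
  obtain K0 where K0: "countable K0" "K0 \<subseteq> T" "AE s in M. \<exists>t\<in>K0. f t s \<noteq> 0"
    using countable_support[of T f M \<alpha>] f min by (auto simp: minimal_representation_def)
  have ray: "{s \<in> space M. s < of_rat q} \<in> sets M" for q :: rat
    using space_M by (auto simp: sets_M sets_restrict_space_iff)
  have "\<exists>A\<in>ratio_sigma_field M T f. emeasure M (sym_diff A {s \<in> space M. s < of_rat q}) = 0" for q :: rat
    using min ray unfolding minimal_representation_def by blast
  then obtain A where A: "\<And>q. A q \<in> ratio_sigma_field M T f"
    and A0: "\<And>q::rat. emeasure M (sym_diff (A q) {s \<in> space M. s < of_rat q}) = 0"
    by metis
  obtain K where K: "\<And>q. countable (K q)" "\<And>q. K q \<subseteq> T" "\<And>q. A q \<in> ratio_sigma_field M (K q) f"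
    using ratio_sigma_field_countable[OF A] by metis
  obtain t0 where t0: "t0 \<in> T" using T by auto
  \<comment> \<open>the extra time only serves to make the set nonempty\<close>
  define L where "L = insert t0 (K0 \<union> (\<Union>q. K q))"
  have L: "countable L" "L \<subseteq> T" "L \<noteq> {}" using K K0 t0 by (auto simp: L_def)
  define u where "u = from_nat_into L"
  have u: "range u = L" unfolding u_def using L by (simp add: range_from_nat_into)
  have fu: "f (u i) \<in> L_plus M \<alpha>" for i using u L f by blast
  note [measurable] = L_plusD(1)[OF fu]
  have "AE s in M. \<exists>i. f (u i) s \<noteq> 0"
    using K0(3)
  proof eventually_elim
    case (elim s)
    then obtain t where "t \<in> L" "f t s \<noteq> 0" by (auto simp: L_def)
    moreover then obtain i where "t = u i" using u by blast
    ultimately show ?case by blast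
  qed
  moreover have "\<exists>E\<in>sets seq_space. AE s in M. s < of_rat q \<longleftrightarrow> normalize_seq (\<lambda>i. f (u i) s) \<in> E" for q :: rat
  proof -
    have "A q \<in> ratio_sigma_field M (range u) f"
      using K(3)[of q] ratio_sigma_field_mono[of "K q" "range u" M f] u by (auto simp: L_def)
    then obtain E where E [measurable]: "E \<in> sets seq_space"
      and AE: "A q = {s \<in> space M. normalize_seq (\<lambda>i. f (u i) s) \<in> E}"
      using ratio_sigma_field_range[of f u M "A q", OF L_plusD(1)[OF fu] L_plusD(2)[OF fu]] by auto
    have [measurable]: "A q \<in> sets M" unfolding AE by measurable
    note ray[of q, measurable]
    have "AE s in M. s \<notin> sym_diff (A q) {s \<in> space M. s < of_rat q}"
      by (rule AE_not_in) (use A0[of q] in \<open>auto simp: null_sets_def\<close>)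
    then have "AE s in M. s < of_rat q \<longleftrightarrow> normalize_seq (\<lambda>i. f (u i) s) \<in> E"
      using AE_space by eventually_elim (auto simp: AE)
    with E show ?thesis by blast
  qed
  then have "\<exists>G. G \<in> measurable seq_space M \<and> (AE s in M. G (normalize_seq (\<lambda>i. f (u i) s)) = s)"
    using ne by (intro measurable_left_inverse_AE[of M "SOME s. s \<in> space M"] sets_M space_M)
      (auto simp: some_in_eq)
  ultimately show ?thesis using u L by blast
qed

lemma stationary_same_max_integrals:
  assumes stat: "stationary_process P T X" and rep: "spectral_representation P M \<alpha> T X f"
    and T: "\<And>t t'. t \<in> T \<Longrightarrow> t' \<in> T \<Longrightarrow> t + t' \<in> T"
    and u: "\<And>i. u i \<in> T" and h: "h \<in> T"
  shows "same_max_integrals \<alpha> M (\<lambda>i. f (u i)) M (\<lambda>i. f (u i + h))"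
  unfolding same_max_integrals_def
proof (intro allI impI)
  fix n :: nat and a :: "nat \<Rightarrow> real" assume n: "1 \<le> n" and a: "\<forall>i<n. 0 < a i"
  \<comment> \<open>the levels of the process are the inverses of the coefficients of the maximum\<close>
  define x where "x i = inverse (a i)" for i
  have rep': "measure P {\<omega> \<in> space P. \<forall>i<n. X (t i) \<omega> \<le> x i} =
        exp (- (\<integral>s. (Max ((\<lambda>i. a i * f (t i) s) ` {..<n})) powr \<alpha> \<partial>M))"
    if "\<And>i. t i \<in> T" for t
  proof -
    have "\<forall>i<n. t i \<in> T \<and> x i > 0" using that a by (auto simp: x_def)
    then have "measure P {\<omega> \<in> space P. \<forall>i<n. X (t i) \<omega> \<le> x i} =
        exp (- (\<integral>s. (Max ((\<lambda>i. inverse (x i) * f (t i) s) ` {..<n})) powr \<alpha> \<partial>M))"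
      using rep n unfolding spectral_representation_def by blast
    then show ?thesis by (simp add: x_def)
  qed
  have X [measurable]: "X t \<in> borel_measurable P" if "t \<in> T" for t
    using stat that by (auto simp: stationary_process_def)
  let ?Q = "\<Pi>\<^sub>M i\<in>{..<n}. (borel :: real measure)"
  let ?C = "{y \<in> space ?Q. \<forall>i\<in>{..<n}. y i \<le> x i}"
  have C [measurable]: "?C \<in> sets ?Q" by measurable
  have pr: "measure (distr P ?Q (\<lambda>\<omega>. \<lambda>i\<in>{..<n}. X (t i) \<omega>)) ?C = measure P {\<omega> \<in> space P. \<forall>i<n. X (t i) \<omega> \<le> x i}"
    if "\<And>i. t i \<in> T" for t
  proof -
    have [measurable]: "X (t i) \<in> borel_measurable P" for i using X that by auto
    have "measure (distr P ?Q (\<lambda>\<omega>. \<lambda>i\<in>{..<n}. X (t i) \<omega>)) ?C =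
       measure P ((\<lambda>\<omega>. \<lambda>i\<in>{..<n}. X (t i) \<omega>) -` ?C \<inter> space P)"
      by (rule measure_distr) measurable
    also have "(\<lambda>\<omega>. \<lambda>i\<in>{..<n}. X (t i) \<omega>) -` ?C \<inter> space P = {\<omega> \<in> space P. \<forall>i<n. X (t i) \<omega> \<le> x i}"
      by (auto simp: space_PiM)
    finally show ?thesis .
  qed
  have uT: "\<And>i. u i \<in> T" "\<And>i. u i + h \<in> T" using u h T by auto
  have "distr P ?Q (\<lambda>\<omega>. \<lambda>i\<in>{..<n}. X (u i + h) \<omega>) = distr P ?Q (\<lambda>\<omega>. \<lambda>i\<in>{..<n}. X (u i) \<omega>)"
    using stat h u unfolding stationary_process_def by blast
  then have "exp (- (\<integral>s. (Max ((\<lambda>i. a i * f (u i + h) s) ` {..<n})) powr \<alpha> \<partial>M)) =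
     exp (- (\<integral>s. (Max ((\<lambda>i. a i * f (u i) s) ` {..<n})) powr \<alpha> \<partial>M))"
    using pr[of u, OF uT(1)] pr[of "\<lambda>i. u i + h", OF uT(2)] rep'[of u, OF uT(1)] rep'[of "\<lambda>i. u i + h", OF uT(2)] by simp
  then show "(\<integral>s. (Max ((\<lambda>i. a i * f (u i) s) ` {..<n})) powr \<alpha> \<partial>M) =
     (\<integral>s. (Max ((\<lambda>i. a i * f (u i + h) s) ` {..<n})) powr \<alpha> \<partial>M)"
    by simp
qed

section \<open>Point maps induced by the shifts of time\<close>

locale time_group =
  fixes T :: "real set"
  assumes zero_T: "0 \<in> T" and add_T: "\<And>t t'. t \<in> T \<Longrightarrow> t' \<in> T \<Longrightarrow> t + t' \<in> T"
    and uminus_T: "\<And>t. t \<in> T \<Longrightarrow> - t \<in> T"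

text \<open>The times \<open>u i\<close> are those whose normalized sequence determines the point, by means of \<open>G\<close>.\<close>

locale spectral_coordinates = time_group +
  fixes \<alpha> :: real and M :: "'s measure" and f :: "real \<Rightarrow> 's \<Rightarrow> real"
    and u :: "nat \<Rightarrow> real" and G :: "(nat \<Rightarrow> real) \<Rightarrow> 's"
  assumes alpha_pos: "\<alpha> > 0"
    and f: "\<And>t. t \<in> T \<Longrightarrow> f t \<in> L_plus M \<alpha>"
    and joint: "jointly_measurable M T f"
    and invariant: "\<And>v h. (\<And>i. v i \<in> T) \<Longrightarrow> h \<in> T \<Longrightarrow>
       same_max_integrals \<alpha> M (\<lambda>i. f (v i)) M (\<lambda>i. f (v i + h))"
    and u: "\<And>i. u i \<in> T"
    and full: "AE s in M. \<exists>i. f (u i) s \<noteq> 0"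
    and G [measurable]: "G \<in> measurable seq_space M"
    and recover: "AE s in M. G (normalize_seq (\<lambda>i. f (u i) s)) = s"
begin

lemma measurable_f: "t \<in> T \<Longrightarrow> f t \<in> borel_measurable M"
  using L_plusD(1)[OF f] .

text \<open>That the members at the times \<open>u i\<close> have full support says that no \<open>f t\<close> charges their common zero
set. This is a property of the distribution of ratios to \<open>f t\<close>, hence it holds for the shifted times,
and the times \<open>t = u j - h\<close> return the original members.\<close>

lemma full_shift:
  assumes h: "h \<in> T"
  shows "AE s in M. \<exists>i. f (u i + h) s \<noteq> 0"
proof -
  have T: "t \<in> T \<Longrightarrow> t + h \<in> T" for t using h add_T by auto
  have key: "AE s in M. f (t + h) s \<noteq> 0 \<longrightarrow> (\<exists>i. f (u i + h) s \<noteq> 0)" if t: "t \<in> T" for t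
  proof -
    define v where "v = case_nat t u"
    have v: "v i \<in> T" for i using t u by (cases i) (auto simp: v_def)
    define E where "E = {y. \<exists>i. y (Suc i) \<noteq> (0::real)}"
    have "{y \<in> space seq_space. \<exists>i. y (Suc i) \<noteq> 0} \<in> sets seq_space" by measurable
    then have E [measurable]: "E \<in> sets seq_space" by (simp add: E_def)
    have vm: "f (v i) \<in> borel_measurable M" "f (v i + h) \<in> borel_measurable M" for i
      using measurable_f v T by auto
    have r: "(\<lambda>s i. f (v i) s / f (v 0) s) \<in> measurable M seq_space"
      "(\<lambda>s i. f (v i + h) s / f (v 0 + h) s) \<in> measurable M seq_space"
      using vm by (auto intro!: measurable_seq borel_measurable_divide)
    have eq: "distr (density M (\<lambda>s. ennreal (f (v 0) s powr \<alpha>))) seq_space (\<lambda>s i. f (v i) s / f (v 0) s) =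
       distr (density M (\<lambda>s. ennreal (f (v 0 + h) s powr \<alpha>))) seq_space (\<lambda>s i. f (v i + h) s / f (v 0 + h) s)"
      by (rule distr_ratios_eq[OF invariant[OF v h] alpha_pos f f]) (use v T in auto)
    have "AE s in M. 0 < f (v 0) s powr \<alpha> \<longrightarrow> (\<lambda>i. f (v i) s / f (v 0) s) \<in> E"
      using full by eventually_elim (auto simp: E_def v_def)
    then have "AE y in distr (density M (\<lambda>s. ennreal (f (v 0) s powr \<alpha>))) seq_space (\<lambda>s i. f (v i) s / f (v 0) s). y \<in> E"
      using r vm E by (subst AE_distr_iff) (auto simp: AE_density)
    then have "AE s in M. 0 < f (v 0 + h) s powr \<alpha> \<longrightarrow> (\<lambda>i. f (v i + h) s / f (v 0 + h) s) \<in> E"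
      unfolding eq using r vm E by (subst (asm) AE_distr_iff) (auto simp: AE_density)
    then show ?thesis
      by eventually_elim (auto simp: E_def v_def)
  qed
  have "AE s in M. \<forall>j. f (u j) s \<noteq> 0 \<longrightarrow> (\<exists>i. f (u i + h) s \<noteq> 0)"
  proof (subst AE_all_countable, intro allI)
    fix j
    have "u j - h \<in> T" using add_T[OF u uminus_T[OF h]] by simp
    from key[OF this] show "AE s in M. f (u j) s \<noteq> 0 \<longrightarrow> (\<exists>i. f (u i + h) s \<noteq> 0)" by simp
  qed
  with full show ?thesis by eventually_elim blast
qed

definition near_map :: "real \<Rightarrow> 's \<Rightarrow> 's" where
  "near_map h s = G (normalize_seq (\<lambda>i. f (u i + h) s))"

definition near_jac :: "real \<Rightarrow> 's \<Rightarrow> real" where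
  "near_jac h s = lead (\<lambda>i. f (u i + h) s) / lead (\<lambda>i. f (u i) (near_map h s))"

lemma matched: "h \<in> T \<Longrightarrow> matched_families \<alpha> M (\<lambda>i. f (u i)) M (\<lambda>i. f (u i + h)) G"
  by unfold_locales (auto intro!: alpha_pos f u add_T invariant full full_shift recover)

lemma near_map_eq: "h \<in> T \<Longrightarrow> matched_families.point_map (\<lambda>i. f (u i + h)) G = near_map h"
  by (rule ext) (simp add: matched_families.point_map_def[OF matched] near_map_def)

lemma near_jac_eq:
  "h \<in> T \<Longrightarrow> matched_families.jac (\<lambda>i. f (u i)) (\<lambda>i. f (u i + h)) G = near_jac h"
  by (rule ext) (simp add: matched_families.jac_def[OF matched] near_jac_def near_map_eq)

lemma measurable_near_jac: "h \<in> T \<Longrightarrow> near_jac h \<in> borel_measurable M"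
  using matched_families.measurable_jac[OF matched] by (simp add: near_jac_eq)

lemma AE_near_map: "h \<in> T \<Longrightarrow> AE s in M. P s \<Longrightarrow> AE s in M. P (near_map h s)"
  using matched_families.AE_point_map[OF matched, of h P] by (simp add: near_map_eq)

lemma nn_integral_near_map:
  "h \<in> T \<Longrightarrow> k \<in> borel_measurable M \<Longrightarrow>
     (\<integral>\<^sup>+s. k (near_map h s) * ennreal (near_jac h s powr \<alpha>) \<partial>M) = (\<integral>\<^sup>+s. k s \<partial>M)"
  using matched_families.nn_integral_point_map[OF matched, of h k] by (simp add: near_map_eq near_jac_eq)

lemma AE_near_jac:
  "h \<in> T \<Longrightarrow> AE s in M. 0 < near_jac h s \<and> (\<forall>i. f (u i + h) s = near_jac h s * f (u i) (near_map h s))"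
  using matched_families.AE_jac[OF matched, of h] by (simp add: near_map_eq near_jac_eq)

lemma near_map_0: "AE s in M. near_map 0 s = s"
  using recover by (simp add: near_map_def)

text \<open>A further time \<open>t\<close> can be put in front of the coordinates \<open>u\<close>. The inverse \<open>G\<close> composed with the
removal of the first entry is an inverse for the longer sequence, and it leads to the same point map.
So the relation known for the coordinates holds for \<open>t\<close> too, with the same factor.\<close>

lemma near_map_represents:
  assumes h: "h \<in> T" and t: "t \<in> T"
  shows "AE s in M. f (t + h) s = near_jac h s * f t (near_map h s)"
proof -
  define v where "v = case_nat t u"
  define G' where "G' y = G (normalize_seq (\<lambda>i. y (Suc i)))" for y
  have v0: "v 0 = t" and vS: "v (Suc i) = u i" for i by (simp_all add: v_def)
  have v: "v i \<in> T" for i using t u by (cases i) (auto simp: v0 vS)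
  have G'_norm: "G' (normalize_seq y) = G (normalize_seq (\<lambda>i. y (Suc i)))" for y
  proof (cases "lead y = 0")
    case True
    then have "y = (\<lambda>i. 0)" by (auto simp: lead_eq_0_iff)
    then show ?thesis by (simp add: G'_def normalize_seq_def)
  next
    case False
    have "normalize_seq y = (\<lambda>i. inverse (lead y) * y i)"
      by (auto simp: normalize_seq_def field_simps)
    then show ?thesis
      using False normalize_seq_scale[of "inverse (lead y)" "\<lambda>i. y (Suc i)"] by (simp add: G'_def)
  qed
  interpret v: spectral_coordinates T \<alpha> M f v G'
  proof
    show "AE s in M. \<exists>i. f (v i) s \<noteq> 0"
      using full by eventually_elim (auto simp flip: vS intro: exI[of _ "Suc _"])
    have "(\<lambda>y i. y (Suc i)) \<in> measurable seq_space seq_space"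
      by (intro measurable_seq) measurable
    then show "G' \<in> measurable seq_space M"
      unfolding G'_def[abs_def] by (intro measurable_compose[OF _ G] measurable_compose[OF _ measurable_normalize_seq])
    show "AE s in M. G' (normalize_seq (\<lambda>i. f (v i) s)) = s"
      using recover by (simp add: G'_norm vS)
  qed (use alpha_pos f joint invariant v in auto)
  have same: "v.near_map h = near_map h"
  proof
    fix s
    show "v.near_map h s = near_map h s"
      unfolding v.near_map_def near_map_def G'_norm by (simp add: vS)
  qed
  show ?thesis
    using AE_near_jac[OF h] v.AE_near_jac[OF h] AE_near_map[OF h full]
  proof eventually_elim
    case (elim s)
    then obtain i where i: "f (u i) (near_map h s) \<noteq> 0" by blast
    have j: "f (u i + h) s = v.near_jac h s * f (u i) (near_map h s)"
      using elim(2)[THEN conjunct2, THEN spec, of "Suc i"] by (simp add: same vS)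
    moreover have "f (u i + h) s = near_jac h s * f (u i) (near_map h s)"
      using elim(1) by blast
    ultimately have "v.near_jac h s = near_jac h s" using i by simp
    then show ?case
      using elim(2)[THEN conjunct2, THEN spec, of 0] by (simp add: same v0)
  qed
qed

text \<open>A map that turns the coordinates into the shifted ones up to a factor preserves normalized
sequences, and these determine the point.\<close>

lemma near_map_unique:
  assumes rep: "AE s in M. 0 < c s \<and> (\<forall>i. f (u i + h) s = c s * f (u i) (\<psi> s))"
    and rec: "AE s in M. G (normalize_seq (\<lambda>i. f (u i) (\<psi> s))) = \<psi> s"
  shows "AE s in M. \<psi> s = near_map h s"
  using rep rec
proof eventually_elim
  case (elim s)
  then have "near_map h s = G (normalize_seq (\<lambda>i. c s * f (u i) (\<psi> s)))"
    by (simp add: near_map_def)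
  also have "\<dots> = \<psi> s" using elim normalize_seq_scale[of "c s" "\<lambda>i. f (u i) (\<psi> s)"] by simp
  finally show ?case by simp
qed

lemma near_map_add:
  assumes h: "h \<in> T" and t: "t \<in> T"
  shows "AE s in M. near_map t (near_map h s) = near_map (h + t) s"
proof -
  have "AE s in M. \<forall>i. f (u i + t + h) s = near_jac h s * f (u i + t) (near_map h s)"
    unfolding AE_all_countable using near_map_represents[OF h add_T[OF u t]] by blast
  then show ?thesis using AE_near_jac[OF h]
  proof eventually_elim
    case (elim s)
    have "near_map (h + t) s = G (normalize_seq (\<lambda>i. near_jac h s * f (u i + t) (near_map h s)))"
    proof -
      have "u i + (h + t) = u i + t + h" for i by simp
      then show ?thesis unfolding near_map_def[of "h + t"] by (simp only: elim(1))
    qed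
    also have "\<dots> = near_map t (near_map h s)"
    proof -
      have "near_jac h s \<noteq> 0" using elim(2) by simp
      from normalize_seq_scale[OF this] show ?thesis unfolding near_map_def[of t] by (simp only:)
    qed
    finally show ?case by simp
  qed
qed

lemma measurable_near_map_joint:
  "(\<lambda>(t, s). near_map t s) \<in> measurable (restrict_space borel T \<Otimes>\<^sub>M M) M"
proof -
  have "(\<lambda>(t, s). f (u i + t) s) \<in> borel_measurable (restrict_space borel T \<Otimes>\<^sub>M M)" for i
  proof -
    have "(\<lambda>t. u i + t) \<in> measurable (restrict_space borel T) (restrict_space borel T)"
      using u add_T by (intro measurable_restrict_space2) (auto simp: space_restrict_space intro: measurable_restrict_space1)
    then have "(\<lambda>p. (u i + fst p, snd p)) \<in> measurable (restrict_space borel T \<Otimes>\<^sub>M M) (restrict_space borel T \<Otimes>\<^sub>M M)"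
      by (intro measurable_Pair measurable_compose[OF measurable_fst] measurable_snd)
    from measurable_compose[OF this joint[unfolded jointly_measurable_def]]
    show ?thesis by (simp add: split_beta')
  qed
  then have "(\<lambda>p i. case p of (t, s) \<Rightarrow> f (u i + t) s) \<in> measurable (restrict_space borel T \<Otimes>\<^sub>M M) seq_space"
    by (rule measurable_seq)
  from measurable_compose[OF measurable_compose[OF this measurable_normalize_seq] G]
  show ?thesis by (simp add: near_map_def split_beta')
qed

end

section \<open>Paths and their codes in a null set\<close>

text \<open>For each \<open>n\<close> these are the indefinite integrals of functions with values in \<open>[-1, 1]\<close>. They stand for
functions of time up to null sets, in a form that can be evaluated at points.\<close>

definition path_set :: "(nat \<times> real \<Rightarrow> real) set" where
  "path_set = {y. \<forall>n. y (n, 0) = 0 \<and> (\<forall>x x'. \<bar>y (n, x) - y (n, x')\<bar> \<le> \<bar>x - x'\<bar>)}"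

definition path_space :: "(nat \<times> real \<Rightarrow> real) measure" where
  "path_space = restrict_space (PiM UNIV (\<lambda>_. borel)) path_set"

text \<open>Translation of the integrand by \<open>u\<close>; the subtraction lets the integral start at \<open>0\<close> again.\<close>

definition path_shift :: "real \<Rightarrow> (nat \<times> real \<Rightarrow> real) \<Rightarrow> nat \<times> real \<Rightarrow> real" where
  "path_shift u y = (\<lambda>(n, x). y (n, x + u) - y (n, u))"

lemma space_path_space [simp]: "space path_space = path_set"
  by (simp add: path_space_def space_restrict_space space_PiM)

lemma path_shift_in [simp, intro]: "y \<in> path_set \<Longrightarrow> path_shift u y \<in> path_set"
  unfolding path_set_def path_shift_def by (auto, metis add_diff_cancel_right)

lemma path_shift_0: "y \<in> path_set \<Longrightarrow> path_shift 0 y = y"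
  by (auto simp: path_set_def path_shift_def)

lemma path_shift_add: "path_shift t (path_shift h y) = path_shift (h + t) y"
  by (auto simp: path_shift_def algebra_simps)

lemma measurable_into_path_space:
  assumes "\<And>s. s \<in> space N \<Longrightarrow> F s \<in> path_set" "\<And>n x. (\<lambda>s. F s (n, x)) \<in> borel_measurable N"
  shows "F \<in> measurable N path_space"
  unfolding path_space_def using assms
  by (intro measurable_restrict_space2 measurable_PiM_single') auto

lemma measurable_path_eval: "(\<lambda>y. y k) \<in> borel_measurable path_space"
  unfolding path_space_def by (intro measurable_restrict_space1) measurable

lemma path_scaled_floor_tendsto:
  assumes "y \<in> path_set"
  shows "(\<lambda>k. y (n, real_of_int \<lfloor>real (Suc k) * u\<rfloor> / real (Suc k))) \<longlonglongrightarrow> y (n, u)"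
proof (rule LIM_zero_cancel, rule Lim_null_comparison)
  show "(\<lambda>k. 1 / real (Suc k)) \<longlonglongrightarrow> 0" using LIMSEQ_inverse_real_of_nat by (simp add: inverse_eq_divide)
  show "\<forall>\<^sub>F k in sequentially. norm (y (n, real_of_int \<lfloor>real (Suc k) * u\<rfloor> / real (Suc k)) - y (n, u)) \<le> 1 / real (Suc k)"
  proof (rule always_eventually, rule allI)
    fix k
    have "\<bar>y (n, real_of_int \<lfloor>real (Suc k) * u\<rfloor> / real (Suc k)) - y (n, u)\<bar>
        \<le> \<bar>real_of_int \<lfloor>real (Suc k) * u\<rfloor> / real (Suc k) - u\<bar>"
      using assms by (auto simp: path_set_def)
    also have "\<dots> = \<bar>real_of_int \<lfloor>real (Suc k) * u\<rfloor> - real (Suc k) * u\<bar> / real (Suc k)"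
      by (simp add: field_simps abs_divide flip: abs_mult_pos)
    also have "\<dots> \<le> 1 / real (Suc k)"
      by (intro divide_right_mono) linarith+
    finally show "norm (y (n, real_of_int \<lfloor>real (Suc k) * u\<rfloor> / real (Suc k)) - y (n, u)) \<le> 1 / real (Suc k)"
      by simp
  qed
qed

text \<open>Continuity in time allows the measurable time to be replaced by countably many values.\<close>

lemma measurable_path_eval_joint:
  assumes u: "u \<in> borel_measurable N" and F: "F \<in> measurable N path_space"
  shows "(\<lambda>s. F s (n, u s)) \<in> borel_measurable N"
proof (rule borel_measurable_LIMSEQ_real)
  show "(\<lambda>k. F s (n, real_of_int \<lfloor>real (Suc k) * u s\<rfloor> / real (Suc k))) \<longlonglongrightarrow> F s (n, u s)" if "s \<in> space N" for s
    using measurable_space[OF F that] by (intro path_scaled_floor_tendsto) simp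
  show "(\<lambda>s. F s (n, real_of_int \<lfloor>real (Suc k) * u s\<rfloor> / real (Suc k))) \<in> borel_measurable N" for k
  proof (rule measurable_compose_countable[where f = "\<lambda>(i::int) s. F s (n, real_of_int i / real (Suc k))"])
    show "(\<lambda>s. F s (n, real_of_int i / real (Suc k))) \<in> borel_measurable N" for i
      by (rule measurable_compose[OF F measurable_path_eval])
    show "(\<lambda>s. \<lfloor>real (Suc k) * u s\<rfloor>) \<in> measurable N (count_space UNIV)"
      using u by measurable
  qed
qed

lemma measurable_path_shift:
  assumes u: "u \<in> borel_measurable N" and F: "F \<in> measurable N path_space"
  shows "(\<lambda>s. path_shift (u s) (F s)) \<in> measurable N path_space"
proof (rule measurable_into_path_space)
  show "path_shift (u s) (F s) \<in> path_set" if "s \<in> space N" for s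
    using measurable_space[OF F that] by simp
  show "(\<lambda>s. path_shift (u s) (F s) (n, x)) \<in> borel_measurable N" for n x
    unfolding path_shift_def prod.case
    by (intro borel_measurable_diff measurable_path_eval_joint borel_measurable_add borel_measurable_const u F)
qed

lemma path_eqI:
  assumes y: "y \<in> path_set" "y' \<in> path_set" and eq: "\<And>n q. y (n, of_rat q) = y' (n, of_rat q)"
  shows "y = y'"
proof
  fix k :: "nat \<times> real"
  obtain n x where k: "k = (n, x)" by (cases k)
  have "(\<lambda>k. y (n, real_of_int \<lfloor>real (Suc k) * x\<rfloor> / real (Suc k))) = (\<lambda>k. y' (n, real_of_int \<lfloor>real (Suc k) * x\<rfloor> / real (Suc k)))"
  proof
    fix k
    have "real_of_int \<lfloor>real (Suc k) * x\<rfloor> / real (Suc k) = of_rat (of_int \<lfloor>real (Suc k) * x\<rfloor> / of_nat (Suc k))"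
      by (simp add: of_rat_divide of_rat_add)
    then show "y (n, real_of_int \<lfloor>real (Suc k) * x\<rfloor> / real (Suc k)) = y' (n, real_of_int \<lfloor>real (Suc k) * x\<rfloor> / real (Suc k))"
      by (simp only: eq)
  qed
  then show "y k = y' k"
    using path_scaled_floor_tendsto[OF y(1), of n x] path_scaled_floor_tendsto[OF y(2), of n x] k
    by (simp only: LIMSEQ_unique)
qed

lemma sets_path_eq:
  assumes F: "F \<in> measurable N path_space" and H: "H \<in> measurable N path_space"
  shows "{s \<in> space N. F s = H s} \<in> sets N"
proof -
  have "{s \<in> space N. F s = H s} = {s \<in> space N. \<forall>n. \<forall>q. F s (n, of_rat q) = H s (n, of_rat q)}"
    using measurable_space[OF F] measurable_space[OF H] by (auto intro!: path_eqI)
  also have "\<dots> \<in> sets N"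
    using measurable_compose[OF F measurable_path_eval] measurable_compose[OF H measurable_path_eval]
    by (intro sets.sets_Collect_countable_All borel_measurable_eq)
  finally show ?thesis .
qed

text \<open>Expansions in base \<open>4\<close> with digits \<open>0\<close> and \<open>1\<close> only. As \<open>1/3\<close> is the largest sum, the digits are
unique, and the set of sums is null.\<close>

definition digit_sum :: "(nat \<Rightarrow> bool) \<Rightarrow> real" where
  "digit_sum b = (\<Sum>m. of_bool (b m) / 4 ^ Suc m)"

lemma digit_sum_summable: "summable (\<lambda>m. of_bool (b m) / (4::real) ^ Suc m)"
proof (rule summable_comparison_test')
  show "summable (\<lambda>m. (1/4::real) ^ m)" by (rule summable_geometric) simp
  show "norm (of_bool (b m) / (4::real) ^ Suc m) \<le> (1/4) ^ m" for m
    by (simp add: power_one_over field_simps of_bool_def)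
qed

lemma digit_sum_Suc: "4 * digit_sum b = of_bool (b 0) + digit_sum (\<lambda>m. b (Suc m))"
proof -
  have "digit_sum b = of_bool (b 0) / 4 + (\<Sum>m. of_bool (b (Suc m)) / 4 ^ Suc (Suc m))"
    unfolding digit_sum_def using suminf_split_head[OF digit_sum_summable[of b]] by simp
  also have "(\<Sum>m. of_bool (b (Suc m)) / 4 ^ Suc (Suc m)) = (\<Sum>m. (1/4) * (of_bool (b (Suc m)) / (4::real) ^ Suc m))"
    by (simp add: field_simps)
  also have "\<dots> = (1/4) * digit_sum (\<lambda>m. b (Suc m))"
    unfolding digit_sum_def by (rule suminf_mult[OF digit_sum_summable])
  finally show ?thesis by simp
qed

lemma digit_sum_nonneg: "0 \<le> digit_sum b"
  unfolding digit_sum_def by (intro suminf_nonneg digit_sum_summable) simp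

lemma digit_sum_le: "digit_sum b \<le> 1/3"
proof -
  have "digit_sum b \<le> (\<Sum>m. (1/4) * (1/4::real) ^ m)"
    unfolding digit_sum_def
    by (intro suminf_le digit_sum_summable summable_mult summable_geometric) (simp_all add: power_one_over of_bool_def)
  also have "\<dots> = 1/3"
    by (subst suminf_mult) (simp_all add: suminf_geometric)
  finally show ?thesis .
qed

lemma digit_sum_pos: "b m \<Longrightarrow> 0 < digit_sum b"
  unfolding digit_sum_def by (rule suminf_pos2[OF digit_sum_summable, of _ m]) simp_all

definition digit :: "real \<Rightarrow> nat \<Rightarrow> bool" where
  "digit c m \<longleftrightarrow> \<lfloor>4 * ((\<lambda>x. frac (4 * x)) ^^ m) c\<rfloor> = 1"

lemma digit_digit_sum: "digit (digit_sum b) = b"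
proof
  fix m
  have fl: "\<lfloor>4 * digit_sum a\<rfloor> = of_bool (a 0)" and fr: "frac (4 * digit_sum a) = digit_sum (\<lambda>m. a (Suc m))" for a
  proof -
    have "0 \<le> digit_sum (\<lambda>m. a (Suc m))" "digit_sum (\<lambda>m. a (Suc m)) < 1"
      using digit_sum_nonneg digit_sum_le[of "\<lambda>m. a (Suc m)"] by auto
    then show "\<lfloor>4 * digit_sum a\<rfloor> = of_bool (a 0)" unfolding digit_sum_Suc
      by (intro floor_unique) (auto simp: of_bool_def)
    then show "frac (4 * digit_sum a) = digit_sum (\<lambda>m. a (Suc m))"
      unfolding frac_def digit_sum_Suc by simp
  qed
  have "((\<lambda>x. frac (4 * x)) ^^ m) (digit_sum b) = digit_sum (\<lambda>i. b (m + i))"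
    by (induction m) (simp_all add: fr)
  then show "digit (digit_sum b) m = b m"
    by (simp add: digit_def fl of_bool_def)
qed

lemma measurable_digit: "Measurable.pred borel (\<lambda>c. digit c m)"
proof -
  have [measurable]: "(\<lambda>x. ((\<lambda>x. frac (4 * x)) ^^ m) x) \<in> borel_measurable (borel :: real measure)"
    by (induction m) (simp_all add: frac_def)
  show ?thesis unfolding digit_def by measurable
qed

lemma measurable_digit_sum:
  "(\<And>m. Measurable.pred N (\<lambda>s. b s m)) \<Longrightarrow> (\<lambda>s. digit_sum (b s)) \<in> borel_measurable N"
  unfolding digit_sum_def of_bool_def
  by (intro borel_measurable_suminf borel_measurable_divide borel_measurable_const measurable_If) (simp_all add: pred_def)

lemma range_digit_sum: "range digit_sum = {c. digit_sum (digit c) = c}"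
  by (auto simp: digit_digit_sum) (metis rangeI)

lemma range_digit_sum_borel: "range digit_sum \<in> sets borel"
proof -
  have "(\<lambda>c. digit_sum (digit c)) \<in> borel_measurable borel"
    using measurable_digit by (rule measurable_digit_sum)
  then have "{c \<in> space borel. digit_sum (digit c) = c} \<in> sets borel"
    by (intro borel_measurable_eq) auto
  then show ?thesis by (simp add: range_digit_sum)
qed

text \<open>Multiplied by \<open>4\<close>, the set is contained in two translates of itself. Its measure \<open>\<lambda>\<close> is therefore
finite with \<open>4 * \<lambda> \<le> 2 * \<lambda>\<close>.\<close>

lemma range_digit_sum_null: "emeasure lborel (range digit_sum) = 0"
proof -
  let ?C = "range digit_sum"
  note range_digit_sum_borel [measurable]
  have fin: "emeasure lborel ?C < \<infinity>"
  proof -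
    have "emeasure lborel ?C \<le> emeasure lborel {0..1::real}"
    proof (intro emeasure_mono image_subsetI)
      show "digit_sum b \<in> {0..1}" for b
        using digit_sum_nonneg[of b] digit_sum_le[of b] by simp
    qed simp
    also have "\<dots> < \<infinity>" by simp
    finally show ?thesis .
  qed
  have tr: "(\<integral>\<^sup>+x. indicator ?C (x - 1) \<partial>lborel) = emeasure lborel ?C"
    using nn_integral_real_affine[of "indicator ?C" 1 "-1"] by simp
  have "emeasure lborel ?C = (\<integral>\<^sup>+x. indicator ?C x \<partial>lborel)" by simp
  also have "\<dots> = ennreal (1/4) * (\<integral>\<^sup>+x. indicator ?C (x / 4) \<partial>lborel)"
    using nn_integral_real_affine[of "indicator ?C" "1/4" 0] by simp
  also have "\<dots> \<le> ennreal (1/4) * (\<integral>\<^sup>+x. indicator ?C x + indicator ?C (x - 1) \<partial>lborel)"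
  proof (intro mult_left_mono nn_integral_mono)
    fix x :: real
    show "indicator ?C (x / 4) \<le> (indicator ?C x + indicator ?C (x - 1) :: ennreal)"
    proof (cases "x / 4 \<in> ?C")
      case True
      then obtain b where "x / 4 = digit_sum b" by auto
      then have "x = of_bool (b 0) + digit_sum (\<lambda>m. b (Suc m))" using digit_sum_Suc[of b] by simp
      then have "x \<in> ?C \<or> x - 1 \<in> ?C" by (cases "b 0") auto
      then show ?thesis by (auto simp: indicator_def)
    qed simp
  qed simp
  also have "\<dots> = ennreal (1/4) * (emeasure lborel ?C + emeasure lborel ?C)"
    by (subst nn_integral_add) (simp_all add: tr)
  finally have le: "emeasure lborel ?C \<le> ennreal (1/4) * (emeasure lborel ?C + emeasure lborel ?C)" .
  obtain r where r: "emeasure lborel ?C = ennreal r" "0 \<le> r"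
    using fin by (cases "emeasure lborel ?C") auto
  have "ennreal r \<le> ennreal (1/4 * (r + r))"
    using le r by (simp add: ennreal_mult'[symmetric] ennreal_plus[symmetric] del: ennreal_plus)
  then have "r \<le> 1/4 * (r + r)" using r by (subst (asm) ennreal_le_iff) auto
  then show ?thesis using r by simp
qed

text \<open>The digits record all comparisons of values at rational times with rational numbers.\<close>

definition path_code :: "(nat \<times> real \<Rightarrow> real) \<Rightarrow> real" where
  "path_code y = digit_sum (\<lambda>m. case from_nat m :: nat \<times> rat \<times> rat of (n, q, p) \<Rightarrow> y (n, of_rat q) < of_rat p)"

text \<open>The infimum of these functions over \<open>m\<close> is the greatest Lipschitz function below the recorded upper
bounds. The bounds \<open>max p (- |q|)\<close> and \<open>|x|\<close> are valid for every path starting at \<open>0\<close>, and they keep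
the infimum finite for arbitrary \<open>c\<close>, including those that code no path.\<close>

definition path_envelope :: "real \<Rightarrow> nat \<Rightarrow> real \<Rightarrow> nat \<Rightarrow> real" where
  "path_envelope c n x m = (case from_nat m :: nat \<times> rat \<times> rat of (k, q, p) \<Rightarrow>
     if k = n \<and> digit c m then max (of_rat p) (- \<bar>of_rat q\<bar>) + \<bar>x - of_rat q\<bar> else \<bar>x\<bar>)"

definition path_decode :: "real \<Rightarrow> nat \<times> real \<Rightarrow> real" where
  "path_decode c = (\<lambda>(n, x). (INF m. path_envelope c n x m) - (INF m. path_envelope c n 0 m))"

lemma path_envelope_bounds:
  "- \<bar>x\<bar> \<le> path_envelope c n x m" "path_envelope c n x m \<le> path_envelope c n x' m + \<bar>x - x'\<bar>"
proof -
  have "- \<bar>x\<bar> \<le> (if A then max p (- \<bar>q\<bar>) + \<bar>x - q\<bar> else \<bar>x\<bar>) \<and>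
      (if A then max p (- \<bar>q\<bar>) + \<bar>x - q\<bar> else \<bar>x\<bar>) \<le> (if A then max p (- \<bar>q\<bar>) + \<bar>x' - q\<bar> else \<bar>x'\<bar>) + \<bar>x - x'\<bar>"
    for A and p q :: real
    by auto
  then show "- \<bar>x\<bar> \<le> path_envelope c n x m" "path_envelope c n x m \<le> path_envelope c n x' m + \<bar>x - x'\<bar>"
    unfolding path_envelope_def by (cases "from_nat m :: nat \<times> rat \<times> rat"; simp only: prod.case)+
qed

lemma path_envelope_bdd: "bdd_below (range (path_envelope c n x))"
  using path_envelope_bounds(1) by (intro bdd_belowI2)

lemma path_decode_in: "path_decode c \<in> path_set"
proof -
  have le: "(INF m. path_envelope c n x m) \<le> (INF m. path_envelope c n x' m) + \<bar>x - x'\<bar>" for n x x'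
  proof -
    have "(INF m. path_envelope c n x m) - \<bar>x - x'\<bar> \<le> (INF m. path_envelope c n x' m)"
    proof (rule cINF_greatest)
      fix m
      have "(INF m. path_envelope c n x m) \<le> path_envelope c n x m"
        by (rule cINF_lower[OF path_envelope_bdd]) simp
      then show "(INF m. path_envelope c n x m) - \<bar>x - x'\<bar> \<le> path_envelope c n x' m"
        using path_envelope_bounds(2)[of c n x m x'] by linarith
    qed simp
    then show ?thesis by simp
  qed
  have "\<bar>(INF m. path_envelope c n x m) - (INF m. path_envelope c n x' m)\<bar> \<le> \<bar>x - x'\<bar>" for n x x'
    using le[of n x x'] le[of n x' x] by (simp add: abs_le_iff abs_minus_commute)
  then show ?thesis by (auto simp: path_set_def path_decode_def)
qed

lemma path_code_digit:
  "digit (path_code y) m \<longleftrightarrow> (case from_nat m :: nat \<times> rat \<times> rat of (n, q, p) \<Rightarrow> y (n, of_rat q) < of_rat p)"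
  by (simp add: path_code_def digit_digit_sum)

lemma path_decode_code:
  assumes y: "y \<in> path_set"
  shows "path_decode (path_code y) = y"
proof -
  have lip: "\<bar>y (n, x) - y (n, x')\<bar> \<le> \<bar>x - x'\<bar>" and y0: "y (n, 0) = 0" for n x x'
    using y by (auto simp: path_set_def)
  have "(INF m. path_envelope (path_code y) n x m) = y (n, x)" for n x
  proof (rule antisym)
    show "y (n, x) \<le> (INF m. path_envelope (path_code y) n x m)"
    proof (rule cINF_greatest)
      fix m
      obtain k q p where m: "(from_nat m :: nat \<times> rat \<times> rat) = (k, q, p)" by (cases "from_nat m :: nat \<times> rat \<times> rat")
      show "y (n, x) \<le> path_envelope (path_code y) n x m"
        using lip[of n x 0] lip[of n x "of_rat q"] y0[of n]
        by (auto simp: path_envelope_def m path_code_digit)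
    qed simp
    show "(INF m. path_envelope (path_code y) n x m) \<le> y (n, x)"
    proof (rule field_le_epsilon)
      fix e :: real assume e: "0 < e"
      obtain q where q: "x < of_rat q" "of_rat q < x + e / 3" using of_rat_dense[of x "x + e / 3"] e by auto
      obtain p where p: "y (n, of_rat q) < of_rat p" "of_rat p < y (n, of_rat q) + e / 3"
        using of_rat_dense[of "y (n, of_rat q)" "y (n, of_rat q) + e / 3"] e by auto
      define m where "m = to_nat (n, q, p)"
      have m: "(from_nat m :: nat \<times> rat \<times> rat) = (n, q, p)" by (simp add: m_def)
      have "(INF m. path_envelope (path_code y) n x m) \<le> path_envelope (path_code y) n x m"
        by (rule cINF_lower[OF path_envelope_bdd]) simp
      also have "\<dots> = max (of_rat p) (- \<bar>of_rat q\<bar>) + \<bar>x - of_rat q\<bar>"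
        using p by (simp add: path_envelope_def m path_code_digit)
      also have "\<dots> \<le> y (n, x) + e"
        using lip[of n x "of_rat q"] lip[of n "of_rat q" 0] y0[of n] p q by (auto simp: max_def)
      finally show "(INF m. path_envelope (path_code y) n x m) \<le> y (n, x) + e" .
    qed
  qed
  then show ?thesis by (auto simp: path_decode_def y0)
qed

lemma path_code_bounds: "path_code y \<in> {0<..<1}"
proof -
  obtain p where p: "y (0, of_rat 0) < of_rat p"
    using of_rat_dense[of "y (0, of_rat 0)" "y (0, of_rat 0) + 1"] by auto
  have "0 < path_code y"
    unfolding path_code_def by (rule digit_sum_pos[of _ "to_nat (0::nat, 0::rat, p)"]) (use p in simp)
  moreover have "path_code y \<le> 1/3" unfolding path_code_def by (rule digit_sum_le)
  ultimately show ?thesis by simp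
qed

lemma measurable_path_code: "path_code \<in> borel_measurable path_space"
  unfolding path_code_def
proof (rule measurable_digit_sum)
  fix m
  obtain k q p where m: "(from_nat m :: nat \<times> rat \<times> rat) = (k, q, p)" by (cases "from_nat m :: nat \<times> rat \<times> rat")
  note measurable_path_eval [measurable]
  show "Measurable.pred path_space (\<lambda>y. case from_nat m :: nat \<times> rat \<times> rat of (n, q, p) \<Rightarrow> y (n, of_rat q) < of_rat p)"
    unfolding m prod.case by measurable
qed

lemma measurable_path_decode: "path_decode \<in> measurable borel path_space"
proof (rule measurable_into_path_space)
  have env: "(\<lambda>c. path_envelope c n x m) \<in> borel_measurable borel" for n x m
  proof -
    obtain k q p where m: "(from_nat m :: nat \<times> rat \<times> rat) = (k, q, p)" by (cases "from_nat m :: nat \<times> rat \<times> rat")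
    note measurable_digit [measurable]
    show ?thesis unfolding path_envelope_def m prod.case by measurable
  qed
  have inf: "(\<lambda>c. INF m. path_envelope c n x m) \<in> borel_measurable borel" for n x
    using env path_envelope_bdd by (intro borel_measurable_cINF) auto
  show "(\<lambda>c. path_decode c (n, x)) \<in> borel_measurable borel" for n x
    unfolding path_decode_def prod.case by (intro borel_measurable_diff inf)
qed (rule path_decode_in)

section \<open>From near actions to flows\<close>

text \<open>The flow equations hold for each pair of times outside a null set depending on that pair.\<close>

locale near_action = time_group T + sigma_finite_measure M
  for T :: "real set" and M :: "'s measure" +
  fixes \<phi> :: "real \<Rightarrow> 's \<Rightarrow> 's"
  assumes joint: "(\<lambda>(t, s). \<phi> t s) \<in> measurable (restrict_space borel T \<Otimes>\<^sub>M M) M"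
    and AE_compose: "\<And>t P. t \<in> T \<Longrightarrow> AE s in M. P s \<Longrightarrow> AE s in M. P (\<phi> t s)"
    and AE_zero: "AE s in M. \<phi> 0 s = s"
    and AE_add: "\<And>t h. t \<in> T \<Longrightarrow> h \<in> T \<Longrightarrow> AE s in M. \<phi> t (\<phi> h s) = \<phi> (h + t) s"
begin

lemma measurable_phi: "t \<in> T \<Longrightarrow> \<phi> t \<in> measurable M M"
  using measurable_compose[OF measurable_Pair1'[of t "restrict_space borel T" M] joint]
  by (simp add: space_restrict_space)

lemma strict_flow_of_no_null_sets:
  assumes everywhere: "\<And>P s. (AE s in M. P s) \<Longrightarrow> s \<in> space M \<Longrightarrow> P s"
  shows "\<exists>\<psi>. measurable_flow M T \<psi> \<and> (\<forall>t\<in>T. AE s in M. \<psi> t s = \<phi> t s)"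
proof (intro exI conjI ballI)
  show "measurable_flow M T \<phi>"
    unfolding measurable_flow_def is_flow_def
    using joint everywhere[OF AE_zero] everywhere[OF AE_add] measurable_space[OF measurable_phi] by auto
qed simp

text \<open>The union of the exceptional null sets over all pairs of times is still null. The points whose
orbits avoid it form an invariant set; the other points are made fixed points.\<close>

lemma strict_flow_of_countable:
  assumes T: "countable T"
  shows "\<exists>\<psi>. measurable_flow M T \<psi> \<and> (\<forall>t\<in>T. AE s in M. \<psi> t s = \<phi> t s)"
proof -
  have "AE s in M. \<phi> 0 s = s \<and> (\<forall>t\<in>T. \<forall>h\<in>T. \<phi> t (\<phi> h s) = \<phi> (h + t) s)"
    using AE_zero AE_add T by (auto simp: AE_ball_countable)
  then obtain N where N: "N \<in> null_sets M"
    and good: "\<And>s. s \<in> space M - N \<Longrightarrow> \<phi> 0 s = s \<and> (\<forall>t\<in>T. \<forall>h\<in>T. \<phi> t (\<phi> h s) = \<phi> (h + t) s)"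
    by (rule AE_E3) blast
  define S where "S = {s \<in> space M. \<forall>t\<in>T. \<phi> t s \<in> space M - N}"
  have "AE s in M. s \<in> space M - N" using AE_not_in[OF N] AE_space by eventually_elim simp
  then have "AE s in M. \<forall>t\<in>T. \<phi> t s \<in> space M - N"
    by (subst AE_ball_countable[OF T]) (intro ballI AE_compose)
  then have AE_S: "AE s in M. s \<in> space M - N \<and> s \<in> S"
    using \<open>AE s in M. s \<in> space M - N\<close> by eventually_elim (auto simp: S_def)
  define \<psi> where "\<psi> t s = (if s \<in> S - N then \<phi> t s else s)" for t s
  have S: "S \<in> sets M"
  proof -
    have "S = (\<Inter>t\<in>T. \<phi> t -` (space M - N) \<inter> space M)"
      using zero_T by (auto simp: S_def)
    also have "\<dots> \<in> sets M"
      using zero_T T N measurable_phi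
      by (intro sets.countable_INT' measurable_sets[where A = M]) (auto intro!: measurable_sets[where A = M])
    finally show ?thesis .
  qed
  have inS: "\<phi> t s \<in> S - N" if "t \<in> T" "s \<in> S - N" for t s
    using that good[of s] add_T by (auto simp: S_def)
  have "measurable_flow M T \<psi>"
    unfolding measurable_flow_def is_flow_def
  proof (intro conjI ballI)
    have pt: "\<psi> t \<in> measurable M M" if "t \<in> T" for t
      unfolding \<psi>_def using S N measurable_phi[OF that] by (intro measurable_If_set) auto
    then show "\<psi> t \<in> space M \<rightarrow> space M" if "t \<in> T" for t
      using measurable_space[OF pt[OF that]] by auto
    show "\<psi> (t1 + t2) s = \<psi> t2 (\<psi> t1 s)" if "t1 \<in> T" "t2 \<in> T" "s \<in> space M" for t1 t2 s
      using inS[OF that(1), of s] good[of s] that by (auto simp: \<psi>_def S_def)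
    show "\<psi> 0 s = s" if "s \<in> space M" for s
      using good[of s] that by (auto simp: \<psi>_def)
    have "(\<lambda>p. \<psi> (fst p) (snd p)) \<in> measurable (count_space T \<Otimes>\<^sub>M M) M"
      using pt by (intro measurable_pair_measure_countable1[OF T]) simp
    moreover have "sets (restrict_space borel T) = sets (count_space T)"
      unfolding sets_count_space
      by (rule sets_eq_countable[OF T]) (auto simp: space_restrict_space sets_restrict_space intro!: image_eqI[of _ _ "{_}"])
    then have "sets (restrict_space borel T \<Otimes>\<^sub>M M) = sets (count_space T \<Otimes>\<^sub>M M)"
      by (intro sets_pair_measure_cong) simp_all
    ultimately show "(\<lambda>(t, s). \<psi> t s) \<in> measurable (restrict_space borel T \<Otimes>\<^sub>M M) M"
      by (simp add: split_beta' cong: measurable_cong_sets)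
  qed
  moreover have "AE s in M. \<psi> t s = \<phi> t s" for t
    using AE_S by eventually_elim (auto simp: \<psi>_def)
  ultimately show ?thesis by blast
qed

end

text \<open>The unit interval provides room for a null Borel set of the cardinality of the continuum.\<close>

locale real_near_action = near_action UNIV M \<phi> for M :: "real measure" and \<phi> +
  assumes sets_M: "sets M = sets (restrict_space borel (space M))" and space_M: "space M \<in> sets borel"
    and unit: "{0<..<1} \<subseteq> space M"
    and null_unit: "\<And>A. A \<in> sets borel \<Longrightarrow> A \<subseteq> {0<..<1} \<Longrightarrow> emeasure lborel A = 0 \<Longrightarrow> emeasure M A = 0"
begin

lemma measurable_phi_joint:
  assumes "t \<in> borel_measurable N" "F \<in> measurable N M"
  shows "(\<lambda>x. \<phi> (t x) (F x)) \<in> measurable N M"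
proof -
  have "sets (restrict_space borel UNIV \<Otimes>\<^sub>M M) = sets ((borel :: real measure) \<Otimes>\<^sub>M M)"
    by (intro sets_pair_measure_cong) (simp_all add: sets_restrict_space)
  then have "(\<lambda>(t, s). \<phi> t s) \<in> measurable (borel \<Otimes>\<^sub>M M) M"
    using joint by (simp cong: measurable_cong_sets)
  from measurable_compose[OF measurable_Pair[OF assms] this] show ?thesis by simp
qed

lemma measurable_M_borel: "F \<in> measurable N M \<Longrightarrow> F \<in> borel_measurable N"
  using measurable_restrict_space2_iff[of F N borel "space M"] by (simp cong: measurable_cong_sets add: sets_M)

lemma measurable_into_M:
  "F \<in> borel_measurable N \<Longrightarrow> (\<And>x. x \<in> space N \<Longrightarrow> F x \<in> space M) \<Longrightarrow> F \<in> measurable N M"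
  using measurable_restrict_space2[of F N "space M" borel] by (auto cong: measurable_cong_sets simp: sets_M)

lemma sets_M_eq_points:
  assumes "F \<in> measurable N M" "H \<in> measurable N M"
  shows "{x \<in> space N. F x = H x} \<in> sets N"
  using assms by (intro borel_measurable_eq measurable_M_borel)

lemma sigma_finite_pair: "pair_sigma_finite lborel M"
  by unfold_locales

lemma AE_swap:
  assumes "{p \<in> space (lborel \<Otimes>\<^sub>M M). P (fst p) (snd p)} \<in> sets (lborel \<Otimes>\<^sub>M M)"
    and "\<And>t. AE s in M. P t s"
  shows "AE s in M. AE t in lborel. P t s"
  using pair_sigma_finite.AE_commute[OF sigma_finite_pair assms(1)] assms(2) by simp

definition ray :: "nat \<Rightarrow> real set" where
  "ray n = {s \<in> space M. s < of_rat (from_nat n)}"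

lemma ray_subset: "ray n \<subseteq> space M"
  by (auto simp: ray_def)

lemma ray_sets: "ray n \<in> sets M"
  using space_M by (auto simp: ray_def sets_M sets_restrict_space_iff)

text \<open>The integral of \<open>signed_ind x\<close> times a function is its oriented integral from \<open>0\<close> to \<open>x\<close>.\<close>

definition signed_ind :: "real \<Rightarrow> real \<Rightarrow> real" where
  "signed_ind x t = indicator {0<..x} t - indicator {x<..0} t"

definition path :: "real \<Rightarrow> nat \<times> real \<Rightarrow> real" where
  "path s = (\<lambda>(n, x). LINT t|lborel. signed_ind x t * indicator (ray n) (\<phi> t s))"

lemma measurable_orbit: "s \<in> space M \<Longrightarrow> (\<lambda>t. \<phi> t s) \<in> measurable borel M"
  by (intro measurable_phi_joint) auto

lemma measurable_orbit_ind:
  "s \<in> space M \<Longrightarrow> (\<lambda>t. indicator (ray n) (\<phi> t s) :: real) \<in> borel_measurable borel"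
  using measurable_orbit ray_sets by (intro measurable_compose[OF measurable_orbit borel_measurable_indicator])

lemma integrable_path:
  assumes "s \<in> space M"
  shows "integrable lborel (\<lambda>t. signed_ind x t * indicator (ray n) (\<phi> t s))"
proof (rule Bochner_Integration.integrable_bound)
  show "integrable lborel (\<lambda>t. indicator {-\<bar>x\<bar>..\<bar>x\<bar>} t :: real)"
    by simp
  show "(\<lambda>t. signed_ind x t * indicator (ray n) (\<phi> t s)) \<in> borel_measurable lborel"
    using measurable_orbit_ind[OF assms] unfolding signed_ind_def by simp
  show "AE t in lborel. norm (signed_ind x t * indicator (ray n) (\<phi> t s)) \<le> norm (indicator {-\<bar>x\<bar>..\<bar>x\<bar>} t :: real)"
    by (intro AE_I2) (auto simp: signed_ind_def indicator_def)
qed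

lemma path_in:
  assumes s: "s \<in> space M"
  shows "path s \<in> path_set"
proof -
  have diff: "0 \<le> path s (n, x') - path s (n, x) \<and> path s (n, x') - path s (n, x) \<le> x' - x" if "x \<le> x'" for n x x'
  proof -
    have sd: "signed_ind x' t - signed_ind x t = indicator {x<..x'} t" for t
      using that by (auto simp: signed_ind_def indicator_def)
    have "path s (n, x') - path s (n, x) =
        (LINT t|lborel. signed_ind x' t * indicator (ray n) (\<phi> t s) - signed_ind x t * indicator (ray n) (\<phi> t s))"
      unfolding path_def prod.case by (rule Bochner_Integration.integral_diff[symmetric, OF integrable_path integrable_path]) fact+
    also have "\<dots> = (LINT t|lborel. indicator {x<..x'} t * indicator (ray n) (\<phi> t s))"
      by (simp add: left_diff_distrib[symmetric] sd)
    finally have eq: "path s (n, x') - path s (n, x) = (LINT t|lborel. indicator {x<..x'} t * indicator (ray n) (\<phi> t s))" .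
    have "(LINT t|lborel. indicator {x<..x'} t * indicator (ray n) (\<phi> t s)) \<le> (LINT t|lborel. (indicator {x<..x'} t :: real))"
    proof (rule Bochner_Integration.integral_mono)
      have "integrable lborel (\<lambda>t. signed_ind x' t * indicator (ray n) (\<phi> t s) - signed_ind x t * indicator (ray n) (\<phi> t s))"
        by (intro Bochner_Integration.integrable_diff integrable_path s)
      then show "integrable lborel (\<lambda>t. indicator {x<..x'} t * indicator (ray n) (\<phi> t s) :: real)"
        by (simp add: left_diff_distrib[symmetric] sd)
      show "integrable lborel (indicator {x<..x'} :: real \<Rightarrow> real)" using that by simp
    qed (auto simp: indicator_def)
    also have "\<dots> = x' - x" using that by simp
    finally show ?thesis unfolding eq by (auto intro!: integral_nonneg_AE)
  qed
  have "\<bar>path s (n, x) - path s (n, x')\<bar> \<le> \<bar>x - x'\<bar>" for n x x'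
    using diff[of x x' n] diff[of x' x n] by (cases "x \<le> x'") auto
  moreover have "path s (n, 0) = 0" for n
    by (simp add: path_def signed_ind_def)
  ultimately show ?thesis by (auto simp: path_set_def)
qed

lemma measurable_path: "path \<in> measurable M path_space"
proof (rule measurable_into_path_space[OF path_in])
  fix n x
  have "(\<lambda>p. \<phi> (snd p) (fst p)) \<in> measurable (M \<Otimes>\<^sub>M lborel) M"
    by (intro measurable_phi_joint) simp_all
  from measurable_compose[OF this borel_measurable_indicator[OF ray_sets]]
  have "(\<lambda>p. indicator (ray n) (\<phi> (snd p) (fst p)) :: real) \<in> borel_measurable (M \<Otimes>\<^sub>M lborel)" .
  then have "(\<lambda>(s, t). signed_ind x t * indicator (ray n) (\<phi> t s)) \<in> borel_measurable (M \<Otimes>\<^sub>M lborel)"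
    unfolding signed_ind_def split_beta' by (intro borel_measurable_times) simp_all
  then show "(\<lambda>s. path s (n, x)) \<in> borel_measurable M"
    unfolding path_def prod.case by (rule lborel.borel_measurable_lebesgue_integral)
qed

text \<open>For almost every \<open>s\<close> the flow equation holds at almost all times, by Fubini's theorem, and integrals
do not notice the exceptional times.\<close>

lemma path_phi: "AE s in M. path (\<phi> u s) = path_shift u (path s)"
proof -
  have "AE s in M. AE t in lborel. \<phi> t (\<phi> u s) = \<phi> (u + t) s"
  proof (rule AE_swap)
    show "{p \<in> space (lborel \<Otimes>\<^sub>M M). \<phi> (fst p) (\<phi> u (snd p)) = \<phi> (u + fst p) (snd p)} \<in> sets (lborel \<Otimes>\<^sub>M M)"
      by (intro sets_M_eq_points measurable_phi_joint measurable_compose[OF measurable_snd measurable_phi]) simp_all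
    show "AE s in M. \<phi> t (\<phi> u s) = \<phi> (u + t) s" for t by (rule AE_add) simp_all
  qed
  then show ?thesis using AE_space
  proof eventually_elim
    case (elim s)
    have s': "\<phi> u s \<in> space M" using elim measurable_space[OF measurable_phi] by simp
    show ?case
    proof
      fix k :: "nat \<times> real"
      obtain n x where k: "k = (n, x)" by (cases k)
      have "path (\<phi> u s) (n, x) = (LINT t|lborel. signed_ind x t * indicator (ray n) (\<phi> (u + t) s))"
        unfolding path_def prod.case
      proof (rule integral_cong_AE)
        show "(\<lambda>t. signed_ind x t * indicator (ray n) (\<phi> t (\<phi> u s))) \<in> borel_measurable lborel"
          using borel_measurable_integrable[OF integrable_path[OF s']] .
        have "(\<lambda>t. indicator (ray n) (\<phi> (u + t) s) :: real) \<in> borel_measurable borel"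
          using elim(2) by (intro measurable_compose[OF measurable_phi_joint borel_measurable_indicator] ray_sets) auto
        then show "(\<lambda>t. signed_ind x t * indicator (ray n) (\<phi> (u + t) s)) \<in> borel_measurable lborel"
          unfolding signed_ind_def by simp
        show "AE t in lborel. signed_ind x t * indicator (ray n) (\<phi> t (\<phi> u s)) = signed_ind x t * indicator (ray n) (\<phi> (u + t) s)"
          using elim(1) by eventually_elim simp
      qed
      also have "\<dots> = (LINT t|lborel. signed_ind x (t - u) * indicator (ray n) (\<phi> t s))"
        using lborel_integral_real_affine[of 1 "\<lambda>t. signed_ind x (t - u) * indicator (ray n) (\<phi> t s)" u] by simp
      also have "\<dots> = (LINT t|lborel. signed_ind (x + u) t * indicator (ray n) (\<phi> t s) - signed_ind u t * indicator (ray n) (\<phi> t s))"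
      proof -
        have "signed_ind x (t - u) = signed_ind (x + u) t - signed_ind u t" for t
          by (auto simp: signed_ind_def indicator_def)
        then show ?thesis by (simp add: left_diff_distrib)
      qed
      also have "\<dots> = path s (n, x + u) - path s (n, u)"
        unfolding path_def prod.case by (intro Bochner_Integration.integral_diff integrable_path elim)
      finally show "path (\<phi> u s) k = path_shift u (path s) k"
        by (simp add: k path_shift_def)
    qed
  qed
qed

text \<open>Generators of the product \<open>\<sigma>\<close>-algebra for which the time an orbit spends in them is, up to the time
\<open>1\<close>, a value of its path.\<close>

definition strips :: "(real \<times> real) set set" where
  "strips = {{..a} \<times> ray n | a n. True}"

lemma sets_strips: "sets (borel \<Otimes>\<^sub>M M) = sigma_sets (UNIV \<times> space M) strips"
proof
  have sub: "strips \<subseteq> Pow (UNIV \<times> space M)"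
    unfolding strips_def using ray_subset by blast
  have "strips \<subseteq> sets (borel \<Otimes>\<^sub>M M)" using ray_sets by (auto simp: strips_def)
  then show "sigma_sets (UNIV \<times> space M) strips \<subseteq> sets (borel \<Otimes>\<^sub>M M)"
    using sets.sigma_sets_subset[of strips "borel \<Otimes>\<^sub>M M"] by (simp add: space_pair_measure)
  let ?S = "sigma (UNIV \<times> space M) strips"
  have sp: "space ?S = UNIV \<times> space M" using sub by (simp add: space_measure_of)
  have st: "{..a} \<times> ray n \<in> sets ?S" for a n using sub by (auto simp: strips_def)
  have "fst \<in> borel_measurable ?S"
  proof (rule borel_measurableI_le)
    fix a :: real
    have "{p \<in> space ?S. fst p \<le> a} = (\<Union>n. {..a} \<times> ray n)"
    proof (intro set_eqI iffI)
      fix p assume p: "p \<in> {p \<in> space ?S. fst p \<le> a}"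
      obtain q where "snd p < of_rat q" using of_rat_dense[of "snd p" "snd p + 1"] by auto
      moreover have "snd p \<in> space M" using p by (simp add: sp mem_Times_iff)
      ultimately have "snd p \<in> ray (to_nat q)" by (simp add: ray_def)
      then show "p \<in> (\<Union>n. {..a} \<times> ray n)" using p by (auto simp: mem_Times_iff)
    qed (auto simp: sp ray_def)
    then show "{p \<in> space ?S. fst p \<le> a} \<in> sets ?S" using st by auto
  qed
  moreover have "snd \<in> measurable ?S M"
  proof (rule measurable_into_M)
    show "snd \<in> borel_measurable ?S"
    proof (rule borel_measurableI_less)
      fix x :: real
      have "{p \<in> space ?S. snd p < x} = (\<Union>n\<in>{n. of_rat (from_nat n) \<le> x}. \<Union>k::nat. {..real k} \<times> ray n)"
      proof (intro set_eqI iffI)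
        fix p assume p: "p \<in> {p \<in> space ?S. snd p < x}"
        then obtain q where q: "snd p < of_rat q" "of_rat q < x" using of_rat_dense[of "snd p" x] by auto
        obtain k :: nat where "fst p \<le> real k" using real_arch_simple by blast
        moreover have "snd p \<in> space M" using p by (simp add: sp mem_Times_iff)
        then have "snd p \<in> ray (to_nat q)" using q by (simp add: ray_def)
        ultimately have "p \<in> {..real k} \<times> ray (to_nat q)" by (simp add: mem_Times_iff)
        moreover have "to_nat q \<in> {n. of_rat (from_nat n) \<le> x}" using q by simp
        ultimately show "p \<in> (\<Union>n\<in>{n. of_rat (from_nat n) \<le> x}. \<Union>k::nat. {..real k} \<times> ray n)"
          by blast
      qed (auto simp: sp ray_def)
      then show "{p \<in> space ?S. snd p < x} \<in> sets ?S" using st by auto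
    qed
  qed (auto simp: sp)
  ultimately have "(\<lambda>p. (fst p, snd p)) \<in> measurable ?S (borel \<Otimes>\<^sub>M M)"
    by (rule measurable_Pair)
  then have id: "(\<lambda>p::real \<times> real. p) \<in> measurable ?S (borel \<Otimes>\<^sub>M M)" by simp
  show "sets (borel \<Otimes>\<^sub>M M) \<subseteq> sigma_sets (UNIV \<times> space M) strips"
  proof
    fix E :: "(real \<times> real) set" assume E: "E \<in> sets (borel \<Otimes>\<^sub>M M)"
    then have "E \<subseteq> UNIV \<times> space M" using sets.sets_into_space[OF E] by (simp add: space_pair_measure)
    then have "(\<lambda>p. p) -` E \<inter> space ?S = E" unfolding sp vimage_ident by (rule Int_absorb2)
    with measurable_sets[OF id E] show "E \<in> sigma_sets (UNIV \<times> space M) strips" using sub by simp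
  qed
qed

lemma Int_stable_strips: "Int_stable strips"
proof (rule Int_stableI)
  fix A B assume "A \<in> strips" "B \<in> strips"
  then obtain a n a' n' where AB: "A = {..a} \<times> ray n" "B = {..a'} \<times> ray n'" by (auto simp: strips_def)
  define k where "k = (if (of_rat (from_nat n) :: real) \<le> of_rat (from_nat n') then n else n')"
  have "A \<inter> B = {..min a a'} \<times> ray k"
    by (auto simp: AB ray_def k_def)
  then show "A \<inter> B \<in> strips" by (auto simp: strips_def)
qed


text \<open>The statement is clear for strips and passes to complements and disjoint unions.\<close>

lemma occupation_measurable:
  assumes "E \<in> sets (borel \<Otimes>\<^sub>M M)"
  shows "\<exists>W\<in>borel_measurable path_space. \<forall>s\<in>space M.
     emeasure lborel {t \<in> {0<..1}. (t, \<phi> t s) \<in> E} = W (path s)"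
proof -
  have orbit: "(\<lambda>t. (t, \<phi> t s)) \<in> measurable borel (borel \<Otimes>\<^sub>M M)" if "s \<in> space M" for s
    using that by (intro measurable_Pair measurable_orbit) auto
  have sets: "{t \<in> {0<..1}. (t, \<phi> t s) \<in> E} \<in> sets borel" if "s \<in> space M" "E \<in> sets (borel \<Otimes>\<^sub>M M)" for s E
  proof -
    have "{0<..1} \<inter> ((\<lambda>t. (t, \<phi> t s)) -` E \<inter> space borel) \<in> sets borel"
      using measurable_sets[OF orbit that(2)] that(1) by (intro sets.Int) auto
    moreover have "{0<..1} \<inter> ((\<lambda>t. (t, \<phi> t s)) -` E \<inter> space borel) = {t \<in> {0<..1}. (t, \<phi> t s) \<in> E}" by auto
    ultimately show ?thesis by simp
  qed
  have "strips \<subseteq> Pow (UNIV \<times> space M)" using ray_subset by (auto simp: strips_def)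
  from Int_stable_strips this assms[unfolded sets_strips] show ?thesis
  proof (induction rule: sigma_sets_induct_disjoint)
    case (basic A)
    then obtain a n where A: "A = {..a} \<times> ray n" by (auto simp: strips_def)
    \<comment> \<open>only the times in the unit interval up to a count\<close>
    define x where "x = max 0 (min 1 a)"
    show ?case
    proof (intro bexI ballI)
      show "(\<lambda>y. ennreal (y (n, x))) \<in> borel_measurable path_space"
        by (intro measurable_compose[OF measurable_path_eval measurable_ennreal])
      fix s assume s: "s \<in> space M"
      have A': "A \<in> sets (borel \<Otimes>\<^sub>M M)" using ray_sets by (simp add: A)
      have "emeasure lborel {t \<in> {0<..1}. (t, \<phi> t s) \<in> A} = (\<integral>\<^sup>+t. indicator {t \<in> {0<..1}. (t, \<phi> t s) \<in> A} t \<partial>lborel)"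
        using sets[OF s A'] by simp
      also have "\<dots> = (\<integral>\<^sup>+t. ennreal (signed_ind x t * indicator (ray n) (\<phi> t s)) \<partial>lborel)"
        by (intro nn_integral_cong) (auto simp: A signed_ind_def indicator_def x_def)
      also have "\<dots> = ennreal (path s (n, x))"
        unfolding path_def prod.case
        by (intro nn_integral_eq_integral integrable_path s AE_I2) (auto simp: signed_ind_def indicator_def x_def)
      finally show "emeasure lborel {t \<in> {0<..1}. (t, \<phi> t s) \<in> A} = ennreal (path s (n, x))" .
    qed
  next
    case empty
    show ?case by (intro bexI[of _ "\<lambda>_. 0"]) auto
  next
    case (compl A)
    then obtain W where W: "W \<in> borel_measurable path_space"
      "\<And>s. s \<in> space M \<Longrightarrow> emeasure lborel {t \<in> {0<..1}. (t, \<phi> t s) \<in> A} = W (path s)" by blast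
    have A: "A \<in> sets (borel \<Otimes>\<^sub>M M)" using compl by (simp add: sets_strips)
    show ?case
    proof (intro bexI ballI)
      show "(\<lambda>y. 1 - W y) \<in> borel_measurable path_space" using W(1) by measurable
      fix s assume s: "s \<in> space M"
      have "{t \<in> {0<..1}. (t, \<phi> t s) \<in> UNIV \<times> space M - A} = {0<..1} - {t \<in> {0<..1}. (t, \<phi> t s) \<in> A}"
        using measurable_space[OF measurable_orbit[OF s]] by auto
      also have "emeasure lborel \<dots> = emeasure lborel {0<..1::real} - emeasure lborel {t \<in> {0<..1}. (t, \<phi> t s) \<in> A}"
      proof (rule emeasure_Diff)
        have "emeasure lborel {t \<in> {0<..1}. (t, \<phi> t s) \<in> A} \<le> emeasure lborel {0<..1::real}"
          by (intro emeasure_mono) auto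
        then show "emeasure lborel {t \<in> {0<..1}. (t, \<phi> t s) \<in> A} \<noteq> \<infinity>" by (auto simp: top_unique)
      qed (use sets[OF s A] in auto)
      finally show "emeasure lborel {t \<in> {0<..1}. (t, \<phi> t s) \<in> UNIV \<times> space M - A} = 1 - W (path s)"
        using W(2)[OF s] by simp
    qed
  next
    case (union A)
    then have "\<forall>i. \<exists>W. W \<in> borel_measurable path_space \<and> (\<forall>s\<in>space M.
      emeasure lborel {t \<in> {0<..1}. (t, \<phi> t s) \<in> A i} = W (path s))" by blast
    from choice[OF this] obtain W where W: "\<And>i. W i \<in> borel_measurable path_space"
      "\<And>i s. s \<in> space M \<Longrightarrow> emeasure lborel {t \<in> {0<..1}. (t, \<phi> t s) \<in> A i} = W i (path s)" by blast
    have A: "A i \<in> sets (borel \<Otimes>\<^sub>M M)" for i using union by (auto simp: sets_strips)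
    show ?case
    proof (intro bexI ballI)
      show "(\<lambda>y. \<Sum>i. W i y) \<in> borel_measurable path_space" using W(1) by measurable
      fix s assume s: "s \<in> space M"
      have "{t \<in> {0<..1}. (t, \<phi> t s) \<in> (\<Union>i. A i)} = (\<Union>i. {t \<in> {0<..1}. (t, \<phi> t s) \<in> A i})" by auto
      also have "emeasure lborel \<dots> = (\<Sum>i. emeasure lborel {t \<in> {0<..1}. (t, \<phi> t s) \<in> A i})"
      proof (rule suminf_emeasure[symmetric])
        show "range (\<lambda>i. {t \<in> {0<..1}. (t, \<phi> t s) \<in> A i}) \<subseteq> sets lborel"
          using sets[OF s A] by auto
        show "disjoint_family (\<lambda>i. {t \<in> {0<..1}. (t, \<phi> t s) \<in> A i})"
          using union(1) by (auto simp: disjoint_family_on_def)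
      qed
      finally show "emeasure lborel {t \<in> {0<..1}. (t, \<phi> t s) \<in> (\<Union>i. A i)} = (\<Sum>i. W i (path s))"
        using W(2)[OF s] by simp
    qed
  qed
qed

text \<open>For a ray \<open>B\<close>, consider the set \<open>E\<close> of pairs \<open>(t, v)\<close> such that \<open>v\<close> is moved into \<open>B\<close> by
time \<open>- t\<close>. The orbit of almost every \<open>s\<close> is in \<open>E\<close> at almost all times if \<open>s \<in> B\<close>, and at almost no time
otherwise. As the time spent in \<open>E\<close> is a function of the path, so is the membership in \<open>B\<close>.\<close>

lemma path_left_inverse: "\<exists>G. G \<in> measurable path_space M \<and> (AE s in M. G (path s) = s)"
proof (rule measurable_left_inverse_AE[OF sets_M space_M _ measurable_path])
  show "1/2 \<in> space M" using unit by auto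
  fix q :: rat
  define B where "B = {v \<in> space M. v < of_rat q}"
  have B: "B \<in> sets M" using space_M by (auto simp: B_def sets_M sets_restrict_space_iff)
  \<comment> \<open>the pairs (t, v) such that v is moved into B by time - t\<close>
  define E where "E = {p \<in> space (borel \<Otimes>\<^sub>M M). \<phi> (- fst p) (snd p) \<in> B}"
  have "(\<lambda>p. \<phi> (- fst p) (snd p)) \<in> measurable (borel \<Otimes>\<^sub>M M) M"
    by (intro measurable_phi_joint) simp_all
  from measurable_sets[OF this B] have E: "E \<in> sets (borel \<Otimes>\<^sub>M M)"
    by (simp add: E_def vimage_def Int_def conj_commute)
  from occupation_measurable[OF this] obtain W where W: "W \<in> borel_measurable path_space"
    "\<And>s. s \<in> space M \<Longrightarrow> emeasure lborel {t \<in> {0<..1}. (t, \<phi> t s) \<in> E} = W (path s)" by blast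
  have "AE s in M. AE t in lborel. \<phi> (- t) (\<phi> t s) = s"
  proof (rule AE_swap)
    show "{p \<in> space (lborel \<Otimes>\<^sub>M M). \<phi> (- fst p) (\<phi> (fst p) (snd p)) = snd p} \<in> sets (lborel \<Otimes>\<^sub>M M)"
      by (intro sets_M_eq_points measurable_phi_joint) simp_all
    show "AE s in M. \<phi> (- t) (\<phi> t s) = s" for t
      using AE_add[of "- t" t, OF UNIV_I UNIV_I] AE_zero by eventually_elim simp
  qed
  then have "AE s in M. s < of_rat q \<longleftrightarrow> path s \<in> {y \<in> space path_space. W y \<noteq> 0}"
    using AE_space
  proof eventually_elim
    case (elim s)
    have orb: "\<phi> t s \<in> space M" for t using elim(2) measurable_space[OF measurable_phi] by simp
    have "W (path s) = emeasure lborel {t \<in> {0<..1}. (t, \<phi> t s) \<in> E}" using W(2) elim(2) by simp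
    also have "\<dots> = emeasure lborel {t \<in> {0<..1::real}. s < of_rat q}"
    proof (rule emeasure_eq_AE)
      show "AE t in lborel. t \<in> {t \<in> {0<..1}. (t, \<phi> t s) \<in> E} \<longleftrightarrow> t \<in> {t \<in> {0<..1::real}. s < of_rat q}"
        using elim(1) by eventually_elim (use orb elim(2) in \<open>auto simp: E_def B_def space_pair_measure\<close>)
      have "(\<lambda>t. (t, \<phi> t s)) \<in> measurable borel (borel \<Otimes>\<^sub>M M)"
        using elim(2) by (intro measurable_Pair measurable_orbit) auto
      from measurable_sets[OF this E] have "{0<..1} \<inter> ((\<lambda>t. (t, \<phi> t s)) -` E \<inter> space borel) \<in> sets lborel" by auto
      moreover have "{0<..1} \<inter> ((\<lambda>t. (t, \<phi> t s)) -` E \<inter> space borel) = {t \<in> {0<..1}. (t, \<phi> t s) \<in> E}" by auto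
      ultimately show "{t \<in> {0<..1}. (t, \<phi> t s) \<in> E} \<in> sets lborel" by simp
    qed (cases "s < of_rat q", auto)
    also have "{t \<in> {0<..1::real}. s < of_rat q} = (if s < of_rat q then {0<..1} else {})" by auto
    finally show ?case using path_in[OF elim(2)] by (cases "s < of_rat q") auto
  qed
  moreover have "{y \<in> space path_space. W y \<noteq> 0} \<in> sets path_space" using W(1) by measurable
  ultimately show "\<exists>E\<in>sets path_space. AE s in M. s < of_rat q \<longleftrightarrow> path s \<in> E" by blast
qed

text \<open>In the proof, \<open>C\<close> is the null set that receives codes, \<open>Y1\<close> the set of paths that come from points
outside \<open>C\<close>, and \<open>Y2\<close> the invariant set of paths whose shifts are in \<open>Y1\<close> at almost all times. The
map \<open>\<Psi>\<close> embeds \<open>Y2\<close> into the space with left inverse \<open>\<Lambda>\<close>; the flow is the shift transported to its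
image \<open>S\<close>, and trivial elsewhere.\<close>

lemma strict_flow: "\<exists>\<psi>. measurable_flow M UNIV \<psi> \<and> (\<forall>t\<in>UNIV. AE s in M. \<psi> t s = \<phi> t s)"
proof -
  obtain G where G: "G \<in> measurable path_space M" and AE_G: "AE s in M. G (path s) = s"
    using path_left_inverse by blast
  define C where "C = range digit_sum \<inter> {0<..<1}"
  have C: "C \<in> sets borel" unfolding C_def using range_digit_sum_borel by (rule sets.Int) simp
  have CM: "C \<in> sets M"
    using C unit space_M by (auto simp: C_def sets_M sets_restrict_space_iff)
  have AE_C: "AE s in M. s \<notin> C"
  proof (rule AE_not_in)
    have "emeasure lborel C \<le> emeasure lborel (range digit_sum)"
      using range_digit_sum_borel by (intro emeasure_mono) (auto simp: C_def)
    then have "emeasure lborel C = 0" by (simp add: range_digit_sum_null)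
    then have "emeasure M C = 0" using C by (intro null_unit) (auto simp: C_def)
    then show "C \<in> null_sets M" using CM by auto
  qed
  have code: "path_code y \<in> C" for y
    using path_code_bounds[of y] by (auto simp: C_def path_code_def)
  define Y1 where "Y1 = {y \<in> space path_space. path (G y) = y} \<inter> {y \<in> space path_space. G y \<notin> C}"
  have Y1: "Y1 \<in> sets path_space"
  proof -
    have 1: "{y \<in> space path_space. path (G y) = y} \<in> sets path_space"
      by (intro sets_path_eq measurable_compose[OF G measurable_path]) simp
    have "{y \<in> space path_space. G y \<notin> C} = space path_space - (G -` C \<inter> space path_space)" by auto
    also have "\<dots> \<in> sets path_space" by (intro sets.Diff sets.top measurable_sets[OF G CM])
    finally show ?thesis unfolding Y1_def by (rule sets.Int[OF 1])
  qed
  define Y2 where "Y2 = {y \<in> path_set. AE t in lborel. path_shift t y \<in> Y1}"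
  have Y2: "Y2 \<in> sets path_space"
  proof -
    have shift: "(\<lambda>(y, t). path_shift t y) \<in> measurable (path_space \<Otimes>\<^sub>M lborel) path_space"
      using measurable_path_shift[of snd "path_space \<Otimes>\<^sub>M lborel" fst] by (simp add: split_beta')
    have iY: "(indicator (space path_space - Y1) :: _ \<Rightarrow> ennreal) \<in> borel_measurable path_space"
      by (intro borel_measurable_indicator sets.Diff sets.top Y1)
    have ind: "(\<lambda>t. indicator (- Y1) (path_shift t y) :: ennreal) \<in> borel_measurable lborel" if "y \<in> path_set" for y
    proof -
      have "(\<lambda>t. path_shift t y) \<in> measurable lborel path_space"
        using that by (intro measurable_path_shift) simp_all
      from measurable_compose[OF this iY]
      have "(\<lambda>t. indicator (space path_space - Y1) (path_shift t y) :: ennreal) \<in> borel_measurable lborel" .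
      also have "(\<lambda>t. indicator (space path_space - Y1) (path_shift t y) :: ennreal) = (\<lambda>t. indicator (- Y1) (path_shift t y))"
        using that by (auto simp: indicator_def)
      finally show ?thesis .
    qed
    have "(\<lambda>p. indicator (space path_space - Y1) (path_shift (snd p) (fst p)) :: ennreal) \<in> borel_measurable (path_space \<Otimes>\<^sub>M lborel)"
      using measurable_compose[OF shift iY] by (simp add: split_beta')
    then have "(\<lambda>y. \<integral>\<^sup>+t. indicator (space path_space - Y1) (path_shift t y) \<partial>lborel) \<in> borel_measurable path_space"
      by (intro lborel.borel_measurable_nn_integral) (simp add: split_beta')
    then have "{y \<in> space path_space. (\<integral>\<^sup>+t. indicator (space path_space - Y1) (path_shift t y) \<partial>lborel) = 0} \<in> sets path_space"
      by measurable
    also have "{y \<in> space path_space. (\<integral>\<^sup>+t. indicator (space path_space - Y1) (path_shift t y) \<partial>lborel) = 0} = Y2"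
    proof -
      have "(\<integral>\<^sup>+t. indicator (space path_space - Y1) (path_shift t y) \<partial>lborel) = 0 \<longleftrightarrow> (AE t in lborel. path_shift t y \<in> Y1)"
        if y: "y \<in> path_set" for y
      proof -
        have "(\<integral>\<^sup>+t. indicator (space path_space - Y1) (path_shift t y) \<partial>lborel) = (\<integral>\<^sup>+t. indicator (- Y1) (path_shift t y) \<partial>lborel)"
          using y by (intro nn_integral_cong) (auto simp: indicator_def)
        also have "\<dots> = 0 \<longleftrightarrow> (AE t in lborel. indicator (- Y1) (path_shift t y) = (0 :: ennreal))"
          by (rule nn_integral_0_iff_AE[OF ind[OF y]])
        finally show ?thesis by (simp add: indicator_def)
      qed
      then show ?thesis by (auto simp: Y2_def)
    qed
    finally show ?thesis .
  qed
  have Y2_path: "y \<in> Y2 \<Longrightarrow> y \<in> path_set" for y by (simp add: Y2_def)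
  have Y2_shift: "path_shift u y \<in> Y2" if y: "y \<in> Y2" for u y
  proof -
    have "AE t in distr lborel borel ((+) u). path_shift t y \<in> Y1"
      using y unfolding lborel_distr_plus Y2_def by blast
    then have "AE t in lborel. path_shift (u + t) y \<in> Y1"
      by (rule AE_distrD[rotated]) simp
    then show ?thesis using Y2_path[OF y] by (simp add: Y2_def path_shift_add)
  qed
  have AE_good: "AE s in M. G (path s) = s \<and> s \<notin> C \<and> s \<in> space M"
    using AE_G AE_C AE_space by eventually_elim simp
  have good_Y1: "path s \<in> Y1" if "G (path s) = s \<and> s \<notin> C \<and> s \<in> space M" for s
    using that path_in by (simp add: Y1_def)
  have AE_Y2: "AE s in M. path s \<in> Y2"
  proof -
    have "AE s in M. AE t in lborel. path_shift t (path s) \<in> Y1"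
    proof (rule AE_swap)
      have "(\<lambda>p. path_shift (fst p) (path (snd p))) \<in> measurable (lborel \<Otimes>\<^sub>M M) path_space"
        by (intro measurable_path_shift measurable_compose[OF measurable_snd measurable_path]) simp
      from measurable_sets[OF this Y1]
      show "{p \<in> space (lborel \<Otimes>\<^sub>M M). path_shift (fst p) (path (snd p)) \<in> Y1} \<in> sets (lborel \<Otimes>\<^sub>M M)"
        by (simp add: vimage_def Int_def conj_commute)
      show "AE s in M. path_shift t (path s) \<in> Y1" for t
        using path_phi[of t] AE_compose[OF UNIV_I AE_good, of t]
        by eventually_elim (metis good_Y1)
    qed
    then show ?thesis using AE_space by eventually_elim (simp add: Y2_def path_in)
  qed
  define \<Psi> where "\<Psi> y = (if y \<in> Y1 then G y else path_code y)" for y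
  define \<Lambda> where "\<Lambda> s = (if s \<in> C then path_decode s else path s)" for s
  have \<Psi>: "\<Psi> \<in> measurable path_space M"
  proof -
    have "path_code \<in> measurable path_space M"
      using path_code_bounds unit by (intro measurable_into_M measurable_path_code) auto
    then show ?thesis unfolding \<Psi>_def using Y1 G sets.sets_into_space[OF Y1]
      by (intro measurable_If_set) (auto simp: Int_absorb2)
  qed
  have \<Lambda>: "\<Lambda> \<in> measurable M path_space"
  proof -
    have "path_decode \<in> measurable M path_space"
      by (rule measurable_compose[OF measurable_M_borel[of "\<lambda>x. x"] measurable_path_decode]) simp
    then show ?thesis unfolding \<Lambda>_def using CM measurable_path sets.sets_into_space[OF CM]
      by (intro measurable_If_set) (auto simp: Int_absorb2)
  qed
  have \<Lambda>\<Psi>: "\<Lambda> (\<Psi> y) = y" if "y \<in> path_set" for y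
    using that code by (auto simp: \<Lambda>_def \<Psi>_def Y1_def path_decode_code)
  define S where "S = {s \<in> space M. \<Lambda> s \<in> Y2} \<inter> {s \<in> space M. \<Psi> (\<Lambda> s) = s}"
  have S: "S \<in> sets M"
  proof -
    have "{s \<in> space M. \<Lambda> s \<in> Y2} = \<Lambda> -` Y2 \<inter> space M" by auto
    then have "{s \<in> space M. \<Lambda> s \<in> Y2} \<in> sets M" using measurable_sets[OF \<Lambda> Y2] by simp
    moreover have "{s \<in> space M. \<Psi> (\<Lambda> s) = s} \<in> sets M"
      by (intro sets_M_eq_points measurable_compose[OF \<Lambda> \<Psi>]) simp
    ultimately show ?thesis unfolding S_def by (rule sets.Int)
  qed
  define \<psi> where "\<psi> t s = (if s \<in> S then \<Psi> (path_shift t (\<Lambda> s)) else s)" for t s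
  have \<psi>_S: "\<psi> t s \<in> S" "\<Lambda> (\<psi> t s) = path_shift t (\<Lambda> s)" if s: "s \<in> S" for t s
  proof -
    have y: "path_shift t (\<Lambda> s) \<in> Y2" using s Y2_shift by (simp add: S_def)
    then show "\<Lambda> (\<psi> t s) = path_shift t (\<Lambda> s)" using s Y2_path by (simp add: \<psi>_def \<Lambda>\<Psi>)
    with y show "\<psi> t s \<in> S"
      using s measurable_space[OF \<Psi>] Y2_path by (simp add: S_def \<psi>_def)
  qed
  have "measurable_flow M UNIV \<psi>"
    unfolding measurable_flow_def is_flow_def
  proof (intro conjI ballI)
    show "\<psi> t \<in> space M \<rightarrow> space M" for t
      using \<psi>_S(1) by (auto simp: \<psi>_def S_def)
    show "\<psi> (t1 + t2) s = \<psi> t2 (\<psi> t1 s)" for t1 t2 s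
      using \<psi>_S[of s t1] by (cases "s \<in> S") (simp_all add: \<psi>_def[of "t1 + t2" s] \<psi>_def[of t2 "\<psi> t1 s"] path_shift_add, simp add: \<psi>_def)
    show "\<psi> 0 s = s" for s
      using Y2_path by (auto simp: \<psi>_def S_def path_shift_0)
    have "(\<lambda>p. \<Psi> (path_shift (fst p) (\<Lambda> (snd p)))) \<in> measurable (borel \<Otimes>\<^sub>M M) M"
      by (intro measurable_compose[OF _ \<Psi>] measurable_path_shift measurable_compose[OF measurable_snd \<Lambda>]) simp
    moreover have "{p \<in> space (borel \<Otimes>\<^sub>M M). snd p \<in> S} \<in> sets (borel \<Otimes>\<^sub>M M)"
      using measurable_sets[OF measurable_snd S, of borel] by (simp add: vimage_def Int_def conj_commute)
    ultimately have "(\<lambda>p. \<psi> (fst p) (snd p)) \<in> measurable (borel \<Otimes>\<^sub>M M) M"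
      unfolding \<psi>_def by (intro measurable_If) simp_all
    moreover have "sets (restrict_space borel UNIV \<Otimes>\<^sub>M M) = sets ((borel :: real measure) \<Otimes>\<^sub>M M)"
      by (intro sets_pair_measure_cong) (simp_all add: sets_restrict_space)
    ultimately show "(\<lambda>(t, s). \<psi> t s) \<in> measurable (restrict_space borel UNIV \<Otimes>\<^sub>M M) M"
      by (simp add: split_beta' cong: measurable_cong_sets)
  qed
  moreover have "AE s in M. \<psi> t s = \<phi> t s" for t
    using AE_good AE_Y2 path_phi[of t] AE_compose[OF UNIV_I AE_good, of t]
  proof eventually_elim
    case (elim s)
    have \<Lambda>s: "\<Lambda> s = path s" using elim(1) by (simp add: \<Lambda>_def)
    have "s \<in> S" using elim(1,2) good_Y1[OF elim(1)] by (simp add: S_def \<Lambda>s \<Psi>_def)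
    then have "\<psi> t s = \<Psi> (path (\<phi> t s))" by (simp add: \<psi>_def \<Lambda>s elim(3))
    also have "\<dots> = \<phi> t s" using good_Y1[OF elim(4)] elim(4) by (simp add: \<Psi>_def)
    finally show ?case .
  qed
  ultimately show ?thesis by blast
qed

end

section \<open>Radon--Nikodym cocycles and uniqueness\<close>

lemma AE_at_atom:
  assumes "AE s in M. P s" "{s} \<in> sets M" "emeasure M {s} \<noteq> 0"
  shows "P s"
proof (rule ccontr)
  assume "\<not> P s"
  obtain N where N: "{s \<in> space M. \<not> P s} \<subseteq> N" "emeasure M N = 0" "N \<in> sets M"
    using AE_E[OF assms(1)] by blast
  have "s \<in> space M" using sets.sets_into_space[OF assms(2)] by simp
  then have "{s} \<subseteq> N" using N(1) \<open>\<not> P s\<close> by auto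
  then have "emeasure M {s} \<le> emeasure M N" using N(3) by (rule emeasure_mono)
  then show False using assms(3) N(2) by simp
qed

locale nonsingular_measurable_flow = time_group T + sigma_finite_measure M
  for T :: "real set" and M :: "'s measure" +
  fixes \<psi> :: "real \<Rightarrow> 's \<Rightarrow> 's"
  assumes flow: "measurable_flow M T \<psi>" and nonsingular: "nonsingular_flow M T \<psi>"
begin

lemma measurable_psi: "t \<in> T \<Longrightarrow> \<psi> t \<in> measurable M M"
  using flow measurable_compose[OF measurable_Pair1'[of t "restrict_space borel T" M], of "\<lambda>(t, s). \<psi> t s" M]
  by (simp add: space_restrict_space measurable_flow_def)

lemma psi_space: "t \<in> T \<Longrightarrow> s \<in> space M \<Longrightarrow> \<psi> t s \<in> space M"
  using measurable_space[OF measurable_psi] .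

lemma psi_add: "t \<in> T \<Longrightarrow> h \<in> T \<Longrightarrow> s \<in> space M \<Longrightarrow> \<psi> t (\<psi> h s) = \<psi> (h + t) s"
  using flow by (simp add: measurable_flow_def is_flow_def)

lemma psi_0: "s \<in> space M \<Longrightarrow> \<psi> 0 s = s"
  using flow by (simp add: measurable_flow_def is_flow_def)

lemma psi_inverse: "t \<in> T \<Longrightarrow> s \<in> space M \<Longrightarrow> \<psi> (- t) (\<psi> t s) = s"
  "t \<in> T \<Longrightarrow> s \<in> space M \<Longrightarrow> \<psi> t (\<psi> (- t) s) = s"
  by (simp_all add: psi_add uminus_T psi_0)

lemma AE_psi:
  assumes t: "t \<in> T" and P: "AE s in M. P s"
  shows "AE s in M. P (\<psi> t s)"
proof -
  obtain N where N: "{s \<in> space M. \<not> P s} \<subseteq> N" "emeasure M N = 0" "N \<in> sets M"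
    using AE_E[OF P] by blast
  have "emeasure M (\<psi> t -` N \<inter> space M) = 0"
    using nonsingular t N by (auto simp: nonsingular_flow_def)
  then show ?thesis
    using N(1) psi_space[OF t] measurable_sets[OF measurable_psi[OF t] N(3)]
    by (intro AE_I[of _ _ "\<psi> t -` N \<inter> space M"]) auto
qed

lemma image_measure_eq: "t \<in> T \<Longrightarrow> image_measure M (\<psi> t) = distr M M (\<psi> (- t))"
proof (rule measure_eqI)
  assume t: "t \<in> T"
  have sets: "sets (image_measure M (\<psi> t)) = sets M"
    unfolding image_measure_def by (simp add: sets.space_closed sets.sigma_sets_eq)
  then show "sets (image_measure M (\<psi> t)) = sets (distr M M (\<psi> (- t)))" by simp
  fix A assume "A \<in> sets (image_measure M (\<psi> t))"
  then have A: "A \<in> sets M" by (simp add: sets)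
  have m: "\<psi> (- t) \<in> measurable M M" using t by (intro measurable_psi uminus_T)
  have "emeasure (image_measure M (\<psi> t)) A = emeasure M (\<psi> t ` A)"
    using t A psi_space psi_inverse m by (intro emeasure_image_measure) auto
  also have "\<psi> t ` A = \<psi> (- t) -` A \<inter> space M"
  proof (intro set_eqI iffI)
    fix s assume "s \<in> \<psi> t ` A"
    then show "s \<in> \<psi> (- t) -` A \<inter> space M"
      using sets.sets_into_space[OF A] psi_inverse(1)[OF t] psi_space[OF t] by auto
  next
    fix s assume "s \<in> \<psi> (- t) -` A \<inter> space M"
    then show "s \<in> \<psi> t ` A"
      using psi_inverse(2)[OF t, of s] by (intro image_eqI[of _ _ "\<psi> (- t) s"]) auto
  qed
  also have "emeasure M \<dots> = emeasure (distr M M (\<psi> (- t))) A"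
    using A by (simp add: emeasure_distr[OF m])
  finally show "emeasure (image_measure M (\<psi> t)) A = emeasure (distr M M (\<psi> (- t))) A" .
qed

definition flow_deriv :: "real \<Rightarrow> 's \<Rightarrow> ennreal" where
  "flow_deriv t = RN_deriv M (image_measure M (\<psi> t))"

lemma measurable_flow_deriv [measurable]: "flow_deriv t \<in> borel_measurable M"
  unfolding flow_deriv_def by simp

lemma ac_distr: "t \<in> T \<Longrightarrow> absolutely_continuous M (distr M M (\<psi> t))"
  using nonsingular measurable_psi[of t]
  by (auto simp: absolutely_continuous_def nonsingular_flow_def null_sets_def emeasure_distr)

lemma density_flow_deriv: "t \<in> T \<Longrightarrow> density M (flow_deriv t) = distr M M (\<psi> (- t))"
  unfolding flow_deriv_def image_measure_eq using ac_distr[OF uminus_T]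
  by (intro density_RN_deriv) auto

text \<open>The measure \<open>image_measure M (\<psi> t)\<close> is \<open>\<sigma>\<close>-finite because \<open>\<psi> t\<close> is a bijection that carries it to
\<open>M\<close>.\<close>

lemma flow_deriv_finite:
  assumes t: "t \<in> T"
  shows "AE s in M. flow_deriv t s \<noteq> \<infinity>"
proof -
  obtain A where A: "countable A" "A \<subseteq> sets M" "\<Union>A = space M" "\<forall>a\<in>A. emeasure M a \<noteq> \<infinity>"
    using sigma_finite_countable by blast
  have m: "\<psi> (- t) \<in> measurable M M" "\<psi> t \<in> measurable M M" using t by (auto intro: measurable_psi uminus_T)
  have "sigma_finite_measure (distr M M (\<psi> (- t)))"
  proof (rule sigma_finite_measure.intro, intro exI conjI)
    let ?B = "(\<lambda>a. \<psi> t -` a \<inter> space M) ` A"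
    show "countable ?B" using A by simp
    show "?B \<subseteq> sets (distr M M (\<psi> (- t)))" using A(2) m(2) by auto
    have "\<Union>?B = \<psi> t -` \<Union>A \<inter> space M" by auto
    then show "\<Union>?B = space (distr M M (\<psi> (- t)))" using A(3) psi_space[OF t] by auto
    show "\<forall>b\<in>?B. emeasure (distr M M (\<psi> (- t))) b \<noteq> \<infinity>"
    proof clarify
      fix a assume a: "a \<in> A" and inf: "emeasure (distr M M (\<psi> (- t))) (\<psi> t -` a \<inter> space M) = \<infinity>"
      have "a \<subseteq> space M" using sets.sets_into_space[of a M] a A(2) by blast
      then have "\<psi> (- t) -` (\<psi> t -` a \<inter> space M) \<inter> space M = a"
        using psi_inverse(2)[OF t] psi_space[OF uminus_T[OF t]] by auto
      then have "emeasure M a = \<infinity>"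
        using inf a A(2) m by (subst (asm) emeasure_distr) auto
      then show False using A(4) a by blast
    qed
  qed
  then show ?thesis
    unfolding flow_deriv_def image_measure_eq[OF t] using ac_distr[OF uminus_T[OF t]]
    by (intro RN_deriv_finite) auto
qed

lemma flow_deriv_pos:
  assumes t: "t \<in> T"
  shows "AE s in M. flow_deriv t s \<noteq> 0"
proof -
  let ?Z = "{s \<in> space M. flow_deriv t s = 0}"
  have Z: "?Z \<in> sets M" by measurable
  have m: "\<psi> (- t) \<in> measurable M M" using t by (intro measurable_psi uminus_T)
  have "emeasure (density M (flow_deriv t)) ?Z = (\<integral>\<^sup>+s. flow_deriv t s * indicator ?Z s \<partial>M)"
    using Z by (subst emeasure_density) auto
  also have "\<dots> = (\<integral>\<^sup>+s. 0 \<partial>M)"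
    by (intro nn_integral_cong) (auto split: split_indicator)
  finally have "emeasure M (\<psi> (- t) -` ?Z \<inter> space M) = 0"
    using Z m by (simp add: density_flow_deriv[OF t] emeasure_distr)
  then have "emeasure M ?Z = 0"
    using nonsingular uminus_T[OF t] Z unfolding nonsingular_flow_def by blast
  then show ?thesis using Z by (intro AE_I[of _ _ ?Z]) auto
qed

text \<open>The chain rule: both sides are densities of the image measure of \<open>\<psi> (h + t)\<close>, which is the image
measure of \<open>\<psi> t\<close> taken back along \<open>\<psi> h\<close>.\<close>

lemma flow_deriv_cocycle:
  assumes t: "t \<in> T" and h: "h \<in> T"
  shows "AE s in M. flow_deriv (h + t) s = flow_deriv h s * flow_deriv t (\<psi> h s)"
proof -
  note m = measurable_psi[OF h] measurable_psi[OF uminus_T[OF h]] measurable_psi[OF uminus_T[OF t]]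
  note m [measurable]
  have eq: "density M (\<lambda>s. flow_deriv h s * flow_deriv t (\<psi> h s)) = image_measure M (\<psi> (h + t))"
  proof (rule measure_eqI)
    show "sets (density M (\<lambda>s. flow_deriv h s * flow_deriv t (\<psi> h s))) = sets (image_measure M (\<psi> (h + t)))"
      using add_T[OF h t] by (simp add: image_measure_eq)
    fix A assume "A \<in> sets (density M (\<lambda>s. flow_deriv h s * flow_deriv t (\<psi> h s)))"
    then have A [measurable]: "A \<in> sets M" by simp
    have "emeasure (density M (\<lambda>s. flow_deriv h s * flow_deriv t (\<psi> h s))) A =
        (\<integral>\<^sup>+s. flow_deriv h s * (flow_deriv t (\<psi> h s) * indicator A s) \<partial>M)"
      by (subst emeasure_density) (auto simp: mult.assoc)
    also have "\<dots> = (\<integral>\<^sup>+s. flow_deriv t (\<psi> h s) * indicator A s \<partial>density M (flow_deriv h))"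
      by (subst nn_integral_density) auto
    also have "\<dots> = (\<integral>\<^sup>+s. flow_deriv t (\<psi> h (\<psi> (- h) s)) * indicator A (\<psi> (- h) s) \<partial>M)"
      unfolding density_flow_deriv[OF h] by (subst nn_integral_distr) auto
    also have "\<dots> = (\<integral>\<^sup>+s. flow_deriv t s * indicator (\<psi> (- h) -` A \<inter> space M) s \<partial>M)"
      by (intro nn_integral_cong) (auto simp: psi_inverse(2)[OF h] indicator_def)
    also have "\<dots> = emeasure (distr M M (\<psi> (- t))) (\<psi> (- h) -` A \<inter> space M)"
      unfolding density_flow_deriv[OF t, symmetric] by (subst emeasure_density) auto
    also have "\<dots> = emeasure M (\<psi> (- t) -` (\<psi> (- h) -` A \<inter> space M) \<inter> space M)"
      by (subst emeasure_distr) auto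
    also have "\<psi> (- t) -` (\<psi> (- h) -` A \<inter> space M) \<inter> space M = \<psi> (- (h + t)) -` A \<inter> space M"
    proof -
      have "- t + - h = - (h + t)" by simp
      then have "\<psi> (- h) (\<psi> (- t) s) = \<psi> (- (h + t)) s" if "s \<in> space M" for s
        using psi_add[OF uminus_T[OF h] uminus_T[OF t] that] by (simp only:)
      then show ?thesis using psi_space[OF uminus_T[OF t]] by auto
    qed
    also have "emeasure M \<dots> = emeasure (image_measure M (\<psi> (h + t))) A"
      unfolding image_measure_eq[OF add_T[OF h t]]
      by (rule emeasure_distr[symmetric, OF measurable_psi[OF uminus_T[OF add_T[OF h t]]] A])
    finally show "emeasure (density M (\<lambda>s. flow_deriv h s * flow_deriv t (\<psi> h s))) A =
      emeasure (image_measure M (\<psi> (h + t))) A" .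
  qed
  have "AE s in M. flow_deriv h s * flow_deriv t (\<psi> h s) = RN_deriv M (image_measure M (\<psi> (h + t))) s"
    by (rule RN_deriv_unique[OF _ eq]) measurable
  then show ?thesis unfolding flow_deriv_def[of "h + t"] by eventually_elim simp
qed

end

context spectral_coordinates
begin

text \<open>The cocycle rule replaces \<open>f (u i + h) = c * f 0\<close> at \<open>\<psi> (u i + h) s\<close> by a multiple of \<open>f (u i)\<close> at
\<open>\<psi> h s\<close> with a factor \<open>c h s\<close> that is the same for all \<open>i\<close>.\<close>

lemma flow_determined:
  assumes sf: "sigma_finite_measure M"
    and flow: "measurable_flow M T \<psi>" "nonsingular_flow M T \<psi>" and rep: "flow_represents M \<alpha> T f \<psi>"
    and h: "h \<in> T"
  shows "AE s in M. \<psi> h s = near_map h s"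
proof -
  interpret sigma_finite_measure M by (rule sf)
  interpret nonsingular_measurable_flow T M \<psi>
    by unfold_locales (rule flow)+
  define c where "c t s = enn2real (flow_deriv t s) powr (1 / \<alpha>)" for t s
  have rep: "AE s in M. f t s = c t s * f 0 (\<psi> t s)" if "t \<in> T" for t
    using rep that by (simp add: flow_represents_def c_def flow_deriv_def)
  have "AE s in M. 0 < c h s"
    using flow_deriv_finite[OF h] flow_deriv_pos[OF h]
  proof eventually_elim
    case (elim s)
    then have "0 < enn2real (flow_deriv h s)"
      by (simp add: enn2real_positive_iff less_top zero_less_iff_neq_zero)
    then show ?case by (simp add: c_def)
  qed
  moreover have "AE s in M. \<forall>i. f (u i + h) s = c h s * f (u i) (\<psi> h s)"
    unfolding AE_all_countable
  proof
    fix i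
    note ui = u[of i]
    show "AE s in M. f (u i + h) s = c h s * f (u i) (\<psi> h s)"
      using rep[OF add_T[OF ui h]] AE_psi[OF h rep[OF ui]] flow_deriv_cocycle[OF ui h] AE_space
    proof eventually_elim
      case (elim s)
      have "c (u i + h) s = c h s * c (u i) (\<psi> h s)"
        using elim(3) by (simp add: c_def add.commute enn2real_mult powr_mult)
      then show ?case using elim by (simp add: psi_add[OF ui h] add.commute)
    qed
  qed
  ultimately have "AE s in M. 0 < c h s \<and> (\<forall>i. f (u i + h) s = c h s * f (u i) (\<psi> h s))"
    by eventually_elim blast
  then show ?thesis by (rule near_map_unique[OF _ AE_psi[OF h recover]])
qed

lemma near_action: "sigma_finite_measure M \<Longrightarrow> near_action T M near_map"
  by (intro near_action.intro near_action_axioms.intro time_group_axioms measurable_near_map_joint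
      near_map_0 near_map_add AE_near_map)

text \<open>That images of null sets are null follows from the same property of the inverse time.\<close>

lemma strict_version_nonsingular:
  assumes flow: "measurable_flow M T \<psi>" and eq: "\<And>t. t \<in> T \<Longrightarrow> AE s in M. \<psi> t s = near_map t s"
  shows "nonsingular_flow M T \<psi>"
proof -
  have is_flow: "is_flow M T \<psi>" using flow by (simp add: measurable_flow_def)
  have meas: "\<psi> t \<in> measurable M M" if "t \<in> T" for t
    using flow that measurable_compose[OF measurable_Pair1'[of t "restrict_space borel T" M], of "\<lambda>(t, s). \<psi> t s" M]
    by (simp add: space_restrict_space measurable_flow_def)
  have inv: "\<psi> t (\<psi> (- t) s) = s" if "t \<in> T" "s \<in> space M" for t s
  proof -
    have "\<psi> (- t + t) s = \<psi> t (\<psi> (- t) s)" "\<psi> 0 s = s"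
      using is_flow that uminus_T[OF that(1)] unfolding is_flow_def by blast+
    then show ?thesis by simp
  qed
  have AE_psi: "AE s in M. P (\<psi> t s)" if "t \<in> T" "AE s in M. P s" for P t
    using eq[OF that(1)] AE_near_map[OF that] by eventually_elim simp
  show "nonsingular_flow M T \<psi>"
    unfolding nonsingular_flow_def
  proof (intro conjI ballI is_flow)
    fix t A assume t: "t \<in> T" and A: "A \<in> sets M"
    have pre: "\<psi> t -` A \<inter> space M \<in> sets M" using measurable_sets[OF meas[OF t] A] .
    have null_iff: "emeasure M B = 0 \<longleftrightarrow> (AE s in M. s \<notin> B)" if "B \<in> sets M" for B
      using AE_iff_null_sets[OF that] that by (auto simp: null_sets_def)
    have "(AE s in M. \<psi> t s \<notin> A) \<longleftrightarrow> (AE s in M. s \<notin> A)"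
    proof
      assume "AE s in M. \<psi> t s \<notin> A"
      from AE_psi[OF uminus_T[OF t] this] show "AE s in M. s \<notin> A"
        using AE_space by eventually_elim (simp add: inv[OF t])
    qed (rule AE_psi[OF t])
    moreover have "(AE s in M. s \<notin> \<psi> t -` A \<inter> space M) \<longleftrightarrow> (AE s in M. \<psi> t s \<notin> A)"
      by (intro AE_cong) auto
    ultimately show "(emeasure M (\<psi> t -` A \<inter> space M) = 0) = (emeasure M A = 0)"
      using null_iff[OF pre] null_iff[OF A] by simp
  qed
qed

text \<open>The change of variables formula, applied to functions of the form \<open>k \<circ> \<psi> (- t)\<close>, says that
\<open>near_jac t powr \<alpha>\<close> is a density of the image measure of \<open>\<psi> t\<close>.\<close>

lemma strict_version_represents:
  assumes sf: "sigma_finite_measure M"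
    and flow: "measurable_flow M T \<psi>" and eq: "\<And>t. t \<in> T \<Longrightarrow> AE s in M. \<psi> t s = near_map t s"
  shows "flow_represents M \<alpha> T f \<psi>"
proof -
  interpret sigma_finite_measure M by (rule sf)
  interpret nonsingular_measurable_flow T M \<psi>
    using flow strict_version_nonsingular[OF flow eq] by unfold_locales
  show "flow_represents M \<alpha> T f \<psi>"
    unfolding flow_represents_def
  proof
    fix t assume t: "t \<in> T"
    note m = measurable_psi[OF uminus_T[OF t]]
    have "density M (\<lambda>s. ennreal (near_jac t s powr \<alpha>)) = image_measure M (\<psi> t)"
      unfolding image_measure_eq[OF t]
    proof (rule measure_eqI)
      fix A assume "A \<in> sets (density M (\<lambda>s. ennreal (near_jac t s powr \<alpha>)))"
      then have A: "A \<in> sets M" by simp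
      have "emeasure (density M (\<lambda>s. ennreal (near_jac t s powr \<alpha>))) A =
          (\<integral>\<^sup>+s. ennreal (near_jac t s powr \<alpha>) * indicator A s \<partial>M)"
        using A measurable_near_jac[OF t] by (subst emeasure_density) auto
      also have "\<dots> = (\<integral>\<^sup>+s. indicator A (\<psi> (- t) (near_map t s)) * ennreal (near_jac t s powr \<alpha>) \<partial>M)"
      proof (rule nn_integral_cong_AE)
        show "AE s in M. ennreal (near_jac t s powr \<alpha>) * indicator A s =
            indicator A (\<psi> (- t) (near_map t s)) * ennreal (near_jac t s powr \<alpha>)"
          using eq[OF t] AE_space
        proof eventually_elim
          case (elim s)
          then show ?case using psi_inverse(1)[OF t elim(2)] by (simp add: mult.commute)
        qed
      qed
      also have "\<dots> = (\<integral>\<^sup>+s. indicator A (\<psi> (- t) s) \<partial>M)"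
        by (rule nn_integral_near_map[OF t measurable_compose[OF m borel_measurable_indicator[OF A]]])
      also have "\<dots> = (\<integral>\<^sup>+s. indicator A s \<partial>distr M M (\<psi> (- t)))"
        using A m by (subst nn_integral_distr) auto
      also have "\<dots> = emeasure (distr M M (\<psi> (- t))) A" using A by simp
      finally show "emeasure (density M (\<lambda>s. ennreal (near_jac t s powr \<alpha>))) A = emeasure (distr M M (\<psi> (- t))) A" .
    qed simp
    from RN_deriv_unique[OF _ this] measurable_near_jac[OF t]
    have "AE s in M. ennreal (near_jac t s powr \<alpha>) = RN_deriv M (image_measure M (\<psi> t)) s" by simp
    then show "AE s in M. f t s = enn2real (RN_deriv M (image_measure M (\<psi> t)) s) powr (1 / \<alpha>) * f 0 (\<psi> t s)"
      using near_map_represents[OF t zero_T] AE_near_jac[OF t] eq[OF t]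
    proof eventually_elim
      case (elim s)
      have "enn2real (RN_deriv M (image_measure M (\<psi> t)) s) powr (1 / \<alpha>) = near_jac t s"
        using elim(3) alpha_pos by (simp add: elim(1)[symmetric] powr_powr)
      then show ?case using elim(2,4) by simp
    qed
  qed
qed

lemma unique_flow:
  assumes sf: "sigma_finite_measure M"
    and strict: "\<exists>\<phi>. measurable_flow M T \<phi> \<and> (\<forall>t\<in>T. AE s in M. \<phi> t s = near_map t s)"
  shows "\<exists>\<phi>. measurable_flow M T \<phi> \<and> nonsingular_flow M T \<phi> \<and> flow_represents M \<alpha> T f \<phi> \<and>
           (\<forall>\<psi>. measurable_flow M T \<psi> \<and> nonsingular_flow M T \<psi> \<and> flow_represents M \<alpha> T f \<psi> \<longrightarrow>
                (\<forall>t\<in>T. AE s in M. \<psi> t s = \<phi> t s))"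
proof -
  obtain \<phi> where \<phi>: "measurable_flow M T \<phi>" "\<And>t. t \<in> T \<Longrightarrow> AE s in M. \<phi> t s = near_map t s"
    using strict by blast
  have "AE s in M. \<psi> t s = \<phi> t s"
    if "measurable_flow M T \<psi>" "nonsingular_flow M T \<psi>" "flow_represents M \<alpha> T f \<psi>" "t \<in> T" for \<psi> t
    using flow_determined[OF sf that] \<phi>(2)[OF that(4)] by eventually_elim simp
  with \<phi>(1) strict_version_nonsingular[OF \<phi>] strict_version_represents[OF sf \<phi>] show ?thesis by blast
qed

end

section \<open>Flows on the standard spaces\<close>

lemma sets_std_measure_iff: "A \<in> sets (std_measure I N) \<longleftrightarrow> A \<in> sets borel \<and> A \<subseteq> std_space I N"
  using std_space_borel by (auto simp: sets_restrict_space_iff)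

lemma std_measure_atom:
  assumes "real n \<in> std_space I N"
  shows "emeasure (std_measure I N) {real n} = 1"
proof -
  have "{real n} \<inter> {0<..<1} = {}" by auto
  then show ?thesis using assms by (subst emeasure_std_measure) auto
qed

lemma sigma_finite_std_measure: "sigma_finite_measure (std_measure I N)"
proof (rule sigma_finite_measure.intro, intro exI conjI)
  let ?A = "insert (std_space I N \<inter> {0<..<1}) ((\<lambda>n. {real n}) ` {n. real n \<in> std_space I N})"
  show "countable ?A" by simp
  show "?A \<subseteq> sets (std_measure I N)" using std_space_borel by (auto simp: sets_std_measure_iff simp del: sets_std_measure)
  show "\<Union>?A = space (std_measure I N)" by (auto simp: std_space_def split: if_splits)
  have "emeasure (std_measure I N) (std_space I N \<inter> {0<..<1}) \<noteq> \<infinity>"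
  proof -
    have "(x::real) \<notin> \<nat>" if "0 < x" "x < 1" for x
      using that by (auto elim!: Nats_cases)
    then have "std_space I N \<inter> {0<..<1} \<inter> \<nat> = {}" by auto
    moreover have "emeasure lborel (std_space I N \<inter> {0<..<1} \<inter> {0<..<1}) \<le> emeasure lborel {0<..<1::real}"
      by (intro emeasure_mono) auto
    ultimately show ?thesis by (subst emeasure_std_measure) (auto simp: top_unique)
  qed
  then show "\<forall>a\<in>?A. emeasure (std_measure I N) a \<noteq> \<infinity>" by (auto simp: std_measure_atom)
qed

lemma std_measure_null_unit:
  assumes "A \<in> sets borel" "A \<subseteq> {0<..<1}" "emeasure lborel A = 0"
  shows "emeasure (std_measure 1 N) A = 0"
proof -
  have "(x::real) \<notin> \<nat>" if "0 < x" "x < 1" for x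
    using that by (auto elim!: Nats_cases)
  then have "A \<inter> \<nat> = {}" "A \<inter> {0<..<1} = A" using assms(2) by auto
  moreover have "A \<subseteq> std_space 1 N" using assms(2) by (auto simp: std_space_def)
  ultimately show ?thesis using assms by (simp add: emeasure_std_measure)
qed

lemma unique_flow_of_empty_space:
  assumes "space M = {}"
  shows "\<exists>\<phi>. measurable_flow M T \<phi> \<and> nonsingular_flow M T \<phi> \<and> flow_represents M \<alpha> T f \<phi> \<and>
           (\<forall>\<psi>. measurable_flow M T \<psi> \<and> nonsingular_flow M T \<psi> \<and> flow_represents M \<alpha> T f \<psi> \<longrightarrow>
                (\<forall>t\<in>T. AE s in M. \<psi> t s = \<phi> t s))"
proof -
  have AE: "AE s in M. P s" for P using assms by (intro AE_I2) simp
  have "A = {}" if "A \<in> sets M" for A using sets.sets_into_space[OF that] assms by simp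
  then have "measurable_flow M T (\<lambda>t s. s) \<and> nonsingular_flow M T (\<lambda>t s. s)"
    using assms by (auto simp: measurable_flow_def nonsingular_flow_def is_flow_def split_beta')
  then show ?thesis by (auto simp: flow_represents_def AE intro!: exI[of _ "\<lambda>t s. s"])
qed

theorem theorem6p1:
  fixes P :: "'a measure" and X :: "real \<Rightarrow> 'a \<Rightarrow> real"
    and \<alpha> :: real and T :: "real set"
    and I :: nat and N :: enat and f :: "real \<Rightarrow> real \<Rightarrow> real"
  assumes "prob_space P"
    and "\<alpha> > 0"
    and "T = UNIV \<or> T = \<int>"
    and "stationary_process P T X"
    and "frechet_process P \<alpha> T X"
    and "I \<in> {0, 1}"
    and "spectral_representation P (std_measure I N) \<alpha> T X f"
    and "jointly_measurable (std_measure I N) T f"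
    and "minimal_representation (std_measure I N) \<alpha> T f"
  shows "\<exists>\<phi>. measurable_flow (std_measure I N) T \<phi> \<and>
           nonsingular_flow (std_measure I N) T \<phi> \<and>
           flow_represents (std_measure I N) \<alpha> T f \<phi> \<and>
           (\<forall>\<psi>. measurable_flow (std_measure I N) T \<psi> \<and>
                nonsingular_flow (std_measure I N) T \<psi> \<and>
                flow_represents (std_measure I N) \<alpha> T f \<psi> \<longrightarrow>
                (\<forall>t\<in>T. AE s in std_measure I N. \<psi> t s = \<phi> t s))"
proof (cases "std_space I N = {}")
  case True
  then show ?thesis by (intro unique_flow_of_empty_space) simp
next
  case False
  let ?M = "std_measure I N"
  interpret time_group T
    using assms(3) by unfold_locales auto
  have f: "f t \<in> L_plus ?M \<alpha>" if "t \<in> T" for t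
    using assms(7) that by (simp add: spectral_representation_def)
  obtain u G where uG: "range u \<subseteq> T" "AE s in ?M. \<exists>i::nat. f (u i) s \<noteq> 0" "G \<in> measurable seq_space ?M"
    "AE s in ?M. G (normalize_seq (\<lambda>i. f (u i) s)) = s"
    using minimal_representation_coordinates[OF _ _ _ _ f assms(9)] False zero_T by auto
  interpret spectral_coordinates T \<alpha> ?M f u G
  proof
    show "same_max_integrals \<alpha> ?M (\<lambda>i. f (v i)) ?M (\<lambda>i. f (v i + h))" if "\<And>i. v i \<in> T" "h \<in> T" for v h
      by (rule stationary_same_max_integrals[OF assms(4,7) add_T that])
  qed (use assms f uG in auto)
  note sf = sigma_finite_std_measure[of I N]
  interpret near_action T ?M near_map by (rule near_action[OF sf])
  show ?thesis
  proof (rule unique_flow[OF sf])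
    \<comment> \<open>without the continuous part every point is an atom, so no nonempty set is null\<close>
    consider "I = 0" | "T = \<int>" | "T = UNIV" "I = 1" using assms(3,6) by auto
    then show "\<exists>\<phi>. measurable_flow ?M T \<phi> \<and> (\<forall>t\<in>T. AE s in ?M. \<phi> t s = near_map t s)"
    proof cases
      case 1
      show ?thesis
      proof (rule strict_flow_of_no_null_sets)
        fix P s assume ae: "AE s in ?M. P s" and s: "s \<in> space ?M"
        obtain n where n: "s = real n" using s 1 by (auto simp: std_space_def)
        show "P s"
        proof (rule AE_at_atom[OF ae])
          show "{s} \<in> sets ?M" using s by (simp add: sets_std_measure_iff del: sets_std_measure)
          show "emeasure ?M {s} \<noteq> 0" using s n by (simp add: std_measure_atom)
        qed
      qed
    next
      case 2
      then show ?thesis by (intro strict_flow_of_countable) (simp add: Ints_def)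
    next
      case 3
      interpret real_near_action ?M near_map
      proof (intro real_near_action.intro real_near_action_axioms.intro)
        show "near_action UNIV ?M near_map" using near_action[OF sf] 3 by simp
        show "{0<..<1} \<subseteq> space ?M" using 3 by (auto simp: std_space_def)
        show "emeasure ?M A = 0" if "A \<in> sets borel" "A \<subseteq> {0<..<1}" "emeasure lborel A = 0" for A
          using std_measure_null_unit[OF that] 3 by simp
      qed simp_all
      show ?thesis using strict_flow 3 by simp
    qed
  qed
qed

end
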